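(* For the two-dimensional isentropic MHD system below, let $(U_l,U_r,\sigma_2)$ be a 2-shock wave with either $B_l>B_r>0$ or $B_l<B_r<0$. Then there is no weight $a>0$ such that $(U_l,U_r,\sigma_2)$ satisfies $a$-contraction. Likewise, if $(\tilde U_l,\tilde U_r,\sigma_3)$ is a 3-shock wave with either $\tilde B_r>\tilde B_l>0$ or $\tilde B_r<\tilde B_l<0$, there is no $a>0$ such that it satisfies $a$-contraction.
   Context: The system (Lagrangian coordinates) is $\partial_t v-\partial_x u=0$, $\partial_t(vB)-\beta\partial_x w=0$, $\partial_t u+\partial_x(p(v)+\tfrac12B^2)=0$, $\partial_t w-\beta\partial_x B=0$, with $\beta$ a fixed nonzero real constant, $p(v)=v^{-\gamma}$, $\gamma>1$, $v>0$. Conservative variables $U=(v,q,u,w)$ with $q=vB$; entropy $\eta(U)=\int_v^\infty p(s)\,ds+\tfrac12(u^2+w^2)+\frac{q^2}{2v}$, with entropy flux $Q$ satisfying $\nabla Q=\nabla\eta\,\nabla F$ where $F$ is the flux; states with $B\neq0$ are considered. With $c=\sqrt{-p'(v)}$ and $\alpha_\pm=\tfrac12\Big[\frac{B^2+\beta^2}{v}+c^2\pm\sqrt{(\frac{B^2+\beta^2}{v}+c^2)^2-4\beta^2\frac{c^2}{v}}\Big]$, the characteristic speeds are $\lambda_1=-\sqrt{\alpha_+}<\lambda_2=-\sqrt{\alpha_-}<\lambda_3=\sqrt{\alpha_-}<\lambda_4=\sqrt{\alpha_+}$. A $k$-shock wave $(U_l,U_r,\sigma)$ is an entropic (Lax)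 Rankine–Hugoniot discontinuity of the $k$-th characteristic family: $F(U_r)-F(U_l)=\sigma(U_r-U_l)$, $Q(U_r)-Q(U_l)\le\sigma(\eta(U_r)-\eta(U_l))$, with $U_r$ on the $k$-shock curve from $U_l$. Relative entropy $\eta(U|V)=\eta(U)-\eta(V)-\nabla\eta(V)\cdot(U-V)$. a-contraction: with $E_a(U(t),h)=\int_{-\infty}^h\eta(U(t,x)|U_l)dx+a\int_h^\infty\eta(U(t,x)|U_r)dx$ and $S(x)=U_l$ ($x<0$), $U_r$ ($x>0$), the discontinuity satisfies $a$-contraction if for every bounded convex set $\mathcal U_K$ of states there is $C_K$ such that for every entropy weak solution $U\in\mathcal U_K\cap BV_{loc}((0,T)\times\mathbb R)^4$ (i.e. weak solution with $\partial_t\eta(U)+\partial_xQ(U)\le0$) with initial datum $U_0$, $E_a(U_0,0)<\infty$, there is a Lipschitz $h$, $h(0)=0$, with $E_a(U(t),h(t))\le E_a(U(s),h(s))$ for a.e. $t>s>0$, $|h'(t)|\le C_K$ and $|h(t)-\sigma t|\le C_K\sqrt t\|U_0-S\|_{L^2}$. *)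

theory Defs
  imports "HOL-Analysis.Analysis"
begin

text \<open>States U = (v,q,u,w) with q = v B are vectors in real^4:
  U$1 = v, U$2 = q, U$3 = u, U$4 = w.\<close>

definition pres :: "real \<Rightarrow> real \<Rightarrow> real" where
  "pres \<gamma> v = v powr (- \<gamma>)"

definition magB :: "real^4 \<Rightarrow> real" where
  "magB U = U$2 / U$1"

definition flux :: "real \<Rightarrow> real \<Rightarrow> real^4 \<Rightarrow> real^4" where
  "flux \<beta> \<gamma> U = vector [ - (U$3), - \<beta> * U$4,
                            pres \<gamma> (U$1) + (magB U)\<^sup>2 / 2, - \<beta> * magB U ]"

definition ent :: "real \<Rightarrow> real^4 \<Rightarrow> real" where
  "ent \<gamma> U = integral {U$1..} (\<lambda>s. pres \<gamma> s) + ((U$3)\<^sup>2 + (U$4)\<^sup>2) / 2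
              + (U$2)\<^sup>2 / (2 * U$1)"

definition phys_dom :: "(real^4) set" where
  "phys_dom = {U. 0 < U$1}"

definition is_entropy_flux :: "real \<Rightarrow> real \<Rightarrow> (real^4 \<Rightarrow> real) \<Rightarrow> bool" where
  "is_entropy_flux \<beta> \<gamma> Q \<longleftrightarrow> (\<forall>U\<in>phys_dom.
     (Q has_derivative
        (\<lambda>dU. frechet_derivative (ent \<gamma>) (at U) (frechet_derivative (flux \<beta> \<gamma>) (at U) dU))) (at U))"

definition rel_ent :: "real \<Rightarrow> real^4 \<Rightarrow> real^4 \<Rightarrow> real" where
  "rel_ent \<gamma> U V = ent \<gamma> U - ent \<gamma> V - frechet_derivative (ent \<gamma>) (at V) (U - V)"

definition sound :: "real \<Rightarrow> real \<Rightarrow> real" where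
  "sound \<gamma> v = sqrt (- deriv (pres \<gamma>) v)"

definition alpha :: "real \<Rightarrow> real \<Rightarrow> real \<Rightarrow> real^4 \<Rightarrow> real" where
  "alpha s \<beta> \<gamma> U =
     (let v = U$1; B = magB U; c = sound \<gamma> v;
          A = (B\<^sup>2 + \<beta>\<^sup>2) / v + c\<^sup>2
      in (A + s * sqrt (A\<^sup>2 - 4 * \<beta>\<^sup>2 * c\<^sup>2 / v)) / 2)"

definition char_speed :: "real \<Rightarrow> real \<Rightarrow> nat \<Rightarrow> real^4 \<Rightarrow> real" where
  "char_speed \<beta> \<gamma> k U =
     (if k = 1 then - sqrt (alpha 1 \<beta> \<gamma> U)
      else if k = 2 then - sqrt (alpha (-1) \<beta> \<gamma> U)
      else if k = 3 then sqrt (alpha (-1) \<beta> \<gamma> U)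
      else sqrt (alpha 1 \<beta> \<gamma> U))"

text \<open>k-shock wave (k in {1..4}): Rankine-Hugoniot, entropy inequality, and
  Lax conditions selecting the k-th characteristic family; states with v>0, B\<noteq>0.\<close>
definition k_shock :: "real \<Rightarrow> real \<Rightarrow> (real^4 \<Rightarrow> real) \<Rightarrow> nat \<Rightarrow> real^4 \<Rightarrow> real^4 \<Rightarrow> real \<Rightarrow> bool" where
  "k_shock \<beta> \<gamma> Q k Ul Ur \<sigma> \<longleftrightarrow>
     1 \<le> k \<and> k \<le> 4 \<and>
     Ul \<in> phys_dom \<and> Ur \<in> phys_dom \<and> magB Ul \<noteq> 0 \<and> magB Ur \<noteq> 0 \<and>
     flux \<beta> \<gamma> Ur - flux \<beta> \<gamma> Ul = \<sigma> *\<^sub>R (Ur - Ul) \<and>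
     Q Ur - Q Ul \<le> \<sigma> * (ent \<gamma> Ur - ent \<gamma> Ul) \<and>
     char_speed \<beta> \<gamma> k Ur < \<sigma> \<and> \<sigma> < char_speed \<beta> \<gamma> k Ul \<and>
     (k > 1 \<longrightarrow> char_speed \<beta> \<gamma> (k - 1) Ul < \<sigma>) \<and>
     (k < 4 \<longrightarrow> \<sigma> < char_speed \<beta> \<gamma> (k + 1) Ur)"

definition pdt :: "(real \<times> real \<Rightarrow> real) \<Rightarrow> real \<times> real \<Rightarrow> real" where
  "pdt \<phi> z = deriv (\<lambda>s. \<phi> (s, snd z)) (fst z)"

definition pdx :: "(real \<times> real \<Rightarrow> real) \<Rightarrow> real \<times> real \<Rightarrow> real" where
  "pdx \<phi> z = deriv (\<lambda>y. \<phi> (fst z, y)) (snd z)"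

definition test_fn :: "(real \<times> real) set \<Rightarrow> (real \<times> real \<Rightarrow> real) \<Rightarrow> bool" where
  "test_fn K \<phi> \<longleftrightarrow> (\<forall>z. \<phi> differentiable (at z)) \<and>
     continuous_on UNIV (pdt \<phi>) \<and> continuous_on UNIV (pdx \<phi>) \<and>
     compact (closure {z. \<phi> z \<noteq> 0}) \<and> closure {z. \<phi> z \<noteq> 0} \<subseteq> K"

text \<open>Scalar BV_loc on an open set \<Omega> of the (t,x)-plane: locally integrable and
  the distributional gradient has locally finite total variation.\<close>
definition bv_loc :: "(real \<times> real) set \<Rightarrow> (real \<times> real \<Rightarrow> real) \<Rightarrow> bool" where
  "bv_loc \<Omega> f \<longleftrightarrow> set_borel_measurable lborel \<Omega> f \<and>
     (\<forall>K. compact K \<and> K \<subseteq> \<Omega> \<longrightarrow> set_integrable lborel K f \<and>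
        (\<exists>M. \<forall>\<psi>1 \<psi>2. test_fn K \<psi>1 \<and> test_fn K \<psi>2 \<and> (\<forall>z. (\<psi>1 z)\<^sup>2 + (\<psi>2 z)\<^sup>2 \<le> 1) \<longrightarrow>
              \<bar>\<integral>z\<in>K. f z * (pdt \<psi>1 z + pdx \<psi>2 z) \<partial>lborel\<bar> \<le> M))"

definition entropy_weak_sol ::
  "real \<Rightarrow> real \<Rightarrow> (real^4 \<Rightarrow> real) \<Rightarrow> real \<Rightarrow> (real \<times> real \<Rightarrow> real^4) \<Rightarrow> (real \<Rightarrow> real^4) \<Rightarrow> bool" where
  "entropy_weak_sol \<beta> \<gamma> Q T U U0 \<longleftrightarrow>
     set_borel_measurable lborel ({0<..<T} \<times> UNIV) U \<and> U0 \<in> borel_measurable lborel \<and>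
     (\<forall>\<phi>. test_fn ({..<T} \<times> UNIV) \<phi> \<longrightarrow>
        (\<integral>z\<in>{0<..<T} \<times> UNIV. (pdt \<phi> z *\<^sub>R U z + pdx \<phi> z *\<^sub>R flux \<beta> \<gamma> (U z)) \<partial>lborel)
        + (\<integral>x. \<phi> (0, x) *\<^sub>R U0 x \<partial>lborel) = 0) \<and>
     (\<forall>\<phi>. test_fn ({0<..<T} \<times> UNIV) \<phi> \<and> (\<forall>z. 0 \<le> \<phi> z) \<longrightarrow>
        0 \<le> (\<integral>z\<in>{0<..<T} \<times> UNIV. (pdt \<phi> z * ent \<gamma> (U z) + pdx \<phi> z * Q (U z)) \<partial>lborel))"

definition Ea :: "real \<Rightarrow> real \<Rightarrow> real^4 \<Rightarrow> real^4 \<Rightarrow> (real \<Rightarrow> real^4) \<Rightarrow> real \<Rightarrow> ennreal" where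
  "Ea \<gamma> a Ul Ur f h =
     (\<integral>\<^sup>+x\<in>{..h}. ennreal (rel_ent \<gamma> (f x) Ul) \<partial>lborel)
     + ennreal a * (\<integral>\<^sup>+x\<in>{h<..}. ennreal (rel_ent \<gamma> (f x) Ur) \<partial>lborel)"

definition shock_profile :: "real^4 \<Rightarrow> real^4 \<Rightarrow> real \<Rightarrow> real^4" where
  "shock_profile Ul Ur x = (if x < 0 then Ul else Ur)"

definition a_contraction ::
  "real \<Rightarrow> real \<Rightarrow> (real^4 \<Rightarrow> real) \<Rightarrow> real \<Rightarrow> real^4 \<Rightarrow> real^4 \<Rightarrow> real \<Rightarrow> bool" where
  "a_contraction \<beta> \<gamma> Q a Ul Ur \<sigma> \<longleftrightarrow>
   (\<forall>UK. bounded UK \<and> convex UK \<and> UK \<subseteq> phys_dom \<longrightarrow>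
     (\<exists>CK. \<forall>T U U0.
        0 < T \<and> entropy_weak_sol \<beta> \<gamma> Q T U U0 \<and>
        (\<forall>t x. t \<in> {0<..<T} \<longrightarrow> U (t, x) \<in> UK) \<and> (\<forall>x. U0 x \<in> UK) \<and>
        (\<forall>i. bv_loc ({0<..<T} \<times> UNIV) (\<lambda>z. U z $ i)) \<and>
        Ea \<gamma> a Ul Ur U0 0 < \<infinity>
        \<longrightarrow>
        (\<exists>h :: real \<Rightarrow> real.
           h 0 = 0 \<and> (\<exists>L. L-lipschitz_on {0..<T} h) \<and>
           (\<exists>N. N \<in> null_sets lborel \<and>
              (\<forall>s t. s \<notin> N \<and> t \<notin> N \<and> 0 < s \<and> s < t \<and> t < T \<longrightarrow>
                 Ea \<gamma> a Ul Ur (\<lambda>x. U (t, x)) (h t) \<le> Ea \<gamma> a Ul Ur (\<lambda>x. U (s, x)) (h s))) \<and>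
           (AE t in lborel. t \<in> {0<..<T} \<longrightarrow>
              (\<forall>D. (h has_real_derivative D) (at t) \<longrightarrow> \<bar>D\<bar> \<le> CK)) \<and>
           (\<forall>t \<in> {0..<T}.
              (\<integral>\<^sup>+x. ennreal ((norm (U0 x - shock_profile Ul Ur x))\<^sup>2) \<partial>lborel) < \<infinity> \<longrightarrow>
              \<bar>h t - \<sigma> * t\<bar> \<le> CK * sqrt t *
                 sqrt (enn2real (\<integral>\<^sup>+x. ennreal ((norm (U0 x - shock_profile Ul Ur x))\<^sup>2) \<partial>lborel))))))"

end

theory Submission
  imports Defs "HOL-Real_Asymp.Real_Asymp"
begin

text \<open>
  Let \<open>G(V) = \<eta>(V|Ul) - a \<eta>(V|Ur)\<close>. If a solution equals a constant \<open>V\<close> with \<open>G(V) = 0\<close> on a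
  neighbourhood of the origin, then \<open>E_a(U(t),h)\<close> does not depend on \<open>h\<close> as long as \<open>h\<close> stays in that
  neighbourhood, so every Lipschitz shift yields the same energy for small times, and contraction fails as soon as
  this energy grows. Such a \<open>V\<close> is reached from a base state \<open>W\<close>, which is \<open>Ul\<close> if \<open>a \<le> 1\<close> and \<open>Ur\<close> if
  \<open>a > 1\<close>, along the integral curve of the fast family 1 (resp. 4): the solution consists of the given shock
  and, at a distance, a simple wave from \<open>W\<close> to \<open>V\<close> followed by the reversed simple wave from \<open>V\<close> to \<open>W\<close>.
  Its energy is affine in time with slope \<open>\<integral> (\<sigma> - \<lambda>) dG\<close> along the curve. If \<open>V\<close> is the first zero of
  \<open>G\<close>, genuine nonlinearity of the fast family and an integration by parts bound the slope below by
  \<open>-(\<sigma> - \<lambda>(W)) G(W)\<close>, and this is positive because \<open>\<lambda>_1(Ul) < \<sigma> < \<lambda>_4(Ur)\<close>.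
  A zero exists because the velocity \<open>u\<close> is unbounded along the curve as \<open>v \<rightarrow> 0\<close>; for \<open>a = 1\<close> the function \<open>G\<close>
  is affine and one needs \<open>u_r < u_l\<close>, which follows from the sign conditions on \<open>B\<close>.
\<close>

section \<open>Test functions and moving jumps\<close>

text \<open>One has \<open>G(Ul) < 0 < G(Ur)\<close>, and for \<open>a \<noteq> 1\<close> the sign
  of \<open>G\<close> at large velocity and small volume is that of \<open>1 - a\<close>. This
  decides the base state: the curve must leave it towards a sign change. As \<open>v\<close>
  decreases the fast speed grows in modulus, so \<open>\<lambda>_1\<close> decreases on a curve from
  \<open>Ul\<close> and \<open>\<lambda>_4\<close> increases on one from \<open>Ur\<close>. In both
  cases the derivative of the speed has the sign of \<open>G\<close> before its first zero, so the
  term that the integration by parts discards has the right sign. At \<open>a = 1\<close> the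
  quadratic growth cancels, and the linear term in \<open>u\<close> must beat those in
  \<open>q\<close> and \<open>w\<close>. Along the curve \<open>q\<close> stays bounded and
  \<open>w\<close> is at most logarithmic in \<open>v\<close>, while \<open>u\<close> grows like a
  negative power of \<open>v\<close>. The two simple waves run through the same states in opposite
  order, so wherever the speed varies one of them is compressive. The solution is therefore built
  only for a short time, before characteristics can cross. This suffices, because contraction
  compares almost all pairs of times \<open>s < t\<close>.\<close>

definition step :: "real \<Rightarrow> real" where
  "step x = (if 0 < x then 1 else 0)"

lemma step_measurable [measurable]: "step \<in> borel_measurable borel"
  unfolding step_def by measurable

lemma step_simps [simp]: "0 < x \<Longrightarrow> step x = 1" "x \<le> 0 \<Longrightarrow> step x = 0"
  by (auto simp: step_def)

lemma step_bounds: "0 \<le> step x" "step x \<le> 1" "\<bar>step x\<bar> \<le> 1"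
  by (auto simp: step_def)

text \<open>The complement of the support is open, so \<open>\<phi>\<close> vanishes identically
  near \<open>z\<close> and both partial derivatives are those of the zero function.\<close>

lemma test_fn_zero_outside:
  assumes "test_fn K \<phi>" "z \<notin> K"
  shows "\<phi> z = 0" "pdt \<phi> z = 0" "pdx \<phi> z = 0"
proof -
  define S where "S = closure {z. \<phi> z \<noteq> 0}"
  have C: "open (- S)" "z \<in> - S"
    using assms by (auto simp: test_fn_def S_def)
  have zero: "\<phi> y = 0" if "y \<in> - S" for y
    using that unfolding S_def using closure_subset[of "{z. \<phi> z \<noteq> 0}"] by auto
  obtain t x where z: "z = (t, x)" by (cases z)
  show "\<phi> z = 0" using zero C by blast
  have o: "open ((\<lambda>s. (s, x)) -` (- S))" "open ((\<lambda>y. (t, y)) -` (- S))"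
    by (intro open_vimage C(1) continuous_intros)+
  have "((\<lambda>s. \<phi> (s, x)) has_real_derivative 0) (at t)"
    by (rule has_field_derivative_transform_within_open[OF DERIV_const[of 0] o(1)])
       (use C(2) in \<open>auto simp: z zero\<close>)
  then show "pdt \<phi> z = 0" by (simp add: pdt_def z DERIV_imp_deriv)
  have "((\<lambda>y. \<phi> (t, y)) has_real_derivative 0) (at x)"
    by (rule has_field_derivative_transform_within_open[OF DERIV_const[of 0] o(2)])
       (use C(2) in \<open>auto simp: z zero\<close>)
  then show "pdx \<phi> z = 0" by (simp add: pdx_def z DERIV_imp_deriv)
qed

lemma test_fn_subset: "test_fn K \<phi> \<Longrightarrow> K \<subseteq> L \<Longrightarrow> test_fn L \<phi>"
  by (auto simp: test_fn_def)

lemma test_fn_support_box: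
  assumes "test_fn K \<phi>"
  obtains M where "M > 0"
    "\<And>t x. \<not> (\<bar>t\<bar> \<le> M \<and> \<bar>x\<bar> \<le> M) \<Longrightarrow> \<phi> (t, x) = 0 \<and> pdt \<phi> (t, x) = 0 \<and> pdx \<phi> (t, x) = 0"
proof -
  let ?S = "closure {z. \<phi> z \<noteq> 0}"
  have t: "test_fn ?S \<phi>" using assms by (auto simp: test_fn_def)
  have "bounded ?S" using assms by (auto simp: test_fn_def compact_imp_bounded)
  then obtain M where M: "M > 0" "\<And>z. z \<in> ?S \<Longrightarrow> norm z \<le> M"
    by (meson bounded_pos)
  have "(t, x) \<notin> ?S" if "\<not> (\<bar>t\<bar> \<le> M \<and> \<bar>x\<bar> \<le> M)" for t x
    using M(2)[of "(t, x)"] that norm_fst_le[of t x] norm_snd_le[of x t] by auto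
  then show ?thesis using that[OF M(1)] test_fn_zero_outside[OF t] by blast
qed

lemma test_fn_continuous:
  assumes "test_fn K \<phi>"
  shows "continuous_on UNIV \<phi>" "continuous_on UNIV (pdt \<phi>)" "continuous_on UNIV (pdx \<phi>)"
  using assms
  by (auto simp: test_fn_def intro!: continuous_at_imp_continuous_on differentiable_imp_continuous_within)

lemma test_fn_measurable:
  assumes "test_fn K \<phi>"
  shows "\<phi> \<in> borel_measurable borel" "pdt \<phi> \<in> borel_measurable borel" "pdx \<phi> \<in> borel_measurable borel"
  using test_fn_continuous[OF assms] by (auto intro!: borel_measurable_continuous_onI)

lemma integrable_continuous_zero_outside:
  fixes f :: "'a::euclidean_space \<Rightarrow> real"
  assumes "continuous_on UNIV f" "compact S" "\<And>z. z \<notin> S \<Longrightarrow> f z = 0"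
  shows "integrable lborel f"
proof -
  have "integrable lborel (\<lambda>z. indicator S z *\<^sub>R f z)"
    using assms by (intro borel_integrable_compact) (auto intro: continuous_on_subset)
  also have "(\<lambda>z. indicator S z *\<^sub>R f z) = f"
    using assms(3) by (auto simp: indicator_def fun_eq_iff)
  finally show ?thesis .
qed

lemma test_fn_integrable:
  assumes "test_fn K \<phi>"
  shows "integrable lborel \<phi>" "integrable lborel (pdt \<phi>)" "integrable lborel (pdx \<phi>)"
    "integrable lborel (\<lambda>x. \<phi> (t, x))"
proof -
  let ?S = "closure {z. \<phi> z \<noteq> 0}"
  have t: "test_fn ?S \<phi>" "compact ?S" using assms by (auto simp: test_fn_def)
  note z = test_fn_zero_outside[OF t(1)]
  show "integrable lborel \<phi>" "integrable lborel (pdt \<phi>)" "integrable lborel (pdx \<phi>)"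
    using integrable_continuous_zero_outside[OF _ t(2)] test_fn_continuous[OF assms] z by blast+
  obtain M where M: "M > 0"
    "\<And>t x. \<not> (\<bar>t\<bar> \<le> M \<and> \<bar>x\<bar> \<le> M) \<Longrightarrow> \<phi> (t, x) = 0 \<and> pdt \<phi> (t, x) = 0 \<and> pdx \<phi> (t, x) = 0"
    using test_fn_support_box[OF assms] by blast
  have "continuous_on UNIV (\<lambda>x. \<phi> (t, x))"
    by (rule continuous_on_compose2[OF test_fn_continuous(1)[OF assms]]) (auto intro!: continuous_intros)
  then show "integrable lborel (\<lambda>x. \<phi> (t, x))"
    by (rule integrable_continuous_zero_outside[of _ "{-M..M}"]) (use M(2) in auto)
qed

text \<open>\<open>pdt\<close> and \<open>pdx\<close> are one-variable derivatives.
  Differentiability in the plane identifies them with the total derivative on the basis vectors, and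
  linearity gives the direction \<open>(1, s)\<close> of a jump line.\<close>

lemma test_fn_line_derivative:
  assumes "test_fn K \<phi>"
  shows "((\<lambda>t. \<phi> (t, y + s * t)) has_real_derivative pdt \<phi> (t, y + s * t) + s * pdx \<phi> (t, y + s * t)) (at t)"
    "((\<lambda>x. \<phi> (t, x)) has_real_derivative pdx \<phi> (t, y)) (at y)"
proof -
  have *: "((\<lambda>r. \<phi> (t0 + r, x0 + k * r)) has_real_derivative D (1, k)) (at 0)"
    if "(\<phi> has_derivative D) (at (t0, x0))" for D t0 x0 k
  proof -
    have "((\<lambda>r. \<phi> (t0 + r, x0 + k * r)) has_derivative (\<lambda>h. D (h, k * h))) (at 0)"
      by (rule has_derivative_compose[where f = "\<lambda>r. (t0 + r, x0 + k * r)" and g = \<phi>])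
         (use that in \<open>auto intro!: derivative_eq_intros\<close>)
    moreover have "(\<lambda>h. D (h, k * h)) = (*) (D (1, k))"
      using has_derivative_linear[OF that] linear_scale[of D _ "(1, k)"] by (auto simp: mult.commute)
    ultimately show ?thesis unfolding has_field_derivative_def by metis
  qed
  have **: "((\<lambda>r. \<phi> (t0, x0 + r)) has_real_derivative D (0, 1)) (at 0)"
    if "(\<phi> has_derivative D) (at (t0, x0))" for D t0 x0
  proof -
    have "((\<lambda>r. \<phi> (t0, x0 + r)) has_derivative (\<lambda>h. D (0, h))) (at 0)"
      by (rule has_derivative_compose[where f = "\<lambda>r. (t0, x0 + r)" and g = \<phi>])
         (use that in \<open>auto intro!: derivative_eq_intros\<close>)
    moreover have "(\<lambda>h. D (0, h)) = (*) (D (0, 1))"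
    proof (rule ext)
      show "D (0, h) = D (0, 1) * h" for h
        using has_derivative_linear[OF that] linear_scale[of D h "(0, 1)"] by (simp add: mult.commute)
    qed
    ultimately show ?thesis unfolding has_field_derivative_def by metis
  qed
  have pd: "pdt \<phi> (t0, x0) = D (1, 0)" "pdx \<phi> (t0, x0) = D (0, 1)"
    if "(\<phi> has_derivative D) (at (t0, x0))" for D t0 x0
  proof -
    have "((\<lambda>r. \<phi> (r, x0)) has_real_derivative D (1, 0)) (at (0 + t0))"
      by (rule DERIV_shift[THEN iffD2]) (use *[OF that, of 0] in \<open>simp add: add.commute\<close>)
    moreover have "((\<lambda>r. \<phi> (t0, r)) has_real_derivative D (0, 1)) (at (0 + x0))"
      by (rule DERIV_shift[THEN iffD2]) (use **[OF that] in \<open>simp add: add.commute\<close>)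
    ultimately show "pdt \<phi> (t0, x0) = D (1, 0)" "pdx \<phi> (t0, x0) = D (0, 1)"
      by (auto simp: pdt_def pdx_def intro!: DERIV_imp_deriv)
  qed
  have ex: "\<exists>D. (\<phi> has_derivative D) (at (t0, x0))" for t0 x0
    using assms by (auto simp: test_fn_def differentiable_def)
  obtain D where D: "(\<phi> has_derivative D) (at (t, y + s * t))" using ex by blast
  have lin: "D (1, s) = D (1, 0) + s * D (0, 1)"
    using has_derivative_linear[OF D] linear_add[of D "(1, 0)" "s *\<^sub>R (0, 1)"] linear_scale[of D s "(0, 1)"]
    by simp
  have "((\<lambda>r. \<phi> (r, y + s * r)) has_real_derivative D (1, s)) (at (0 + t))"
    by (rule DERIV_shift[THEN iffD2]) (use *[OF D, of s] in \<open>simp add: algebra_simps\<close>)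
  then show "((\<lambda>t. \<phi> (t, y + s * t)) has_real_derivative pdt \<phi> (t, y + s * t) + s * pdx \<phi> (t, y + s * t)) (at t)"
    by (simp add: lin pd[OF D])
  obtain E where E: "(\<phi> has_derivative E) (at (t, y))" using ex by blast
  have "((\<lambda>r. \<phi> (t, r)) has_real_derivative E (0, 1)) (at (0 + y))"
    by (rule DERIV_shift[THEN iffD2]) (use **[OF E] in \<open>simp add: add.commute\<close>)
  then show "((\<lambda>x. \<phi> (t, x)) has_real_derivative pdx \<phi> (t, y)) (at y)"
    by (simp add: pd[OF E])
qed

lemma lborel_integral_translate:
  fixes f :: "real \<Rightarrow> 'a :: {banach, second_countable_topology}"
  shows "(LBINT x. f x) = (LBINT x. f (t + x))"
  using lborel_integral_real_affine[of 1 f t] by simp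

abbreviation strip :: "real \<Rightarrow> (real \<times> real) set" where
  "strip T \<equiv> {0<..<T} \<times> UNIV"

text \<open>The shear \<open>x = y + s t\<close> turns the moving jump into a fixed half-line in
  \<open>y\<close>, and the integrand into the \<open>t\<close>-derivative of \<open>\<phi>\<close>
  along a line parallel to the jump. Fubini and the fundamental theorem in \<open>t\<close> leave
  only the initial trace.\<close>

lemma jump_transport_identity:
  assumes \<phi>: "test_fn ({..<T} \<times> UNIV) \<phi>" and T: "0 < T"
  shows "(LBINT z:strip T. step (snd z - b - s * fst z) * (pdt \<phi> z + s * pdx \<phi> z))
         = - (LBINT x. step (x - b) * \<phi> (0, x))"
proof -
  note meas[measurable] = test_fn_measurable[OF \<phi>]
  obtain M where M: "M > 0"
    "\<And>t x. \<not> (\<bar>t\<bar> \<le> M \<and> \<bar>x\<bar> \<le> M) \<Longrightarrow> \<phi> (t, x) = 0 \<and> pdt \<phi> (t, x) = 0 \<and> pdx \<phi> (t, x) = 0"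
    using test_fn_support_box[OF \<phi>] by blast
  define D where "D z = pdt \<phi> z + s * pdx \<phi> z" for z
  have [measurable]: "D \<in> borel_measurable borel" unfolding D_def by measurable
  have Dint: "integrable lborel D" unfolding D_def using test_fn_integrable[OF \<phi>] by auto
  have contD: "continuous_on UNIV D" unfolding D_def
    using test_fn_continuous[OF \<phi>] by (intro continuous_intros)
  \<comment> \<open>The integrand before (\<open>F\<close>) and after (\<open>F'\<close>) the shear.
    Both must be integrable on the plane, since Fubini is applied once in each set of
    coordinates.\<close>
  define F where "F t x = indicator {0<..<T} t * step (x - b - s * t) * D (t, x)" for t x
  define F' where "F' t y = indicator {0<..<T} t * step (y - b) * D (t, y + s * t)" for t y
  have measF: "case_prod F \<in> borel_measurable borel"
    unfolding F_def borel_prod[symmetric] by measurable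
  have Fint: "integrable (lborel \<Otimes>\<^sub>M lborel) (case_prod F)"
  proof -
    have "norm (case_prod F z) \<le> norm (D z)" for z
      by (cases z) (auto simp: F_def step_def indicator_def)
    then show ?thesis
      unfolding lborel_prod by (intro Bochner_Integration.integrable_bound[OF Dint]) (use measF in auto)
  qed
  have measF': "case_prod F' \<in> borel_measurable borel"
    unfolding F'_def borel_prod[symmetric] by measurable
  have F'int: "integrable (lborel \<Otimes>\<^sub>M lborel) (case_prod F')"
  proof -
    have 1: "integrable lborel (\<lambda>z. D (fst z, snd z + s * fst z))"
    proof (rule integrable_continuous_zero_outside)
      show "continuous_on UNIV (\<lambda>z. D (fst z, snd z + s * fst z))"
        by (rule continuous_on_compose2[OF contD]) (auto intro!: continuous_intros)
      \<comment> \<open>In the sheared coordinates \<open>x\<close> can leave the box of half-width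
        \<open>M\<close> by at most \<open>\<bar>s\<bar> * M\<close>.\<close>
      show "compact (cbox (-M, -(M+\<bar>s\<bar>*M)) (M, M+\<bar>s\<bar>*M))" by simp
      fix z assume z: "z \<notin> cbox (-M, -(M+\<bar>s\<bar>*M)) (M, M+\<bar>s\<bar>*M)"
      have "\<bar>snd z\<bar> \<le> M + \<bar>s\<bar>*M" if "\<bar>fst z\<bar> \<le> M" "\<bar>snd z + s * fst z\<bar> \<le> M"
      proof -
        have "\<bar>s * fst z\<bar> \<le> \<bar>s\<bar> * M" using that by (simp add: abs_mult mult_left_mono)
        then show ?thesis using that by linarith
      qed
      with z have "\<not> (\<bar>fst z\<bar> \<le> M \<and> \<bar>snd z + s * fst z\<bar> \<le> M)"
        by (cases z) (auto simp: cbox_Pair_eq abs_le_iff)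
      then show "D (fst z, snd z + s * fst z) = 0" using M(2) unfolding D_def by simp
    qed
    have "norm (case_prod F' z) \<le> norm (D (fst z, snd z + s * fst z))" for z
      by (cases z) (auto simp: F'_def step_def indicator_def)
    then show ?thesis
      unfolding lborel_prod by (intro Bochner_Integration.integrable_bound[OF 1]) (use measF' in auto)
  qed
  have inner: "(LBINT t. F' t y) = - (step (y - b) * \<phi> (0, y))" for y
  proof -
    have "((\<lambda>t. \<phi> (t, y + s * t)) has_vector_derivative D (t, y + s * t)) (at t within {0..T})" for t
      using test_fn_line_derivative(1)[OF \<phi>, of y s t] unfolding D_def
      by (simp add: has_real_derivative_iff_has_vector_derivative has_vector_derivative_at_within)
    moreover have "continuous_on {0..T} (\<lambda>t. D (t, y + s * t))"
      by (rule continuous_on_compose2[OF contD]) (auto intro!: continuous_intros)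
    ultimately have "(LBINT t. indicator {0..T} t *\<^sub>R D (t, y + s * t)) = \<phi> (T, y + s * T) - \<phi> (0, y + s * 0)"
      using T by (intro integral_FTC_Icc) auto
    \<comment> \<open>The support lies in \<open>{..<T} \<times> UNIV\<close>, hence
      \<open>\<phi>\<close> vanishes at time \<open>T\<close>.\<close>
    also have "\<dots> = - \<phi> (0, y)"
      using test_fn_zero_outside(1)[OF \<phi>, of "(T, y + s * T)"] by simp
    finally have e: "(LBINT t. indicator {0..T} t *\<^sub>R D (t, y + s * t)) = - \<phi> (0, y)" .
    have "(LBINT t. indicator {0<..<T} t *\<^sub>R D (t, y + s * t)) = (LBINT t. indicator {0..T} t *\<^sub>R D (t, y + s * t))"
    proof (rule integral_cong_AE)
      have "AE t in lborel. t \<noteq> 0 \<and> t \<noteq> T" using AE_lborel_singleton[of 0] AE_lborel_singleton[of T] by auto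
      then show "AE t in lborel. indicator {0<..<T} t *\<^sub>R D (t, y + s * t) = indicator {0..T} t *\<^sub>R D (t, y + s * t)"
        by eventually_elim (auto simp: indicator_def)
    qed auto
    with e have "(LBINT t. step (y - b) * (indicator {0<..<T} t *\<^sub>R D (t, y + s * t))) = - (step (y - b) * \<phi> (0, y))"
      by simp
    then show ?thesis by (simp add: F'_def mult_ac)
  qed
  have "(LBINT z:strip T. step (snd z - b - s * fst z) * (pdt \<phi> z + s * pdx \<phi> z))
      = (\<integral>z. case_prod F z \<partial>(lborel \<Otimes>\<^sub>M lborel))"
    unfolding lborel_prod set_lebesgue_integral_def F_def D_def
    by (intro Bochner_Integration.integral_cong) (auto simp: indicator_def split: prod.splits)
  also have "\<dots> = (LBINT t. (LBINT x. F t x))"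
    using lborel_pair.integral_fst[OF Fint] by simp
  also have "\<dots> = (LBINT t. (LBINT y. F' t y))"
  proof (rule Bochner_Integration.integral_cong[OF refl])
    fix t show "(LBINT x. F t x) = (LBINT y. F' t y)"
      by (subst lborel_integral_translate[of _ "s * t"]) (simp add: F_def F'_def[abs_def] algebra_simps)
  qed
  also have "\<dots> = (LBINT y. (LBINT t. F' t y))"
    by (rule lborel_pair.Fubini_integral[OF F'int, symmetric])
  also have "\<dots> = - (LBINT x. step (x - b) * \<phi> (0, x))"
    by (simp add: inner)
  finally show ?thesis .
qed

text \<open>On each time slice this is the fundamental theorem from the jump to a point beyond the
  support. It measures the defect of a jump that violates Rankine-Hugoniot, and the variation
  carried by a jump line.\<close>

lemma jump_space_identity:
  assumes \<phi>: "test_fn K \<phi>"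
  shows "(LBINT z:strip T. step (snd z - b - s * fst z) * pdx \<phi> z)
         = - (LBINT t:{0<..<T}. \<phi> (t, b + s * t))"
proof -
  note meas[measurable] = test_fn_measurable[OF \<phi>]
  obtain M where M: "M > 0"
    "\<And>t x. \<not> (\<bar>t\<bar> \<le> M \<and> \<bar>x\<bar> \<le> M) \<Longrightarrow> \<phi> (t, x) = 0 \<and> pdt \<phi> (t, x) = 0 \<and> pdx \<phi> (t, x) = 0"
    using test_fn_support_box[OF \<phi>] by blast
  define F where "F t x = indicator {0<..<T} t * step (x - b - s * t) * pdx \<phi> (t, x)" for t x
  have measF: "case_prod F \<in> borel_measurable borel"
    unfolding F_def borel_prod[symmetric] by measurable
  have Fint: "integrable (lborel \<Otimes>\<^sub>M lborel) (case_prod F)"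
  proof -
    have "norm (case_prod F z) \<le> norm (pdx \<phi> z)" for z
      by (cases z) (auto simp: F_def step_def indicator_def)
    then show ?thesis
      unfolding lborel_prod
      by (intro Bochner_Integration.integrable_bound[OF test_fn_integrable(3)[OF \<phi>]]) (use measF in auto)
  qed
  have inner: "(LBINT x. F t x) = indicator {0<..<T} t * (- \<phi> (t, b + s * t))" for t
  proof -
    \<comment> \<open>The endpoint \<open>?c\<close> lies to the right of the jump, so that the
      interval is nonempty, and strictly outside the support.\<close>
    let ?b = "b + s * t" let ?c = "max (b + s * t) M + 1"
    have "((\<lambda>x. \<phi> (t, x)) has_vector_derivative pdx \<phi> (t, x)) (at x within {?b..?c})" for x
      using test_fn_line_derivative(2)[OF \<phi>, of t x]
      by (simp add: has_real_derivative_iff_has_vector_derivative has_vector_derivative_at_within)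
    moreover have "continuous_on {?b..?c} (\<lambda>x. pdx \<phi> (t, x))"
      by (rule continuous_on_compose2[OF test_fn_continuous(3)[OF \<phi>]]) (auto intro!: continuous_intros)
    ultimately have "(LBINT x. indicator {?b..?c} x *\<^sub>R pdx \<phi> (t, x)) = \<phi> (t, ?c) - \<phi> (t, ?b)"
      by (intro integral_FTC_Icc) auto
    moreover have "\<phi> (t, ?c) = 0" using M(1) by (intro M(2)[THEN conjunct1]) (auto simp: max_def)
    moreover have "(LBINT x. step (x - b - s * t) * pdx \<phi> (t, x)) = (LBINT x. indicator {?b..?c} x *\<^sub>R pdx \<phi> (t, x))"
    proof (rule integral_cong_AE)
      show "AE x in lborel. step (x - b - s * t) * pdx \<phi> (t, x) = indicator {?b..?c} x *\<^sub>R pdx \<phi> (t, x)"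
        using AE_lborel_singleton[of ?b]
        proof eventually_elim
          case (elim x)
          have "pdx \<phi> (t, x) = 0" if "x > ?c"
            using M(1) that by (intro M(2)[THEN conjunct2, THEN conjunct2]) (auto simp: max_def split: if_splits)
          with elim show ?case by (auto simp: indicator_def step_def)
        qed
    qed auto
    ultimately show ?thesis by (simp add: F_def mult.assoc)
  qed
  have "(LBINT z:strip T. step (snd z - b - s * fst z) * pdx \<phi> z)
      = (\<integral>z. case_prod F z \<partial>(lborel \<Otimes>\<^sub>M lborel))"
    unfolding lborel_prod set_lebesgue_integral_def F_def
    by (intro Bochner_Integration.integral_cong) (auto simp: indicator_def split: prod.splits)
  also have "\<dots> = (LBINT t. (LBINT x. F t x))"
    using lborel_pair.integral_fst[OF Fint] by simp
  also have "\<dots> = - (LBINT t:{0<..<T}. \<phi> (t, b + s * t))"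
    by (simp add: inner set_lebesgue_integral_def)
  finally show ?thesis .
qed

section \<open>Superpositions of moving jumps\<close>

text \<open>
  A superposition of jumps of size \<open>\<omega> p dp\<close>, the jump with label \<open>p\<close> travelling along the line
  \<open>x = c p + \<mu> p t\<close>. It solves \<open>g_t + f_x = 0\<close> when each jump of \<open>f\<close> is \<open>\<mu> p\<close> times that of \<open>g\<close>, whence shocks
  (constant \<open>c\<close>, \<open>\<mu>\<close>) and simple waves are treated alike, by Fubini, without differentiating the solution.
\<close>
definition layer :: "(real \<Rightarrow> real) \<Rightarrow> (real \<Rightarrow> real) \<Rightarrow> (real \<Rightarrow> 'b) \<Rightarrow> real \<times> real \<Rightarrow> 'b::euclidean_space" where
  "layer c \<mu> \<omega> z = (LBINT p:{0..1}. step (snd z - c p - \<mu> p * fst z) *\<^sub>R \<omega> p)"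

lemma integrable_scaleR_bounded:
  fixes g :: "'a \<Rightarrow> 'b::{banach, second_countable_topology}" and \<Psi> :: "'a \<Rightarrow> real"
  assumes "integrable M \<Psi>" "g \<in> borel_measurable M" "bounded (range g)"
  shows "integrable M (\<lambda>z. \<Psi> z *\<^sub>R g z)"
proof -
  obtain C where C: "\<And>z. norm (g z) \<le> C" using assms(3) by (auto simp: bounded_iff)
  have C0: "0 \<le> C" using C[of undefined] norm_ge_zero order_trans by blast
  show ?thesis
  proof (rule Bochner_Integration.integrable_bound)
    show "integrable M (\<lambda>z. \<Psi> z * C)" using assms(1) by simp
    show "AE z in M. norm (\<Psi> z *\<^sub>R g z) \<le> norm (\<Psi> z * C)"
      using C C0 by (auto simp: abs_mult intro!: mult_left_mono)
  qed (use assms in measurable)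
qed

lemma continuous_bounded_unit_interval:
  fixes \<omega> :: "real \<Rightarrow> 'b::real_normed_vector"
  assumes "continuous_on UNIV \<omega>"
  obtains C where "0 \<le> C" "\<And>p. p \<in> {0..1} \<Longrightarrow> norm (\<omega> p) \<le> C"
proof -
  have "bounded (\<omega> ` {0..1})"
    using assms by (intro compact_imp_bounded compact_continuous_image) (auto intro: continuous_on_subset)
  then obtain C where "0 < C" "\<And>p. p \<in> {0..1} \<Longrightarrow> norm (\<omega> p) \<le> C"
    by (auto simp: bounded_pos)
  then show ?thesis using that[of C] by auto
qed

lemma integrable_indicator_unit: "integrable lborel (indicator {0..1::real} :: real \<Rightarrow> real)"
  by (intro integrable_real_indicator) auto

lemma fst_snd_borel_measurable [measurable]:
  "(fst :: real \<times> real \<Rightarrow> real) \<in> borel_measurable borel" "(snd :: real \<times> real \<Rightarrow> real) \<in> borel_measurable borel"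
  by (auto intro!: borel_measurable_continuous_onI continuous_intros)

lemma abs_integral_mult_le:
  fixes f g :: "'a \<Rightarrow> real"
  assumes "integrable M f" "integrable M (\<lambda>z. f z * g z)" "\<And>z. \<bar>g z\<bar> \<le> 1"
  shows "\<bar>\<integral>z. f z * g z \<partial>M\<bar> \<le> (\<integral>z. \<bar>f z\<bar> \<partial>M)"
proof -
  have "\<bar>\<integral>z. f z * g z \<partial>M\<bar> \<le> (\<integral>z. \<bar>f z * g z\<bar> \<partial>M)" by (rule integral_abs_bound)
  also have "\<dots> \<le> (\<integral>z. \<bar>f z\<bar> \<partial>M)"
    using assms by (intro integral_mono integrable_abs) (auto simp: abs_mult mult_left_le)
  finally show ?thesis .
qed

text \<open>The majorant \<open>\<bar>\<Psi> z\<bar> * C\<close> on the unit interval makes Fubini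
  applicable. The kernel is abstract because it serves space-time integrals, initial traces and, in
  the form \<open>1 - step\<close>, energies on half-lines.\<close>

lemma unit_interval_Fubini:
  fixes \<Psi> :: "'a::euclidean_space \<Rightarrow> real" and \<omega> :: "real \<Rightarrow> 'b::euclidean_space"
  assumes \<Psi>: "integrable lborel \<Psi>" and \<omega>: "continuous_on UNIV \<omega>"
    and K[measurable]: "case_prod K \<in> borel_measurable (borel \<Otimes>\<^sub>M borel)" and K1: "\<And>p z. \<bar>K p z\<bar> \<le> 1"
  shows "(LBINT z. \<Psi> z *\<^sub>R (LBINT p:{0..1}. K p z *\<^sub>R \<omega> p))
       = (LBINT p:{0..1}. (LBINT z. \<Psi> z * K p z) *\<^sub>R \<omega> p)"
proof -
  obtain C where C: "0 \<le> C" "\<And>p. p \<in> {0..1} \<Longrightarrow> norm (\<omega> p) \<le> C"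
    using continuous_bounded_unit_interval[OF \<omega>] by blast
  have [measurable]: "\<Psi> \<in> borel_measurable borel" using \<Psi> by auto
  have [measurable]: "\<omega> \<in> borel_measurable borel" using \<omega> by (rule borel_measurable_continuous_onI)
  define F where "F p z = indicator {0..1} p *\<^sub>R (\<Psi> z * K p z) *\<^sub>R \<omega> p" for p z
  have B: "integrable (lborel \<Otimes>\<^sub>M lborel) (\<lambda>z. indicator {0..1::real} (fst z) * (\<bar>\<Psi> (snd z)\<bar> * C))"
  proof (rule lborel_pair.Fubini_integrable)
    show "integrable lborel (\<lambda>x. LINT y|lborel. norm (indicat_real {0..1::real} (fst (x, y)) * (\<bar>\<Psi> (snd (x, y))\<bar> * C)))"
      using C(1) integrable_indicator_unit by (simp add: abs_mult)
    show "AE x in lborel. integrable lborel (\<lambda>y. indicat_real {0..1::real} (fst (x, y)) * (\<bar>\<Psi> (snd (x, y))\<bar> * C))"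
      using \<Psi> by simp
  qed measurable
  have F: "integrable (lborel \<Otimes>\<^sub>M lborel) (case_prod F)"
  proof (rule Bochner_Integration.integrable_bound[OF B])
    show "case_prod F \<in> borel_measurable (lborel \<Otimes>\<^sub>M lborel)" unfolding F_def by measurable
    have "norm (F p z) \<le> indicator {0..1} p * (\<bar>\<Psi> z\<bar> * C)" for p z
      using C(2)[of p] C(1) mult_mono[OF mult_left_mono[OF K1[of p z], of "\<bar>\<Psi> z\<bar>"], of "norm (\<omega> p)" C]
      by (auto simp: F_def abs_mult indicator_def)
    then show "AE x in lborel \<Otimes>\<^sub>M lborel. norm (case x of (x, xa) \<Rightarrow> F x xa)
         \<le> norm (indicat_real {0..1} (fst x) * (\<bar>\<Psi> (snd x)\<bar> * C))"
      using C(1) by (auto simp: abs_mult)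
  qed
  have "(LBINT z. \<Psi> z *\<^sub>R (LBINT p:{0..1}. K p z *\<^sub>R \<omega> p)) = (LBINT z. (LBINT p. F p z))"
    unfolding set_lebesgue_integral_def integral_scaleR_right[symmetric] F_def
    by (intro Bochner_Integration.integral_cong refl) (simp add: mult_ac)
  also have "\<dots> = (LBINT p. (LBINT z. F p z))"
    by (rule lborel_pair.Fubini_integral[OF F])
  also have "\<dots> = (LBINT p:{0..1}. (LBINT z. \<Psi> z * K p z) *\<^sub>R \<omega> p)"
  proof -
    have "(LBINT z. F p z) = indicator {0..1} p *\<^sub>R (LBINT z. \<Psi> z * K p z) *\<^sub>R \<omega> p" for p
    proof -
      have "integrable lborel (\<lambda>z. \<Psi> z * K p z)"
        using integrable_scaleR_bounded[OF \<Psi>, of "K p"] K1 by (auto simp: bounded_iff)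
      then show ?thesis unfolding F_def by simp
    qed
    then show ?thesis by (simp add: set_lebesgue_integral_def)
  qed
  finally show ?thesis .
qed

lemma layer_measurable [measurable]:
  assumes "continuous_on UNIV c" "continuous_on UNIV \<mu>" "continuous_on UNIV \<omega>"
  shows "layer c \<mu> \<omega> \<in> borel_measurable borel"
proof -
  have [measurable]: "c \<in> borel_measurable borel" "\<mu> \<in> borel_measurable borel" "\<omega> \<in> borel_measurable borel"
    using assms by (auto intro: borel_measurable_continuous_onI)
  show ?thesis
    unfolding layer_def set_lebesgue_integral_def borel_prod[symmetric] by measurable
qed

lemma layer_integrand_integrable:
  fixes \<omega> :: "real \<Rightarrow> 'b::euclidean_space"
  assumes "continuous_on UNIV c" "continuous_on UNIV \<mu>" "continuous_on UNIV \<omega>"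
  shows "set_integrable lborel {0..1} (\<lambda>p. step (x - c p - \<mu> p * t) *\<^sub>R \<omega> p)"
proof -
  have [measurable]: "c \<in> borel_measurable borel" "\<mu> \<in> borel_measurable borel" "\<omega> \<in> borel_measurable borel"
    using assms by (auto intro: borel_measurable_continuous_onI)
  have "integrable lborel (\<lambda>p. indicator {0..1} p *\<^sub>R \<omega> p)"
    using assms by (intro borel_integrable_compact) (auto intro: continuous_on_subset)
  then show ?thesis unfolding set_integrable_def
    by (rule Bochner_Integration.integrable_bound) (auto simp: indicator_def step_def)
qed

lemma layer_bounded:
  fixes \<omega> :: "real \<Rightarrow> 'b::euclidean_space"
  assumes "continuous_on UNIV c" "continuous_on UNIV \<mu>" "continuous_on UNIV \<omega>"
  shows "bounded (range (layer c \<mu> \<omega>))"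
proof -
  obtain C where C: "0 \<le> C" "\<And>p. p \<in> {0..1} \<Longrightarrow> norm (\<omega> p) \<le> C"
    using continuous_bounded_unit_interval[OF assms(3)] by blast
  have "norm (layer c \<mu> \<omega> z) \<le> C" for z
  proof -
    let ?f = "\<lambda>p. indicator {0..1} p *\<^sub>R step (snd z - c p - \<mu> p * fst z) *\<^sub>R \<omega> p"
    have i: "integrable lborel ?f" using layer_integrand_integrable[OF assms] by (simp add: set_integrable_def)
    have "norm (layer c \<mu> \<omega> z) \<le> (LBINT p. norm (?f p))"
      unfolding layer_def set_lebesgue_integral_def by (rule integral_norm_bound)
    also have "\<dots> \<le> (LBINT p. indicator {0..1::real} p * C)"
    proof (rule integral_mono)
      show "norm (?f p) \<le> indicator {0..1} p * C" for p
        using C by (auto simp: indicator_def step_def)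
    qed (use integrable_norm[OF i] integrable_indicator_unit in auto)
    also have "\<dots> = C" by simp
    finally show ?thesis .
  qed
  then show ?thesis by (auto simp: bounded_iff)
qed

lemma layer_Fubini:
  fixes \<omega> :: "real \<Rightarrow> 'b::euclidean_space"
  assumes c: "continuous_on UNIV c" "continuous_on UNIV \<mu>" "continuous_on UNIV \<omega>"
    and \<Psi>: "integrable lborel \<Psi>"
  shows "(LBINT z. \<Psi> z *\<^sub>R layer c \<mu> \<omega> z)
       = (LBINT p:{0..1}. (LBINT z. \<Psi> z * step (snd z - c p - \<mu> p * fst z)) *\<^sub>R \<omega> p)"
proof -
  have [measurable]: "c \<in> borel_measurable borel" "\<mu> \<in> borel_measurable borel"
    using c by (auto intro: borel_measurable_continuous_onI)
  show ?thesis unfolding layer_def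
    by (rule unit_interval_Fubini[OF \<Psi> c(3)]) (auto simp: step_bounds borel_prod[symmetric] simp del: borel_prod)
qed

text \<open>Density and flux are two separate bounded fields here, so the notion is linear and adds
  up over superpositions. Nonlinearity returns only when the second field is recognised as the flux
  of the first.\<close>

definition weak_balance :: "real \<Rightarrow> (real \<times> real \<Rightarrow> 'b) \<Rightarrow> (real \<times> real \<Rightarrow> 'b::euclidean_space) \<Rightarrow> bool" where
  "weak_balance T g f \<longleftrightarrow> g \<in> borel_measurable borel \<and> f \<in> borel_measurable borel \<and> bounded (range g) \<and> bounded (range f) \<and>
     (\<forall>\<phi>. test_fn ({..<T} \<times> UNIV) \<phi> \<longrightarrow>
        (LBINT z:strip T. (pdt \<phi> z *\<^sub>R g z + pdx \<phi> z *\<^sub>R f z))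
        + (LBINT x. \<phi> (0, x) *\<^sub>R g (0, x)) = 0)"

lemma strip_measurable [measurable]: "strip T \<in> sets borel"
  by (intro borel_open open_Times) auto

lemma test_weighted_integrable:
  fixes g :: "real \<times> real \<Rightarrow> 'b::euclidean_space"
  assumes \<phi>: "test_fn K \<phi>" and g: "g \<in> borel_measurable borel" "bounded (range g)"
  shows "set_integrable lborel (strip T) (\<lambda>z. pdt \<phi> z *\<^sub>R g z)"
    "set_integrable lborel (strip T) (\<lambda>z. pdx \<phi> z *\<^sub>R g z)"
    "integrable lborel (\<lambda>x. \<phi> (t, x) *\<^sub>R g (t, x))"
proof -
  show "set_integrable lborel (strip T) (\<lambda>z. pdt \<phi> z *\<^sub>R g z)"
    "set_integrable lborel (strip T) (\<lambda>z. pdx \<phi> z *\<^sub>R g z)"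
    unfolding set_integrable_def using test_fn_integrable[OF \<phi>] g
    by (auto intro!: integrable_mult_indicator integrable_scaleR_bounded simp del: scaleR_scaleR)
  have "(\<lambda>x. g (t, x)) \<in> borel_measurable borel" 
    using g(1) by (rule measurable_compose[rotated]) (simp add: borel_prod[symmetric] del: borel_prod)
  then show "integrable lborel (\<lambda>x. \<phi> (t, x) *\<^sub>R g (t, x))"
    using test_fn_integrable(4)[OF \<phi>] g
    by (intro integrable_scaleR_bounded) (auto elim!: bounded_subset)
qed

lemma weak_balance_add:
  assumes "weak_balance T g f" "weak_balance T g' f'"
  shows "weak_balance T (\<lambda>z. g z + g' z) (\<lambda>z. f z + f' z)"
  unfolding weak_balance_def
proof (intro conjI allI impI)
  show "bounded (range (\<lambda>z. g z + g' z))" "bounded (range (\<lambda>z. f z + f' z))"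
    using assms by (auto simp: weak_balance_def intro!: bounded_plus_comp)
  fix \<phi> :: "real \<times> real \<Rightarrow> real" assume \<phi>: "test_fn ({..<T} \<times> UNIV) \<phi>"
  note i = test_weighted_integrable[OF \<phi>]
  have I: "set_integrable lborel (strip T) (\<lambda>z. pdt \<phi> z *\<^sub>R g z + pdx \<phi> z *\<^sub>R f z)"
     "set_integrable lborel (strip T) (\<lambda>z. pdt \<phi> z *\<^sub>R g' z + pdx \<phi> z *\<^sub>R f' z)"
    using assms by (auto simp: weak_balance_def intro!: set_integral_add(1) i)
  have J: "integrable lborel (\<lambda>x. \<phi> (0, x) *\<^sub>R g (0, x))" "integrable lborel (\<lambda>x. \<phi> (0, x) *\<^sub>R g' (0, x))"
    using assms by (auto simp: weak_balance_def intro!: i)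
  have e: "(LBINT z:strip T. (pdt \<phi> z *\<^sub>R (g z + g' z) + pdx \<phi> z *\<^sub>R (f z + f' z)))
     = (LBINT z:strip T. (pdt \<phi> z *\<^sub>R g z + pdx \<phi> z *\<^sub>R f z))
      + (LBINT z:strip T. (pdt \<phi> z *\<^sub>R g' z + pdx \<phi> z *\<^sub>R f' z))"
    unfolding set_integral_add(2)[OF I, symmetric] by (simp add: algebra_simps)
  have e2: "(LBINT x. \<phi> (0, x) *\<^sub>R (g (0, x) + g' (0, x))) = 
     (LBINT x. \<phi> (0, x) *\<^sub>R g (0, x)) + (LBINT x. \<phi> (0, x) *\<^sub>R g' (0, x))"
    unfolding Bochner_Integration.integral_add[OF J, symmetric] by (simp add: algebra_simps)
  have z: "(LBINT z:strip T. (pdt \<phi> z *\<^sub>R g z + pdx \<phi> z *\<^sub>R f z)) + (LBINT x. \<phi> (0, x) *\<^sub>R g (0, x)) = 0"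
    "(LBINT z:strip T. (pdt \<phi> z *\<^sub>R g' z + pdx \<phi> z *\<^sub>R f' z)) + (LBINT x. \<phi> (0, x) *\<^sub>R g' (0, x)) = 0"
    using assms \<phi> by (auto simp: weak_balance_def)
  show "(LBINT z:strip T. (pdt \<phi> z *\<^sub>R (g z + g' z) + pdx \<phi> z *\<^sub>R (f z + f' z)))
    + (LBINT x. \<phi> (0, x) *\<^sub>R (g (0, x) + g' (0, x))) = 0"
    unfolding e e2 using arg_cong2[OF z, of "(+)"] by (simp add: algebra_simps)
qed (use assms in \<open>auto simp: weak_balance_def\<close>)

text \<open>A stationary jump placed to the left of the support equals 1 wherever the test function
  is nonzero, so constants are covered by the two jump identities.\<close>

lemma test_fn_total_integrals:
  assumes \<phi>: "test_fn ({..<T} \<times> UNIV) \<phi>" and T: "0 < T"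
  shows "(LBINT z:strip T. pdt \<phi> z) = - (LBINT x. \<phi> (0, x))"
    "(LBINT z:strip T. pdx \<phi> z) = 0"
proof -
  obtain M where M: "M > 0"
    "\<And>t x. \<not> (\<bar>t\<bar> \<le> M \<and> \<bar>x\<bar> \<le> M) \<Longrightarrow> \<phi> (t, x) = 0 \<and> pdt \<phi> (t, x) = 0 \<and> pdx \<phi> (t, x) = 0"
    using test_fn_support_box[OF \<phi>] by blast
  have h: "step (x - - (M+1)) * \<phi> (t, x) = \<phi> (t, x)" "step (x - - (M+1)) * pdt \<phi> (t, x) = pdt \<phi> (t, x)"
     "step (x - - (M+1)) * pdx \<phi> (t, x) = pdx \<phi> (t, x)" for t x
    using M(2)[of t x] M(1) by (cases "\<bar>x\<bar> \<le> M"; simp)+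
  have h2: "step (snd z - - (M+1) - 0 * fst z) * (pdt \<phi> z + 0 * pdx \<phi> z) = pdt \<phi> z"
     "step (snd z - - (M+1) - 0 * fst z) * pdx \<phi> z = pdx \<phi> z" for z
    using h(2,3)[of "snd z" "fst z"] by simp_all
  have zero: "\<phi> (t, - (M+1) + 0 * t) = 0" for t
    using M(1) by (intro M(2)[THEN conjunct1]) auto
  show "(LBINT z:strip T. pdt \<phi> z) = - (LBINT x. \<phi> (0, x))"
    using jump_transport_identity[OF \<phi> T, of "- (M+1)" 0] unfolding h2 h .
  show "(LBINT z:strip T. pdx \<phi> z) = 0"
    using jump_space_identity[OF \<phi>, of T "- (M+1)" 0] unfolding h2 zero by simp
qed

lemma weak_balance_const:
  assumes T: "0 < T"
  shows "weak_balance T (\<lambda>_. k) (\<lambda>_. k')"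
  unfolding weak_balance_def
proof (intro conjI allI impI)
  fix \<phi> :: "real \<times> real \<Rightarrow> real" assume \<phi>: "test_fn ({..<T} \<times> UNIV) \<phi>"
  have i: "set_integrable lborel (strip T) (pdt \<phi>)" "set_integrable lborel (strip T) (pdx \<phi>)"
    using test_weighted_integrable[OF \<phi>, of "\<lambda>_. 1::real" T] by auto
  have "(LBINT z:strip T. (pdt \<phi> z *\<^sub>R k + pdx \<phi> z *\<^sub>R k'))
    = (LBINT z:strip T. pdt \<phi> z) *\<^sub>R k + (LBINT z:strip T. pdx \<phi> z) *\<^sub>R k'"
    using i by (simp add: set_lebesgue_integral_def set_integrable_def scaleR_add_right)
  then show "(LBINT z:strip T. (pdt \<phi> z *\<^sub>R k + pdx \<phi> z *\<^sub>R k')) + (LBINT x. \<phi> (0, x) *\<^sub>R k) = 0"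
    using test_fn_integrable(4)[OF \<phi>, of 0] by (simp add: test_fn_total_integrals[OF \<phi> T])
qed auto

text \<open>Fubini moves the label \<open>p\<close> outside. For each label the flux jump is
  \<open>\<mu> p\<close> times the density jump, which is Rankine-Hugoniot on the line
  \<open>x = c p + \<mu> p t\<close>, so \<open>jump_transport_identity\<close> applies.\<close>

lemma weak_balance_layer:
  fixes \<omega> :: "real \<Rightarrow> 'b::euclidean_space"
  assumes T: "0 < T" and c: "continuous_on UNIV c" "continuous_on UNIV \<mu>" "continuous_on UNIV \<omega>"
  shows "weak_balance T (layer c \<mu> \<omega>) (layer c \<mu> (\<lambda>p. \<mu> p *\<^sub>R \<omega> p))"
  unfolding weak_balance_def
proof (intro conjI allI impI)
  have c': "continuous_on UNIV (\<lambda>p. \<mu> p *\<^sub>R \<omega> p)" using c by (intro continuous_intros)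
  have [measurable]: "c \<in> borel_measurable borel" "\<mu> \<in> borel_measurable borel" "\<omega> \<in> borel_measurable borel"
    using c by (auto intro: borel_measurable_continuous_onI)
  show m: "layer c \<mu> \<omega> \<in> borel_measurable borel" "layer c \<mu> (\<lambda>p. \<mu> p *\<^sub>R \<omega> p) \<in> borel_measurable borel"
    "bounded (range (layer c \<mu> \<omega>))" "bounded (range (layer c \<mu> (\<lambda>p. \<mu> p *\<^sub>R \<omega> p)))"
    using c c' by (auto intro!: layer_measurable layer_bounded)
  fix \<phi> :: "real \<times> real \<Rightarrow> real" assume \<phi>: "test_fn ({..<T} \<times> UNIV) \<phi>"
  note [measurable] = test_fn_measurable[OF \<phi>]
  let ?S = "strip T"
  let ?H = "\<lambda>p z. step (snd z - c p - \<mu> p * fst z)"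
  have I: "integrable lborel (\<lambda>z. indicator ?S z * pdt \<phi> z)" "integrable lborel (\<lambda>z. indicator ?S z * pdx \<phi> z)"
    using test_weighted_integrable[OF \<phi>, of "\<lambda>_. 1::real" T] by (auto simp: set_integrable_def)
  have IH: "integrable lborel (\<lambda>z. (indicator ?S z * pdt \<phi> z) * ?H p z)"
    "integrable lborel (\<lambda>z. (indicator ?S z * pdx \<phi> z) * ?H p z)" for p
  proof -
    have 1: "?H p \<in> borel_measurable lborel" 
      by (simp add: borel_prod[symmetric] del: borel_prod)
    have 2: "bounded (range (?H p))" using step_bounds by (auto simp: bounded_iff)
    show "integrable lborel (\<lambda>z. (indicator ?S z * pdt \<phi> z) * ?H p z)"
      "integrable lborel (\<lambda>z. (indicator ?S z * pdx \<phi> z) * ?H p z)"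
      using integrable_scaleR_bounded[OF I(1) 1 2] integrable_scaleR_bounded[OF I(2) 1 2] by simp_all
  qed
  \<comment> \<open>For the jump with label \<open>p\<close>: \<open>A\<close> is the contribution
    of the time derivative, \<open>B\<close> that of the space derivative, \<open>D\<close> the
    initial trace.\<close>
  define A where "A p = (LBINT z. (indicator ?S z * pdt \<phi> z) * ?H p z)" for p
  define B where "B p = (LBINT z. (indicator ?S z * pdx \<phi> z) * ?H p z)" for p
  define D where "D p = (LBINT x. \<phi> (0, x) * step (x - c p))" for p
  have ABD: "A p + \<mu> p * B p + D p = 0" for p
  proof -
    have "A p + \<mu> p * B p = (LBINT z:?S. ?H p z * (pdt \<phi> z + \<mu> p * pdx \<phi> z))"
      unfolding A_def B_def set_lebesgue_integral_def
      unfolding integral_mult_right_zero[symmetric]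
      by (subst Bochner_Integration.integral_add[symmetric])
         (use IH in \<open>auto simp: algebra_simps intro!: Bochner_Integration.integral_cong\<close>)
    also have "\<dots> = - D p" unfolding jump_transport_identity[OF \<phi> T] D_def by (simp add: mult.commute)
    finally show ?thesis by simp
  qed
  have "(LBINT x. \<phi> (0, x) *\<^sub>R layer c \<mu> \<omega> (0, x)) = (LBINT p:{0..1}. (LBINT x. \<phi> (0, x) * step (x - c p)) *\<^sub>R \<omega> p)"
    unfolding layer_def
    by (simp, rule unit_interval_Fubini[OF test_fn_integrable(4)[OF \<phi>] c(3)]) (auto simp: step_bounds)
  then have t3: "(LBINT x. \<phi> (0, x) *\<^sub>R layer c \<mu> \<omega> (0, x)) = (LBINT p:{0..1}. D p *\<^sub>R \<omega> p)"
    by (simp add: D_def)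
  have t1: "(LBINT z. (indicator ?S z * pdt \<phi> z) *\<^sub>R layer c \<mu> \<omega> z) = (LBINT p:{0..1}. A p *\<^sub>R \<omega> p)"
    unfolding A_def by (rule layer_Fubini[OF c I(1)])
  have t2: "(LBINT z. (indicator ?S z * pdx \<phi> z) *\<^sub>R layer c \<mu> (\<lambda>p. \<mu> p *\<^sub>R \<omega> p) z) = (LBINT p:{0..1}. (\<mu> p * B p) *\<^sub>R \<omega> p)"
    unfolding B_def layer_Fubini[OF c(1,2) c' I(2)] by (simp add: mult.commute)
  have [measurable]: "A \<in> borel_measurable borel" "B \<in> borel_measurable borel" "D \<in> borel_measurable borel"
    unfolding A_def B_def D_def by (intro lborel.borel_measurable_lebesgue_integral; measurable)+
  \<comment> \<open>Bounds uniform in \<open>p\<close>, needed to integrate \<open>A\<close> and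
    \<open>\<mu> B\<close> against the density separately.\<close>
  have bnd: "\<bar>A p\<bar> \<le> (LBINT z. \<bar>indicator ?S z * pdt \<phi> z\<bar>)" 
    "\<bar>B p\<bar> \<le> (LBINT z. \<bar>indicator ?S z * pdx \<phi> z\<bar>)" for p
    unfolding A_def B_def
    by (rule abs_integral_mult_le[OF I(1) IH(1) step_bounds(3)], rule abs_integral_mult_le[OF I(2) IH(2) step_bounds(3)])
  have \<omega>i: "integrable lborel (\<lambda>p. indicator {0..1} p *\<^sub>R \<omega> p)" "integrable lborel (\<lambda>p. indicator {0..1} p *\<^sub>R \<mu> p *\<^sub>R \<omega> p)"
    using c c' by (auto intro!: borel_integrable_compact intro: continuous_on_subset simp del: scaleR_scaleR)
  have iA: "set_integrable lborel {0..1} (\<lambda>p. A p *\<^sub>R \<omega> p)"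
    unfolding set_integrable_def
    by (rule Bochner_Integration.integrable_bound[OF integrable_scaleR_right[OF \<omega>i(1), of "LBINT z. \<bar>indicator ?S z * pdt \<phi> z\<bar>"]])
       (auto simp: indicator_def intro!: mult_right_mono order_trans[OF bnd(1)])
  have iB: "set_integrable lborel {0..1} (\<lambda>p. (\<mu> p * B p) *\<^sub>R \<omega> p)"
  proof -
    define N where "N = (LBINT z. \<bar>indicator ?S z * pdx \<phi> z\<bar>)"
    have "norm (indicator {0..1} p *\<^sub>R (\<mu> p * B p) *\<^sub>R \<omega> p) \<le> norm (N *\<^sub>R indicator {0..1} p *\<^sub>R \<mu> p *\<^sub>R \<omega> p)" for p
    proof -
      have "\<bar>B p\<bar> * (\<bar>\<mu> p\<bar> * norm (\<omega> p)) \<le> \<bar>N\<bar> * (\<bar>\<mu> p\<bar> * norm (\<omega> p))"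
        using bnd(2)[of p] unfolding N_def by (intro mult_right_mono) auto
      then show ?thesis by (simp add: indicator_def abs_mult mult_ac)
    qed
    then show ?thesis unfolding set_integrable_def
      by (intro Bochner_Integration.integrable_bound[OF integrable_scaleR_right[OF \<omega>i(2), of N]] AE_I2) auto
  qed
  have iAB: "set_integrable lborel {0..1} (\<lambda>p. A p *\<^sub>R \<omega> p + (\<mu> p * B p) *\<^sub>R \<omega> p)"
    by (rule set_integral_add(1)[OF iA iB])
  have De: "D p *\<^sub>R \<omega> p = - (A p *\<^sub>R \<omega> p + (\<mu> p * B p) *\<^sub>R \<omega> p)" for p
  proof -
    have "D p = - (A p + \<mu> p * B p)" using ABD[of p] by linarith
    then show ?thesis by (simp add: scaleR_add_left scaleR_minus_left scaleR_left_diff_distrib)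
  qed
  have "(LBINT z:?S. (pdt \<phi> z *\<^sub>R layer c \<mu> \<omega> z + pdx \<phi> z *\<^sub>R layer c \<mu> (\<lambda>p. \<mu> p *\<^sub>R \<omega> p) z))
    = (LBINT z:?S. (pdt \<phi> z *\<^sub>R layer c \<mu> \<omega> z)) + (LBINT z:?S. (pdx \<phi> z *\<^sub>R layer c \<mu> (\<lambda>p. \<mu> p *\<^sub>R \<omega> p) z))"
    by (intro set_integral_add(2) test_weighted_integrable[OF \<phi>] m)
  also have "\<dots> = (LBINT p:{0..1}. (A p *\<^sub>R \<omega> p + (\<mu> p * B p) *\<^sub>R \<omega> p))"
    unfolding set_integral_add(2)[OF iA iB] using t1 t2 by (simp add: set_lebesgue_integral_def)
  also have "\<dots> = - (LBINT p:{0..1}. D p *\<^sub>R \<omega> p)"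
    by (simp only: De set_lebesgue_integral_def scaleR_minus_right Bochner_Integration.integral_minus minus_minus)
  finally show "(LBINT z:?S. (pdt \<phi> z *\<^sub>R layer c \<mu> \<omega> z + pdx \<phi> z *\<^sub>R layer c \<mu> (\<lambda>p. \<mu> p *\<^sub>R \<omega> p) z))
     + (LBINT x. \<phi> (0, x) *\<^sub>R layer c \<mu> \<omega> (0, x)) = 0"
    unfolding t3 by simp
qed

section \<open>Entropy dissipation across moving jumps\<close>

definition weak_dissipation :: "real \<Rightarrow> (real \<times> real \<Rightarrow> real) \<Rightarrow> (real \<times> real \<Rightarrow> real) \<Rightarrow> bool" where
  "weak_dissipation T g f \<longleftrightarrow> g \<in> borel_measurable borel \<and> f \<in> borel_measurable borel \<and> bounded (range g) \<and> bounded (range f) \<and>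
     (\<forall>\<phi>. test_fn (strip T) \<phi> \<and> (\<forall>z. 0 \<le> \<phi> z) \<longrightarrow>
        0 \<le> (LBINT z:strip T. (pdt \<phi> z * g z + pdx \<phi> z * f z)))"

lemma weak_balance_test_interior:
  assumes "weak_balance T g f" "test_fn (strip T) \<phi>"
  shows "(LBINT z:strip T. (pdt \<phi> z *\<^sub>R g z + pdx \<phi> z *\<^sub>R f z)) = 0"
proof -
  have "\<phi> (0, x) = 0" for x using test_fn_zero_outside(1)[OF assms(2)] by auto
  moreover have "test_fn ({..<T} \<times> UNIV) \<phi>" by (rule test_fn_subset[OF assms(2)]) auto
  ultimately show ?thesis using assms(1) by (auto simp: weak_balance_def)
qed

lemma weak_balance_imp_dissipation: "weak_balance T g f \<Longrightarrow> weak_dissipation T g f"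
  using weak_balance_test_interior[of T g f] by (auto simp: weak_balance_def weak_dissipation_def)

lemma weak_dissipation_add:
  assumes "weak_dissipation T g f" "weak_dissipation T g' f'"
  shows "weak_dissipation T (\<lambda>z. g z + g' z) (\<lambda>z. f z + f' z)"
  unfolding weak_dissipation_def
proof (intro conjI allI impI)
  show "bounded (range (\<lambda>z. g z + g' z))" "bounded (range (\<lambda>z. f z + f' z))"
    using assms by (auto simp: weak_dissipation_def intro!: bounded_plus_comp)
  fix \<phi> :: "real \<times> real \<Rightarrow> real" assume \<phi>: "test_fn (strip T) \<phi> \<and> (\<forall>z. 0 \<le> \<phi> z)"
  note i = test_weighted_integrable[where 'b = real, OF conjunct1[OF \<phi>], unfolded real_scaleR_def]
  have I: "set_integrable lborel (strip T) (\<lambda>z. pdt \<phi> z * g z + pdx \<phi> z * f z)"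
     "set_integrable lborel (strip T) (\<lambda>z. pdt \<phi> z * g' z + pdx \<phi> z * f' z)"
    using assms by (auto simp: weak_dissipation_def intro!: set_integral_add(1) i)
  have e: "(LBINT z:strip T. (pdt \<phi> z * (g z + g' z) + pdx \<phi> z * (f z + f' z)))
     = (LBINT z:strip T. (pdt \<phi> z * g z + pdx \<phi> z * f z))
      + (LBINT z:strip T. (pdt \<phi> z * g' z + pdx \<phi> z * f' z))"
    unfolding set_integral_add(2)[OF I, symmetric] by (simp add: algebra_simps)
  show "0 \<le> (LBINT z:strip T. (pdt \<phi> z * (g z + g' z) + pdx \<phi> z * (f z + f' z)))"
    unfolding e using assms \<phi> by (auto simp: weak_dissipation_def)
qed (use assms in \<open>auto simp: weak_dissipation_def\<close>)

text \<open>For a pure flux jump of size \<open>k\<close>, with no jump in the density, the space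
  identity turns the test integral into \<open>- k\<close> times an integral of
  \<open>\<phi>\<close> along the line. The entropy defect of a shock takes this form.\<close>

lemma weak_dissipation_jump:
  assumes "k \<le> 0"
  shows "weak_dissipation T (\<lambda>_. 0) (\<lambda>z. k * step (snd z - b - s * fst z))"
  unfolding weak_dissipation_def
proof (intro conjI allI impI)
  show "bounded (range (\<lambda>z::real \<times> real. k * step (snd z - b - s * fst z)))"
    by (auto simp: bounded_iff abs_mult intro!: exI[of _ "\<bar>k\<bar>"] mult_left_le step_bounds(3))
  show "(\<lambda>z::real \<times> real. k * step (snd z - b - s * fst z)) \<in> borel_measurable borel" by measurable
  fix \<phi> :: "real \<times> real \<Rightarrow> real" assume \<phi>: "test_fn (strip T) \<phi> \<and> (\<forall>z. 0 \<le> \<phi> z)"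
  have "(LBINT z:strip T. (pdt \<phi> z * 0 + pdx \<phi> z * (k * step (snd z - b - s * fst z))))
     = k * (LBINT z:strip T. step (snd z - b - s * fst z) * pdx \<phi> z)"
    by (simp add: set_integral_mult_right[symmetric] mult_ac del: set_integral_mult_right)
  also have "\<dots> = - k * (LBINT t:{0<..<T}. \<phi> (t, b + s * t))"
    using jump_space_identity[of _ \<phi> T b s] \<phi> by auto
  also have "\<dots> \<ge> 0"
    using assms \<phi> by (intro mult_nonneg_nonneg) (auto simp: set_lebesgue_integral_def intro!: integral_nonneg)
  finally show "0 \<le> (LBINT z:strip T. (pdt \<phi> z * 0 + pdx \<phi> z * (k * step (snd z - b - s * fst z))))" .
qed auto

text \<open>One variation bound for the whole strip rather than one per compact set. It is stable
  under addition, and available because a jump line has finite length in a strip of finite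
  height.\<close>

definition uniform_bv :: "real \<Rightarrow> (real \<times> real \<Rightarrow> real) \<Rightarrow> bool" where
  "uniform_bv T g \<longleftrightarrow> g \<in> borel_measurable borel \<and> bounded (range g) \<and>
    (\<exists>M. \<forall>\<psi>1 \<psi>2. test_fn (strip T) \<psi>1 \<and> test_fn (strip T) \<psi>2 \<and> (\<forall>z. (\<psi>1 z)\<^sup>2 + (\<psi>2 z)\<^sup>2 \<le> 1) \<longrightarrow>
       \<bar>LBINT z:strip T. g z * (pdt \<psi>1 z + pdx \<psi>2 z)\<bar> \<le> M)"

lemma divergence_weighted_integrable:
  assumes "test_fn K \<psi>1" "test_fn K \<psi>2" "g \<in> borel_measurable borel" "bounded (range g)"
  shows "set_integrable lborel (strip T) (\<lambda>z. g z * (pdt \<psi>1 z + pdx \<psi>2 z))"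
  using set_integral_add(1)[OF test_weighted_integrable(1)[OF assms(1,3,4)] test_weighted_integrable(2)[OF assms(2,3,4)]]
  by (simp add: algebra_simps)

lemma uniform_bv_add:
  assumes "uniform_bv T g" "uniform_bv T g'"
  shows "uniform_bv T (\<lambda>z. g z + g' z)"
proof -
  obtain M M' where M:
    "\<forall>\<psi>1 \<psi>2. test_fn (strip T) \<psi>1 \<and> test_fn (strip T) \<psi>2 \<and> (\<forall>z. (\<psi>1 z)\<^sup>2 + (\<psi>2 z)\<^sup>2 \<le> 1) \<longrightarrow>
       \<bar>LBINT z:strip T. g z * (pdt \<psi>1 z + pdx \<psi>2 z)\<bar> \<le> M"
    "\<forall>\<psi>1 \<psi>2. test_fn (strip T) \<psi>1 \<and> test_fn (strip T) \<psi>2 \<and> (\<forall>z. (\<psi>1 z)\<^sup>2 + (\<psi>2 z)\<^sup>2 \<le> 1) \<longrightarrow>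
       \<bar>LBINT z:strip T. g' z * (pdt \<psi>1 z + pdx \<psi>2 z)\<bar> \<le> M'"
    using assms unfolding uniform_bv_def by blast
  have "\<bar>LBINT z:strip T. (g z + g' z) * (pdt \<psi>1 z + pdx \<psi>2 z)\<bar> \<le> M + M'"
    if \<psi>: "test_fn (strip T) \<psi>1 \<and> test_fn (strip T) \<psi>2 \<and> (\<forall>z. (\<psi>1 z)\<^sup>2 + (\<psi>2 z)\<^sup>2 \<le> 1)" for \<psi>1 \<psi>2
  proof -
    have "(LBINT z:strip T. (g z + g' z) * (pdt \<psi>1 z + pdx \<psi>2 z))
      = (LBINT z:strip T. g z * (pdt \<psi>1 z + pdx \<psi>2 z)) + (LBINT z:strip T. g' z * (pdt \<psi>1 z + pdx \<psi>2 z))"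
      using assms \<psi> unfolding distrib_right[of "g _" "g' _"]
      by (intro set_integral_add(2) divergence_weighted_integrable) (auto simp: uniform_bv_def)
    then show ?thesis using M(1)[rule_format, OF \<psi>] M(2)[rule_format, OF \<psi>] by linarith
  qed
  moreover have "bounded (range (\<lambda>z. g z + g' z))"
    using assms by (auto simp: uniform_bv_def intro!: bounded_plus_comp)
  ultimately show ?thesis using assms unfolding uniform_bv_def by auto
qed

lemma uniform_bv_const:
  assumes "0 < T" shows "uniform_bv T (\<lambda>_. k)"
proof -
  have "(LBINT z:strip T. k * (pdt \<psi>1 z + pdx \<psi>2 z)) = 0"
    if \<psi>: "test_fn (strip T) \<psi>1" "test_fn (strip T) \<psi>2" for \<psi>1 \<psi>2
  proof -
    have i: "set_integrable lborel (strip T) (pdt \<psi>1)" "set_integrable lborel (strip T) (pdx \<psi>2)"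
      using test_weighted_integrable[OF \<psi>(1), of "\<lambda>_. 1::real" T] test_weighted_integrable[OF \<psi>(2), of "\<lambda>_. 1::real" T] by auto
    have "(LBINT z:strip T. pdt \<psi>1 z) = 0" "(LBINT z:strip T. pdx \<psi>2 z) = 0"
      using weak_balance_test_interior[OF weak_balance_const[OF assms, of "1::real" 0] \<psi>(1)]
        weak_balance_test_interior[OF weak_balance_const[OF assms, of "0::real" 1] \<psi>(2)] by auto
    then show ?thesis by (simp add: set_integral_add(2)[OF i])
  qed
  then have "\<exists>M. \<forall>\<psi>1 \<psi>2. test_fn (strip T) \<psi>1 \<and> test_fn (strip T) \<psi>2 \<and> (\<forall>z. (\<psi>1 z)\<^sup>2 + (\<psi>2 z)\<^sup>2 \<le> 1) \<longrightarrow>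
       \<bar>LBINT z:strip T. k * (pdt \<psi>1 z + pdx \<psi>2 z)\<bar> \<le> M"
    by (intro exI[of _ 0]) auto
  then show ?thesis unfolding uniform_bv_def by auto
qed

lemma test_fn_trace_bound:
  assumes "test_fn K \<psi>" "\<And>z. \<bar>\<psi> z\<bar> \<le> 1" "0 < T"
  shows "\<bar>LBINT t:{0<..<T}. \<psi> (t, b + s * t)\<bar> \<le> T"
proof -
  have "(\<lambda>t. \<psi> (t, b + s * t)) \<in> borel_measurable borel"
    by (intro borel_measurable_continuous_onI continuous_on_compose2[OF test_fn_continuous(1)[OF assms(1)]])
       (auto intro!: continuous_intros)
  then have m: "(\<lambda>t. indicat_real {0<..<T} t * \<psi> (t, b + s * t)) \<in> borel_measurable borel" by measurable
  have I: "integrable lborel (indicat_real {0<..<T})" using assms by (intro integrable_real_indicator) auto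
  have "integrable lborel (\<lambda>t. indicat_real {0<..<T} t * \<psi> (t, b + s * t))"
    by (rule Bochner_Integration.integrable_bound[OF I]) (use m assms in \<open>auto simp: indicator_def\<close>)
  then have "\<bar>LBINT t:{0<..<T}. \<psi> (t, b + s * t)\<bar> \<le> (LBINT t. \<bar>indicat_real {0<..<T} t\<bar>)"
    unfolding set_lebesgue_integral_def real_scaleR_def using assms I by (intro abs_integral_mult_le) auto
  also have "\<dots> = T" using assms by simp
  finally show ?thesis .
qed

text \<open>Each jump line contributes at most \<open>(1 + \<bar>\<mu> p\<bar>) T\<close> per unit
  of jump. The transport part of the divergence integrates to zero, since the test function has no
  initial trace, and two integrals of test functions along the line remain.\<close>

lemma uniform_bv_layer:
  assumes T: "0 < T" and c: "continuous_on UNIV c" "continuous_on UNIV \<mu>" "continuous_on UNIV \<omega>"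
  shows "uniform_bv T (layer c \<mu> \<omega>)"
proof -
  have [measurable]: "c \<in> borel_measurable borel" "\<mu> \<in> borel_measurable borel" "\<omega> \<in> borel_measurable borel"
    using c by (auto intro: borel_measurable_continuous_onI)
  obtain C where C: "0 \<le> C" "\<And>p. p \<in> {0..1} \<Longrightarrow> norm (\<omega> p) \<le> C"
    using continuous_bounded_unit_interval[OF c(3)] by blast
  obtain L where L: "0 \<le> L" "\<And>p. p \<in> {0..1} \<Longrightarrow> norm (\<mu> p) \<le> L"
    using continuous_bounded_unit_interval[OF c(2)] by blast
  let ?S = "strip T"
  have "\<bar>LBINT z:?S. layer c \<mu> \<omega> z * (pdt \<psi>1 z + pdx \<psi>2 z)\<bar> \<le> (T + L * T) * C"
    if \<psi>: "test_fn ?S \<psi>1" "test_fn ?S \<psi>2" "\<forall>z. (\<psi>1 z)\<^sup>2 + (\<psi>2 z)\<^sup>2 \<le> 1" for \<psi>1 \<psi>2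
  proof -
    note [measurable] = test_fn_measurable[OF \<psi>(1)] test_fn_measurable[OF \<psi>(2)]
    have sub: "test_fn ({..<T} \<times> UNIV) \<psi>1" by (rule test_fn_subset[OF \<psi>(1)]) auto
    have b1: "\<bar>\<psi>1 z\<bar> \<le> 1" "\<bar>\<psi>2 z\<bar> \<le> 1" for z
    proof -
      have "(\<psi>1 z)\<^sup>2 \<le> 1" "(\<psi>2 z)\<^sup>2 \<le> 1"
        using \<psi>(3)[rule_format, of z] zero_le_power2[of "\<psi>1 z"] zero_le_power2[of "\<psi>2 z"] by linarith+
      then show "\<bar>\<psi>1 z\<bar> \<le> 1" "\<bar>\<psi>2 z\<bar> \<le> 1" by (auto simp: abs_square_le_1)
    qed
    let ?H = "\<lambda>p z. step (snd z - c p - \<mu> p * fst z)"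
    define A where "A p = (LBINT z. (indicator ?S z * (pdt \<psi>1 z + pdx \<psi>2 z)) * ?H p z)" for p
    have I: "integrable lborel (\<lambda>z. indicator ?S z * (pdt \<psi>1 z + pdx \<psi>2 z))"
      using divergence_weighted_integrable[OF \<psi>(1,2), of "\<lambda>_. 1" T] by (simp add: set_integrable_def)
    have A: "\<bar>A p\<bar> \<le> T + L * T" if p: "p \<in> {0..1}" for p
    proof -
      have Hm: "?H p \<in> borel_measurable borel" "bounded (range (?H p))"
        using step_bounds by (auto simp: bounded_iff)
      note i1 = test_weighted_integrable[OF \<psi>(1) Hm, of T] and i2 = test_weighted_integrable[OF \<psi>(2) Hm, of T]
      \<comment> \<open>Adding and subtracting \<open>\<mu> p * pdx \<psi>1\<close> lets the time
        derivative enter only through the derivative along the jump line.\<close>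
      have "A p = (LBINT z:?S. (pdt \<psi>1 z *\<^sub>R ?H p z + \<mu> p * (pdx \<psi>1 z *\<^sub>R ?H p z)) - \<mu> p * (pdx \<psi>1 z *\<^sub>R ?H p z) + pdx \<psi>2 z *\<^sub>R ?H p z)"
        unfolding A_def set_lebesgue_integral_def
        by (intro Bochner_Integration.integral_cong) (auto simp: algebra_simps)
      also have "\<dots> = (LBINT z:?S. (pdt \<psi>1 z *\<^sub>R ?H p z + \<mu> p * (pdx \<psi>1 z *\<^sub>R ?H p z)))
            - \<mu> p * (LBINT z:?S. pdx \<psi>1 z *\<^sub>R ?H p z) + (LBINT z:?S. pdx \<psi>2 z *\<^sub>R ?H p z)"
        using i1(1,2) i2(2) 
        by (subst set_integral_add(2) | subst set_integral_diff(2) | simp add: set_integral_add(1) set_integral_diff(1))+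
      also have "(LBINT z:?S. (pdt \<psi>1 z *\<^sub>R ?H p z + \<mu> p * (pdx \<psi>1 z *\<^sub>R ?H p z))) = 0"
        using jump_transport_identity[OF sub T, of "c p" "\<mu> p"] test_fn_zero_outside(1)[OF \<psi>(1), of "(0, _)"]
        by (auto simp: algebra_simps)
      also have "(LBINT z:?S. pdx \<psi>1 z *\<^sub>R ?H p z) = - (LBINT t:{0<..<T}. \<psi>1 (t, c p + \<mu> p * t))"
        using jump_space_identity[OF \<psi>(1), of T "c p" "\<mu> p"] by (simp add: mult.commute)
      also have "(LBINT z:?S. pdx \<psi>2 z *\<^sub>R ?H p z) = - (LBINT t:{0<..<T}. \<psi>2 (t, c p + \<mu> p * t))"
        using jump_space_identity[OF \<psi>(2), of T "c p" "\<mu> p"] by (simp add: mult.commute)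
      finally have e: "A p = \<mu> p * (LBINT t:{0<..<T}. \<psi>1 (t, c p + \<mu> p * t)) - (LBINT t:{0<..<T}. \<psi>2 (t, c p + \<mu> p * t))"
        by simp
      have "\<bar>\<mu> p * (LBINT t:{0<..<T}. \<psi>1 (t, c p + \<mu> p * t))\<bar> \<le> L * T"
        unfolding abs_mult using L p test_fn_trace_bound[OF \<psi>(1) b1(1) T] by (intro mult_mono) auto
      then show ?thesis using e test_fn_trace_bound[OF \<psi>(2) b1(2) T, of "c p" "\<mu> p"] by linarith
    qed
    have "(LBINT z:?S. layer c \<mu> \<omega> z * (pdt \<psi>1 z + pdx \<psi>2 z)) = (LBINT p:{0..1}. A p *\<^sub>R \<omega> p)"
      using layer_Fubini[OF c I] unfolding A_def set_lebesgue_integral_def by (simp add: mult_ac)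
    also have "\<bar>\<dots>\<bar> \<le> (LBINT p. indicator {0..1::real} p * ((T + L * T) * C))"
      unfolding set_lebesgue_integral_def real_norm_def[symmetric]
    proof (rule order_trans[OF integral_norm_bound integral_mono])
      have Am: "A \<in> borel_measurable borel"
        unfolding A_def by (intro lborel.borel_measurable_lebesgue_integral; measurable)
      show bd: "norm (indicator {0..1} p *\<^sub>R A p *\<^sub>R \<omega> p) \<le> indicator {0..1} p * ((T + L * T) * C)" for p
        using A[of p] C(2)[of p] T L(1) by (auto simp: indicator_def abs_mult intro!: mult_mono)
      show i: "integrable lborel (\<lambda>p. indicator {0..1::real} p * ((T + L * T) * C))"
        using integrable_indicator_unit by auto
      show "integrable lborel (\<lambda>p. norm (indicator {0..1} p *\<^sub>R A p *\<^sub>R \<omega> p))"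
        by (rule Bochner_Integration.integrable_bound[OF i]) (use Am bd in \<open>auto intro: order_trans[OF _ abs_ge_self]\<close>)
    qed
    also have "\<dots> = (T + L * T) * C" by simp
    finally show ?thesis .
  qed
  then show ?thesis unfolding uniform_bv_def using layer_measurable[OF c] layer_bounded[OF c] by blast
qed

text \<open>The derivatives of a test function supported in \<open>K\<close> vanish off
  \<open>K\<close>, so its integral over \<open>K\<close> is the one over the strip.\<close>

lemma uniform_bv_imp_bv_loc:
  assumes "uniform_bv T g" shows "bv_loc (strip T) g"
  unfolding bv_loc_def
proof (intro conjI allI impI)
  have g[measurable]: "g \<in> borel_measurable borel" and b: "bounded (range g)" using assms by (auto simp: uniform_bv_def)
  show "set_borel_measurable lborel (strip T) g"
    unfolding set_borel_measurable_def by measurable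
  fix K :: "(real \<times> real) set" assume K: "compact K \<and> K \<subseteq> strip T"
  have [measurable]: "K \<in> sets borel" using K by (auto intro: borel_compact)
  have "integrable lborel (indicat_real K)"
    using K emeasure_compact_finite[of K] by (intro integrable_real_indicator) auto
  from integrable_scaleR_bounded[OF this _ b] g
  show "set_integrable lborel K g" by (simp add: set_integrable_def)
  obtain M where M:
    "\<forall>\<psi>1 \<psi>2. test_fn (strip T) \<psi>1 \<and> test_fn (strip T) \<psi>2 \<and> (\<forall>z. (\<psi>1 z)\<^sup>2 + (\<psi>2 z)\<^sup>2 \<le> 1) \<longrightarrow>
       \<bar>LBINT z:strip T. g z * (pdt \<psi>1 z + pdx \<psi>2 z)\<bar> \<le> M"
    using assms unfolding uniform_bv_def by blast
  have "\<bar>LBINT z:K. g z * (pdt \<psi>1 z + pdx \<psi>2 z)\<bar> \<le> M"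
    if \<psi>: "test_fn K \<psi>1 \<and> test_fn K \<psi>2 \<and> (\<forall>z. (\<psi>1 z)\<^sup>2 + (\<psi>2 z)\<^sup>2 \<le> 1)" for \<psi>1 \<psi>2
  proof -
    have "pdt \<psi>1 z + pdx \<psi>2 z = 0" if "z \<notin> K" for z
      using test_fn_zero_outside[of K \<psi>1] test_fn_zero_outside[of K \<psi>2] \<psi> that by auto
    then have "(LBINT z:K. g z * (pdt \<psi>1 z + pdx \<psi>2 z)) = (LBINT z:strip T. g z * (pdt \<psi>1 z + pdx \<psi>2 z))"
      unfolding set_lebesgue_integral_def using K
      by (intro Bochner_Integration.integral_cong) (auto simp: indicator_def)
    moreover have "test_fn (strip T) \<psi>1" "test_fn (strip T) \<psi>2"
      using \<psi> K by (auto intro: test_fn_subset)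
    ultimately show ?thesis using M[rule_format, of \<psi>1 \<psi>2] \<psi> by simp
  qed
  then show "\<exists>M. \<forall>\<psi>1 \<psi>2. test_fn K \<psi>1 \<and> test_fn K \<psi>2 \<and> (\<forall>z. (\<psi>1 z)\<^sup>2 + (\<psi>2 z)\<^sup>2 \<le> 1) \<longrightarrow>
     \<bar>LBINT z:K. g z * (pdt \<psi>1 z + pdx \<psi>2 z)\<bar> \<le> M" by blast
qed

section \<open>Entropy and flux\<close>

lemma has_vector_derivative_along:
  fixes \<Phi> :: "real \<Rightarrow> 'a::real_normed_vector" and e :: "'a \<Rightarrow> 'b::real_normed_vector"
  assumes \<Phi>: "(\<Phi> has_vector_derivative d) (at p within S)" and e: "(e has_derivative e') (at (\<Phi> p))"
  shows "((\<lambda>p. e (\<Phi> p)) has_vector_derivative e' d) (at p within S)"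
proof -
  have "((\<lambda>p. e (\<Phi> p)) has_derivative (\<lambda>x. e' (x *\<^sub>R d))) (at p within S)"
    by (rule has_derivative_compose[where g = e]) (use \<Phi> e in \<open>auto simp: has_vector_derivative_def\<close>)
  moreover have "e' (x *\<^sub>R d) = x *\<^sub>R e' d" for x
    using has_derivative_linear[OF e] by (rule linear_scale)
  ultimately show ?thesis by (simp add: has_vector_derivative_def)
qed

lemma ent_eq:
  assumes "1 < \<gamma>" "0 < U$1"
  shows "ent \<gamma> U = (U$1) powr (1 - \<gamma>) / (\<gamma> - 1) + ((U$3)\<^sup>2 + (U$4)\<^sup>2) / 2 + (U$2)\<^sup>2 / (2 * U$1)"
proof -
  have "((\<lambda>s. s powr (-\<gamma>)) has_integral - ((U$1) powr (-\<gamma> + 1)) / (-\<gamma> + 1)) {U$1..}"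
    by (rule has_integral_powr_to_inf) (use assms in auto)
  moreover have "- ((U$1) powr (-\<gamma> + 1)) / (-\<gamma> + 1) = (U$1) powr (1 - \<gamma>) / (\<gamma> - 1)"
    using assms by (simp add: field_simps)
  ultimately show ?thesis by (simp add: ent_def pres_def integral_unique)
qed

text \<open>The gradient of the entropy in conservative variables, with components
  \<open>- p - B^2/2\<close>, \<open>B\<close>, \<open>u\<close>, \<open>w\<close> (the entropy
  variables).\<close>

definition dent :: "real \<Rightarrow> real^4 \<Rightarrow> real^4 \<Rightarrow> real" where
  "dent \<gamma> U d = (- pres \<gamma> (U$1) - (magB U)\<^sup>2 / 2) * d$1 + magB U * d$2 + U$3 * d$3 + U$4 * d$4"

text \<open>The Jacobian of the flux. The recurring quotient
  \<open>(d$2 - magB U * d$1) / U$1\<close> is the differential of \<open>B = q / v\<close>.\<close>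

definition dflux :: "real \<Rightarrow> real \<Rightarrow> real^4 \<Rightarrow> real^4 \<Rightarrow> real^4" where
  "dflux \<beta> \<gamma> U d = vector [- (d$3), - \<beta> * d$4,
     - \<gamma> * (U$1) powr (- \<gamma> - 1) * d$1 + magB U * ((d$2 - magB U * d$1) / U$1),
     - \<beta> * ((d$2 - magB U * d$1) / U$1)]"

lemma phys_dom_open: "open phys_dom"
  unfolding phys_dom_def by (intro open_Collect_less continuous_intros)

lemma phys_dom_convex: "convex phys_dom"
proof -
  have "phys_dom = {U. axis 1 1 \<bullet> U > 0}" by (auto simp: phys_dom_def inner_axis')
  then show ?thesis using convex_halfspace_gt[of 0 "axis 1 1 :: real^4"] by simp
qed

lemma vec4_eq_iff: "(x :: 'a^4) = y \<longleftrightarrow> x$1 = y$1 \<and> x$2 = y$2 \<and> x$3 = y$3 \<and> x$4 = y$4"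
  by (auto simp: vec_eq_iff forall_4)

lemma has_derivative_vec_nth [derivative_intros]:
  "(f has_derivative f') F \<Longrightarrow> ((\<lambda>x. f x $ i) has_derivative (\<lambda>h. f' h $ i)) F"
  by (rule bounded_linear.has_derivative[OF bounded_linear_vec_nth])

lemma vector4_nth [simp]:
  "(vector [a, b, c, d] :: 'a::zero^4) $ 1 = a" "(vector [a, b, c, d] :: 'a::zero^4) $ 2 = b"
  "(vector [a, b, c, d] :: 'a::zero^4) $ 3 = c" "(vector [a, b, c, d] :: 'a::zero^4) $ 4 = d"
  by (simp_all add: vector_def)

lemma has_derivative_vec4:
  fixes f :: "'a::real_normed_vector \<Rightarrow> real^4"
  assumes "\<And>i. ((\<lambda>x. f x $ i) has_derivative (\<lambda>h. f' h $ i)) (at x within S)"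
  shows "(f has_derivative f') (at x within S)"
proof (subst has_derivative_componentwise_within, rule ballI)
  fix b :: "real^4" assume "b \<in> Basis"
  then obtain i where b: "b = axis i 1" by (auto simp: Basis_vec_def)
  show "((\<lambda>x. f x \<bullet> b) has_derivative (\<lambda>x. f' x \<bullet> b)) (at x within S)"
    using assms[of i] by (simp add: b inner_axis)
qed

lemma magB_has_derivative:
  assumes "0 < U$1"
  shows "(magB has_derivative (\<lambda>d. (d$2 - magB U * d$1) / U$1)) (at U)"
proof -
  have "((\<lambda>U. U$2 / U$1) has_derivative (\<lambda>d. (d$2 - magB U * d$1) / U$1)) (at U)"
    using assms by (auto intro!: derivative_eq_intros simp: magB_def field_simps)
  then show ?thesis by (simp add: magB_def[abs_def])
qed

lemma powr_entropy_derivative: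
  assumes "1 < \<gamma>" "0 < x"
  shows "((\<lambda>x. x powr (1 - \<gamma>) / (\<gamma> - 1)) has_real_derivative - (x powr (-\<gamma>))) (at x)"
proof -
  have "(1 - \<gamma>) * x powr (1 - \<gamma> - 1) / (\<gamma> - 1) = - (x powr (-\<gamma>))"
    using assms by (simp add: field_simps)
  with DERIV_cdivide[OF has_real_derivative_powr[OF assms(2), of "1 - \<gamma>"], of "\<gamma> - 1"] show ?thesis by metis
qed

lemma pres_has_derivative:
  assumes "0 < x"
  shows "(pres \<gamma> has_real_derivative - \<gamma> * x powr (- \<gamma> - 1)) (at x)"
  using has_real_derivative_powr[OF assms, of "- \<gamma>"] by (simp add: pres_def[abs_def])

lemma ent_has_derivative:
  assumes \<gamma>: "1 < \<gamma>" and U: "0 < U$1"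
  shows "(ent \<gamma> has_derivative dent \<gamma> U) (at U)"
proof -
  have 1: "((\<lambda>U::real^4. (U$1) powr (1 - \<gamma>) / (\<gamma> - 1)) has_derivative (\<lambda>d. d$1 * - pres \<gamma> (U$1))) (at U)"
    unfolding pres_def
    by (rule DERIV_compose_FDERIV[OF powr_entropy_derivative]) (use assms in \<open>auto intro!: derivative_eq_intros\<close>)
  have 2: "((\<lambda>U::real^4. ((U$3)\<^sup>2 + (U$4)\<^sup>2) / 2) has_derivative (\<lambda>d. U$3 * d$3 + U$4 * d$4)) (at U)"
    by (auto intro!: derivative_eq_intros simp: fun_eq_iff)
  have 3: "((\<lambda>U::real^4. (U$2)\<^sup>2 / (2 * U$1)) has_derivative (\<lambda>d. magB U * d$2 - (magB U)\<^sup>2 / 2 * d$1)) (at U)"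
    using U by (auto intro!: derivative_eq_intros simp: fun_eq_iff magB_def field_simps power2_eq_square)
  have "((\<lambda>U. (U$1) powr (1 - \<gamma>) / (\<gamma> - 1) + ((U$3)\<^sup>2 + (U$4)\<^sup>2) / 2 + (U$2)\<^sup>2 / (2 * U$1))
     has_derivative dent \<gamma> U) (at U)"
    using has_derivative_add[OF has_derivative_add[OF 1 2] 3]
    by (rule has_derivative_eq_rhs) (auto simp: fun_eq_iff dent_def algebra_simps)
  then show ?thesis
  proof (rule has_derivative_transform_within_open[OF _ phys_dom_open])
    show "U \<in> phys_dom" using U by (simp add: phys_dom_def)
  qed (auto simp: phys_dom_def ent_eq[OF \<gamma>])
qed

lemma flux_has_derivative:
  assumes U: "0 < U$1"
  shows "(flux \<beta> \<gamma> has_derivative dflux \<beta> \<gamma> U) (at U)"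
proof (rule has_derivative_vec4)
  fix i :: 4
  have p: "((\<lambda>x::real^4. pres \<gamma> (x$1)) has_derivative (\<lambda>d. d$1 * (- \<gamma> * (U$1) powr (- \<gamma> - 1)))) (at U)"
    by (rule DERIV_compose_FDERIV[where f = "pres \<gamma>" and g = "\<lambda>x. x$1"])
       (auto intro!: derivative_eq_intros pres_has_derivative[OF U, simplified])
  note B = magB_has_derivative[OF U]
  have B2: "((\<lambda>x. (magB x)\<^sup>2 / 2) has_derivative (\<lambda>d. magB U * ((d$2 - magB U * d$1) / U$1))) (at U)"
    using U by (auto intro!: derivative_eq_intros B simp: fun_eq_iff field_simps)
  have "i = 1 \<or> i = 2 \<or> i = 3 \<or> i = 4" by (rule exhaust_4)
  then show "((\<lambda>x. flux \<beta> \<gamma> x $ i) has_derivative (\<lambda>h. dflux \<beta> \<gamma> U h $ i)) (at U)"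
  proof (elim disjE)
    assume "i = 3"
    then show ?thesis unfolding flux_def dflux_def
      using has_derivative_add[OF p B2] by (auto simp: mult.commute)
  next
    assume "i = 4"
    then show ?thesis unfolding flux_def dflux_def
      using has_derivative_mult_right[OF B, of "- \<beta>"] by simp
  qed (auto simp: flux_def dflux_def intro!: has_derivative_minus has_derivative_mult_right B has_derivative_vec_nth)
qed

lemma frechet_ent: "1 < \<gamma> \<Longrightarrow> 0 < U$1 \<Longrightarrow> frechet_derivative (ent \<gamma>) (at U) = dent \<gamma> U"
  using frechet_derivative_at[OF ent_has_derivative] by metis

lemma frechet_flux: "0 < U$1 \<Longrightarrow> frechet_derivative (flux \<beta> \<gamma>) (at U) = dflux \<beta> \<gamma> U"
  using frechet_derivative_at[OF flux_has_derivative] by metis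

text \<open>The Bregman distance of the internal energy
  \<open>v powr (1 - \<gamma>) / (\<gamma> - 1)\<close>, whose derivative is minus the
  pressure.\<close>

definition rel_internal :: "real \<Rightarrow> real \<Rightarrow> real \<Rightarrow> real" where
  "rel_internal \<gamma> v z = v powr (1 - \<gamma>) / (\<gamma> - 1) - z powr (1 - \<gamma>) / (\<gamma> - 1) + z powr (- \<gamma>) * (v - z)"

text \<open>The magnetic energy \<open>q^2 / (2 v)\<close> is homogeneous of degree one in
  \<open>(v, q)\<close>, so its Bregman distance collapses to half of \<open>v\<close> times the
  squared difference of the fields. The other parts separate.\<close>

lemma rel_ent_eq:
  assumes \<gamma>: "1 < \<gamma>" and U: "0 < U$1" and V: "0 < V$1"
  shows "rel_ent \<gamma> U V = rel_internal \<gamma> (U$1) (V$1) + ((U$3 - V$3)\<^sup>2 + (U$4 - V$4)\<^sup>2) / 2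
           + U$1 * (magB U - magB V)\<^sup>2 / 2"
proof -
  have "U$2 = U$1 * magB U" "V$2 = V$1 * magB V" using U V by (auto simp: magB_def)
  then show ?thesis
    unfolding rel_ent_def frechet_ent[OF \<gamma> V] ent_eq[OF \<gamma> U] ent_eq[OF \<gamma> V] dent_def rel_internal_def pres_def
    using U V by (simp add: field_simps power2_eq_square)
qed

lemma rel_internal_nonneg:
  assumes "1 < \<gamma>" "0 < v" "0 < z"
  shows "0 \<le> rel_internal \<gamma> v z"
proof -
  define \<pi> where "\<pi> x = x powr (1 - \<gamma>) / (\<gamma> - 1)" for x :: real
  have d: "(\<pi> has_real_derivative - (x powr (-\<gamma>))) (at x)" if "0 < x" for x
    using powr_entropy_derivative[OF assms(1) that] by (simp add: \<pi>_def[abs_def])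
  have "- (z powr (-\<gamma>)) * (v - z) \<le> \<pi> v - \<pi> z"
  proof (rule convex_on_imp_above_tangent[of "{0<..}"])
    show "convex_on {0<..} \<pi>"
    proof (rule convex_on_realI[where f' = "\<lambda>x. - (x powr (-\<gamma>))"])
      fix x y :: real assume "x \<in> {0<..}" "y \<in> {0<..}" "x \<le> y"
      then show "- (x powr - \<gamma>) \<le> - (y powr - \<gamma>)" using assms(1) by (auto intro: powr_mono2')
    qed (use d in auto)
    show "(\<pi> has_real_derivative - (z powr (-\<gamma>))) (at z within {0<..})"
      using d assms by (auto intro: has_field_derivative_at_within)
  qed (use assms in \<open>auto simp: interior_open\<close>)
  then show ?thesis by (simp add: rel_internal_def \<pi>_def)
qed

lemma rel_ent_has_derivative:
  assumes \<gamma>: "1 < \<gamma>" and U: "0 < U$1" and V: "0 < V$1"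
  shows "((\<lambda>u. rel_ent \<gamma> u V) has_derivative (\<lambda>d. dent \<gamma> U d - dent \<gamma> V d)) (at U)"
proof -
  have b: "bounded_linear (dent \<gamma> V)" by (rule has_derivative_bounded_linear[OF ent_has_derivative[OF \<gamma> V]])
  show ?thesis unfolding rel_ent_def frechet_ent[OF \<gamma> V]
    by (auto intro!: derivative_eq_intros ent_has_derivative[OF \<gamma> U] bounded_linear.has_derivative[OF b])
qed

lemma rel_ent_nonneg:
  assumes "1 < \<gamma>" "0 < U$1" "0 < V$1"
  shows "0 \<le> rel_ent \<gamma> U V"
  unfolding rel_ent_eq[OF assms] using rel_internal_nonneg[OF assms] assms by simp

lemma rel_ent_self: "rel_ent \<gamma> U U = 0" if "1 < \<gamma>" "0 < U$1"
  using that by (simp add: rel_ent_eq rel_internal_def)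

text \<open>Strictness is taken from the velocity term alone, since unequal velocities are what is
  known about the two shock states.\<close>

lemma rel_ent_pos:
  assumes "1 < \<gamma>" "0 < U$1" "0 < V$1" "U$3 \<noteq> V$3"
  shows "0 < rel_ent \<gamma> U V"
proof -
  have "0 < (U$3 - V$3)\<^sup>2" using assms by simp
  then show ?thesis
    unfolding rel_ent_eq[OF assms(1-3)] using rel_internal_nonneg[OF assms(1-3)] assms
    by (intro add_pos_nonneg add_nonneg_pos) (auto intro: add_pos_nonneg)
qed

section \<open>Pointwise values and half-line masses of superpositions\<close>

lemma unit_interval_threshold:
  fixes P :: "real \<Rightarrow> bool"
  assumes down: "\<And>p q. p \<in> {0..1} \<Longrightarrow> q \<in> {0..1} \<Longrightarrow> p \<le> q \<Longrightarrow> P q \<Longrightarrow> P p"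
  shows "\<exists>\<rho>\<in>{0..1}. \<forall>p\<in>{0..1}. (p < \<rho> \<longrightarrow> P p) \<and> (\<rho> < p \<longrightarrow> \<not> P p)"
proof -
  \<comment> \<open>Inserting 0 keeps the set nonempty when \<open>P\<close> fails everywhere.
    Nothing is claimed at the threshold itself, a single label being invisible to the
    integrals.\<close>
  define A where "A = insert 0 {p\<in>{0..1}. P p}"
  have A: "A \<noteq> {}" "bdd_above A" "A \<subseteq> {0..1}" by (auto simp: A_def intro!: bdd_aboveI[of _ 1])
  have up: "q \<le> Sup A" if "q \<in> A" for q using that A by (intro cSup_upper)
  have "Sup A \<in> {0..1}"
    using up[of 0] cSup_least[OF A(1), of 1] A(3) by (fastforce simp: A_def)
  moreover have "P p" if p: "p \<in> {0..1}" "p < Sup A" for p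
  proof -
    obtain q where "q \<in> A" "p < q" using less_cSupD[OF A(1) p(2)] by blast
    then show ?thesis using down[of p q] p A(3) by (auto simp: A_def)
  qed
  moreover have "\<not> P p" if "p \<in> {0..1}" "Sup A < p" for p
    using up[of p] that by (auto simp: A_def)
  ultimately show ?thesis by blast
qed

text \<open>The step factor cuts the label integral down to \<open>{l..r}\<close>, where the
  fundamental theorem applies. The endpoints are a null set, so \<open>on\<close> and
  \<open>off\<close> may leave them open.\<close>

lemma layer_eval:
  fixes g :: "real \<Rightarrow> 'b::euclidean_space"
  assumes "continuous_on UNIV c" "continuous_on UNIV \<mu>" "continuous_on UNIV \<omega>"
    and g: "\<And>p. p \<in> {0..1} \<Longrightarrow> (g has_vector_derivative \<omega> p) (at p within {0..1})"
    and lr: "0 \<le> l" "l \<le> r" "r \<le> 1"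
    and on: "\<And>p. l < p \<Longrightarrow> p < r \<Longrightarrow> c p + \<mu> p * t < x"
    and off: "\<And>p. p \<in> {0..1} \<Longrightarrow> p < l \<or> r < p \<Longrightarrow> x \<le> c p + \<mu> p * t"
  shows "layer c \<mu> \<omega> (t, x) = g r - g l"
proof -
  have [measurable]: "c \<in> borel_measurable borel" "\<mu> \<in> borel_measurable borel" "\<omega> \<in> borel_measurable borel"
    using assms by (auto intro: borel_measurable_continuous_onI)
  have "layer c \<mu> \<omega> (t, x) = (LBINT p. indicator {l..r} p *\<^sub>R \<omega> p)"
    unfolding layer_def set_lebesgue_integral_def
  proof (rule integral_cong_AE)
    show "AE p in lborel. indicator {0..1} p *\<^sub>R step (snd (t, x) - c p - \<mu> p * fst (t, x)) *\<^sub>R \<omega> p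
        = indicator {l..r} p *\<^sub>R \<omega> p"
      using AE_lborel_singleton[of l] AE_lborel_singleton[of r]
    proof eventually_elim
      case (elim p)
      then show ?case using lr on[of p] off[of p] by (cases "l < p \<and> p < r") (auto simp: indicator_def)
    qed
  qed auto
  also have "\<dots> = g r - g l"
    using lr assms(3) by (intro integral_FTC_Icc has_vector_derivative_within_subset[OF g]) (auto intro: continuous_on_subset)
  finally show ?thesis .
qed

lemma layer_constant: "layer (\<lambda>_. b) (\<lambda>_. s) (\<lambda>_. k) (t, x) = step (x - b - s * t) *\<^sub>R k"
  by (simp add: layer_def set_lebesgue_integral_def)

text \<open>Up to \<open>h\<close>, a jump at position \<open>X\<close> contributes
  \<open>h - X\<close> times its size, and Fubini sums over the labels. The common lower bound
  \<open>l\<close> on the positions keeps the mass on the half-line finite.\<close>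

lemma layer_left_mass:
  fixes \<omega> :: "real \<Rightarrow> real"
  assumes c: "continuous_on UNIV c" "continuous_on UNIV \<mu>" "continuous_on UNIV \<omega>"
    and X: "\<And>p. p \<in> {0..1} \<Longrightarrow> l \<le> c p + \<mu> p * t \<and> c p + \<mu> p * t \<le> h"
  shows "has_bochner_integral lborel (\<lambda>x. indicator {..h} x * layer c \<mu> \<omega> (t, x)) (LBINT p:{0..1}. (h - c p - \<mu> p * t) * \<omega> p)"
proof -
  have [measurable]: "c \<in> borel_measurable borel" "\<mu> \<in> borel_measurable borel" "\<omega> \<in> borel_measurable borel"
    using c by (auto intro: borel_measurable_continuous_onI)
  have lm: "(\<lambda>x. layer c \<mu> \<omega> (t, x)) \<in> borel_measurable borel"
    using layer_measurable[OF c] by (rule measurable_compose[rotated]) (simp add: borel_prod[symmetric] del: borel_prod)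
  have lb: "bounded (range (\<lambda>x. layer c \<mu> \<omega> (t, x)))"
    using layer_bounded[OF c] by (rule bounded_subset) auto
  have I: "integrable lborel (indicat_real {l..h})"
    using X[of 0] by (intro integrable_real_indicator) auto
  have out: "layer c \<mu> \<omega> (t, x) = 0" if "x < l" for x
  proof -
    have "indicator {0..1} p *\<^sub>R step (snd (t, x) - c p - \<mu> p * fst (t, x)) *\<^sub>R \<omega> p = 0" for p
      using X[of p] that by (auto simp: indicator_def)
    then show ?thesis unfolding layer_def set_lebesgue_integral_def by (simp only: integral_zero)
  qed
  have eq: "indicator {..h} x * layer c \<mu> \<omega> (t, x) = indicator {l..h} x * layer c \<mu> \<omega> (t, x)" for x
    using out[of x] by (auto simp: indicator_def)
  have "(LBINT x. indicator {l..h} x *\<^sub>R layer c \<mu> \<omega> (t, x)) 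
     = (LBINT p:{0..1}. (LBINT x. indicator {l..h} x * step (x - c p - \<mu> p * t)) *\<^sub>R \<omega> p)"
    unfolding layer_def fst_conv snd_conv
    by (rule unit_interval_Fubini[OF I c(3)]) (auto simp: step_bounds)
  also have "\<dots> = (LBINT p:{0..1}. (h - c p - \<mu> p * t) * \<omega> p)"
  proof (rule set_lebesgue_integral_cong)
    show "\<forall>p. p \<in> {0..1} \<longrightarrow> (LBINT x. indicator {l..h} x * step (x - c p - \<mu> p * t)) *\<^sub>R \<omega> p = (h - c p - \<mu> p * t) * \<omega> p"
    proof (intro allI impI)
      fix p :: real assume p: "p \<in> {0..1}"
      have "(\<lambda>x. indicator {l..h} x * step (x - c p - \<mu> p * t)) = indicat_real {c p + \<mu> p * t<..h}"
        using X[OF p] by (auto simp: fun_eq_iff indicator_def step_def)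
      then show "(LBINT x. indicator {l..h} x * step (x - c p - \<mu> p * t)) *\<^sub>R \<omega> p = (h - c p - \<mu> p * t) * \<omega> p"
        using X[OF p] by simp
    qed
  qed auto
  finally show ?thesis unfolding has_bochner_integral_iff eq
    using integrable_scaleR_bounded[OF I _ lb] lm by simp
qed

text \<open>To the right, the total minus the superposition is the integrable quantity: it is built
  from \<open>1 - step\<close>, which vanishes beyond the last jump.\<close>

lemma layer_right_mass:
  fixes \<omega> :: "real \<Rightarrow> real"
  assumes c: "continuous_on UNIV c" "continuous_on UNIV \<mu>" "continuous_on UNIV \<omega>"
    and X: "\<And>p. p \<in> {0..1} \<Longrightarrow> h \<le> c p + \<mu> p * t \<and> c p + \<mu> p * t \<le> r"
  shows "has_bochner_integral lborel (\<lambda>x. indicator {h<..} x * ((LBINT p:{0..1}. \<omega> p) - layer c \<mu> \<omega> (t, x)))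
    (LBINT p:{0..1}. (c p + \<mu> p * t - h) * \<omega> p)"
proof -
  have [measurable]: "c \<in> borel_measurable borel" "\<mu> \<in> borel_measurable borel" "\<omega> \<in> borel_measurable borel"
    using c by (auto intro: borel_measurable_continuous_onI)
  define M where "M x = (LBINT p:{0..1}. (1 - step (x - c p - \<mu> p * t)) *\<^sub>R \<omega> p)" for x
  have i\<omega>: "set_integrable lborel {0..1} \<omega>"
    unfolding set_integrable_def using c(3) by (intro borel_integrable_compact) (auto intro: continuous_on_subset)
  have M: "(LBINT p:{0..1}. \<omega> p) - layer c \<mu> \<omega> (t, x) = M x" for x
    unfolding layer_def M_def fst_conv snd_conv
      set_integral_diff(2)[OF i\<omega> layer_integrand_integrable[OF c], symmetric]
    by (simp add: algebra_simps)
  have lm: "(\<lambda>x. layer c \<mu> \<omega> (t, x)) \<in> borel_measurable borel"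
    using layer_measurable[OF c] by (rule measurable_compose[rotated]) (simp add: borel_prod[symmetric] del: borel_prod)
  have Mm: "M \<in> borel_measurable borel" unfolding M[symmetric, abs_def] using lm by simp
  have "bounded (range (\<lambda>x. layer c \<mu> \<omega> (t, x)))"
    using layer_bounded[OF c] by (rule bounded_subset) auto
  then have Mb: "bounded (range M)" unfolding M[symmetric, abs_def]
    by (intro bounded_minus_comp) auto
  have I: "integrable lborel (indicat_real {h<..r})"
    using X[of 0] by (intro integrable_real_indicator) auto
  have out: "M x = 0" if "r < x" for x
  proof -
    have "indicator {0..1} p *\<^sub>R (1 - step (x - c p - \<mu> p * t)) *\<^sub>R \<omega> p = 0" for p
      using X[of p] that by (auto simp: indicator_def)
    then show ?thesis unfolding M_def set_lebesgue_integral_def by (simp only: integral_zero)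
  qed
  have eq: "indicator {h<..} x * M x = indicator {h<..r} x * M x" for x
    using out[of x] by (auto simp: indicator_def)
  have "(LBINT x. indicator {h<..r} x *\<^sub>R M x) 
     = (LBINT p:{0..1}. (LBINT x. indicator {h<..r} x * (1 - step (x - c p - \<mu> p * t))) *\<^sub>R \<omega> p)"
    unfolding M_def
    by (rule unit_interval_Fubini[OF I c(3)]) (auto simp: step_def)
  also have "\<dots> = (LBINT p:{0..1}. (c p + \<mu> p * t - h) * \<omega> p)"
  proof (rule set_lebesgue_integral_cong)
    show "\<forall>p. p \<in> {0..1} \<longrightarrow> (LBINT x. indicator {h<..r} x * (1 - step (x - c p - \<mu> p * t))) *\<^sub>R \<omega> p = (c p + \<mu> p * t - h) * \<omega> p"
    proof (intro allI impI)
      fix p :: real assume p: "p \<in> {0..1}"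
      have "(\<lambda>x. indicator {h<..r} x * (1 - step (x - c p - \<mu> p * t))) = indicat_real {h<..c p + \<mu> p * t}"
        using X[OF p] by (auto simp: fun_eq_iff indicator_def step_def)
      then show "(LBINT x. indicator {h<..r} x * (1 - step (x - c p - \<mu> p * t))) *\<^sub>R \<omega> p = (c p + \<mu> p * t - h) * \<omega> p"
        using X[OF p] by simp
    qed
  qed auto
  finally show ?thesis unfolding has_bochner_integral_iff M eq
    using integrable_scaleR_bounded[OF I _ Mb] Mm by simp
qed

lemma nn_integral_of_nonneg_mass:
  fixes f :: "real \<Rightarrow> real"
  assumes hb: "has_bochner_integral lborel (\<lambda>x. indicator S x * f x) A" and nn: "\<And>x. 0 \<le> f x"
  shows "(\<integral>\<^sup>+x\<in>S. ennreal (f x) \<partial>lborel) = ennreal A" "0 \<le> A"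
proof -
  have "(\<integral>\<^sup>+x\<in>S. ennreal (f x) \<partial>lborel) = (\<integral>\<^sup>+x. ennreal (indicator S x * f x) \<partial>lborel)"
    by (intro nn_integral_cong) (auto simp: indicator_def)
  also have "\<dots> = ennreal A"
    using nn_integral_eq_integral[of lborel "\<lambda>x. indicator S x * f x"] hb nn
    by (simp add: has_bochner_integral_iff)
  finally show "(\<integral>\<^sup>+x\<in>S. ennreal (f x) \<partial>lborel) = ennreal A" .
  have "0 \<le> (LBINT x. indicator S x * f x)" using nn by (intro Bochner_Integration.integral_nonneg) auto
  then show "0 \<le> A" using hb by (simp add: has_bochner_integral_iff)
qed

lemma null_set_avoid:
  assumes "N \<in> null_sets lborel" "a < (b::real)"
  shows "\<exists>x. a < x \<and> x < b \<and> x \<notin> N"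
proof (rule ccontr)
  assume "\<not> ?thesis"
  then have "{a<..<b} \<subseteq> N" by auto
  then have "emeasure lborel {a<..<b} \<le> emeasure lborel N"
    using assms by (intro emeasure_mono) auto
  also have "\<dots> = 0" using assms by auto
  finally show False using assms by simp
qed

section \<open>Solutions with a plateau\<close>

lemma bv_loc_cong:
  assumes g: "bv_loc \<Omega> g" and eq: "\<And>z. z \<in> \<Omega> \<Longrightarrow> f z = g z"
  shows "bv_loc \<Omega> f"
  unfolding bv_loc_def
proof (intro conjI allI impI)
  have i: "(\<lambda>z. indicator K z *\<^sub>R f z) = (\<lambda>z. indicator K z *\<^sub>R g z)"
    "(\<lambda>z. indicator K z *\<^sub>R (f z * y z)) = (\<lambda>z. indicator K z *\<^sub>R (g z * y z))" if "K \<subseteq> \<Omega>" for K y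
    using that eq by (auto simp: indicator_def fun_eq_iff)
  show "set_borel_measurable lborel \<Omega> f"
    using g unfolding bv_loc_def set_borel_measurable_def i(1)[OF order_refl] by blast
  fix K assume K: "compact K \<and> K \<subseteq> \<Omega>"
  show "set_integrable lborel K f"
    using g K unfolding bv_loc_def set_integrable_def i(1)[OF conjunct2[OF K]] by blast
  show "\<exists>M. \<forall>\<psi>1 \<psi>2. test_fn K \<psi>1 \<and> test_fn K \<psi>2 \<and> (\<forall>z. (\<psi>1 z)\<^sup>2 + (\<psi>2 z)\<^sup>2 \<le> 1) \<longrightarrow>
              \<bar>LBINT z:K. f z * (pdt \<psi>1 z + pdx \<psi>2 z)\<bar> \<le> M"
    using g K unfolding bv_loc_def set_lebesgue_integral_def i(2)[OF conjunct2[OF K]] by blast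
qed

lemma a_contractionD:
  assumes ac: "a_contraction \<beta> \<gamma> Q a Ul Ur \<sigma>" and UK: "bounded UK" "convex UK" "UK \<subseteq> phys_dom"
    and U: "0 < T" "entropy_weak_sol \<beta> \<gamma> Q T U U0" "\<And>t x. t \<in> {0<..<T} \<Longrightarrow> U (t, x) \<in> UK" "\<And>x. U0 x \<in> UK"
      "\<And>i. bv_loc (strip T) (\<lambda>z. U z $ i)" "Ea \<gamma> a Ul Ur U0 0 < \<infinity>"
  shows "\<exists>h :: real \<Rightarrow> real. h 0 = 0 \<and> (\<exists>L. L-lipschitz_on {0..<T} h) \<and>
    (\<exists>N. N \<in> null_sets lborel \<and>
       (\<forall>s t. s \<notin> N \<and> t \<notin> N \<and> 0 < s \<and> s < t \<and> t < T \<longrightarrow>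
          Ea \<gamma> a Ul Ur (\<lambda>x. U (t, x)) (h t) \<le> Ea \<gamma> a Ul Ur (\<lambda>x. U (s, x)) (h s)))"
  using ac unfolding a_contraction_def
  apply (elim allE[of _ UK] impE)
  subgoal using UK by blast
  apply (elim exE allE[of _ T] allE[of _ U] allE[of _ U0] impE)
  subgoal using U by blast
  by (elim exE conjE, intro exI conjI) assumption+

text \<open>
  Either \<open>W = Ul\<close> or \<open>W = Ur\<close> in the application, so that exactly one of the two jumps with speed \<open>\<sigma>\<close> is
  nontrivial. From left to right the solution takes the values \<open>Ul\<close>, \<open>W\<close>, \<open>\<Phi> 1\<close>, \<open>W\<close>, \<open>Ur\<close>, with
  transitions starting at \<open>-5\<close>, \<open>[-3,-2]\<close>, \<open>[2,3]\<close> and \<open>5\<close>; they do not meet before time \<open>T\<close>.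
\<close>
locale bump =
  fixes \<beta> \<gamma> :: real and Q :: "real^4 \<Rightarrow> real" and a :: real and Ul Ur W :: "real^4" and \<sigma> :: real
    and \<Phi> \<Phi>' :: "real \<Rightarrow> real^4" and \<mu> :: "real \<Rightarrow> real" and K :: real
  assumes \<gamma>: "1 < \<gamma>" and Q: "is_entropy_flux \<beta> \<gamma> Q" and a: "0 < a"
    and Ul: "0 < Ul$1" and Ur: "0 < Ur$1"
    and rh: "flux \<beta> \<gamma> W - flux \<beta> \<gamma> Ul = \<sigma> *\<^sub>R (W - Ul)" "flux \<beta> \<gamma> Ur - flux \<beta> \<gamma> W = \<sigma> *\<^sub>R (Ur - W)"
    and dissip: "Q W - Q Ul \<le> \<sigma> * (ent \<gamma> W - ent \<gamma> Ul)" "Q Ur - Q W \<le> \<sigma> * (ent \<gamma> Ur - ent \<gamma> W)"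
    and \<Phi>_pos: "\<And>p. 0 < \<Phi> p $ 1"
    and \<Phi>_cont: "continuous_on UNIV \<Phi>" "continuous_on UNIV \<Phi>'" "continuous_on UNIV \<mu>"
    and \<Phi>_deriv: "\<And>p. p \<in> {0..1} \<Longrightarrow> (\<Phi> has_vector_derivative \<Phi>' p) (at p within {0..1})"
    and \<Phi>_eigen: "\<And>p. p \<in> {0..1} \<Longrightarrow> dflux \<beta> \<gamma> (\<Phi> p) (\<Phi>' p) = \<mu> p *\<^sub>R \<Phi>' p"
    and \<Phi>0: "\<Phi> 0 = W"
    and \<mu>_lip: "K-lipschitz_on {0..1} \<mu>"
    and balance: "rel_ent \<gamma> (\<Phi> 1) Ul = a * rel_ent \<gamma> (\<Phi> 1) Ur"
    and growth: "0 < (LBINT p:{0..1}. (\<sigma> - \<mu> p) * ((dent \<gamma> (\<Phi> p) (\<Phi>' p) - dent \<gamma> Ul (\<Phi>' p))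
                   - a * (dent \<gamma> (\<Phi> p) (\<Phi>' p) - dent \<gamma> Ur (\<Phi>' p))))"
begin

definition layered :: "'b \<Rightarrow> 'b \<Rightarrow> 'b \<Rightarrow> (real \<Rightarrow> 'b) \<Rightarrow> real \<times> real \<Rightarrow> 'b::euclidean_space" where
  "layered l w r \<omega> z = l + (layer (\<lambda>_. -5) (\<lambda>_. \<sigma>) (\<lambda>_. w - l) z + (layer (\<lambda>p. p - 3) \<mu> \<omega> z
     + (layer (\<lambda>p. 3 - p) \<mu> (\<lambda>p. - \<omega> p) z + layer (\<lambda>_. 5) (\<lambda>_. \<sigma>) (\<lambda>_. r - w) z)))"

definition U :: "real \<times> real \<Rightarrow> real^4" where
  "U = layered Ul W Ur \<Phi>'"

definition L :: real where "L = (SOME L. 0 \<le> L \<and> (\<forall>p\<in>{0..1}. \<bar>\<mu> p\<bar> \<le> L))"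

lemma L: "0 \<le> L" "p \<in> {0..1} \<Longrightarrow> \<bar>\<mu> p\<bar> \<le> L"
proof -
  have "\<exists>L. 0 \<le> L \<and> (\<forall>p\<in>{0..1}. \<bar>\<mu> p\<bar> \<le> L)"
    using continuous_bounded_unit_interval[OF \<Phi>_cont(3)] by (metis real_norm_def)
  from someI_ex[OF this] show "0 \<le> L" "p \<in> {0..1} \<Longrightarrow> \<bar>\<mu> p\<bar> \<le> L" unfolding L_def by auto
qed

text \<open>Up to \<open>T\<close> each of \<open>K t\<close>, \<open>L t\<close> and
  \<open>\<bar>\<sigma>\<bar> t\<close> is at most 1/2. The first keeps characteristics from
  crossing in the compressive wave. The other two confine every transition to distance 1/2 from its
  start, so that transitions stay apart and the plateau covers \<open>[-1, 1]\<close>. The added 1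
  keeps the denominator positive.\<close>

definition T :: real where "T = 1 / (2 * (1 + K + L + \<bar>\<sigma>\<bar>))"

lemma K0: "0 \<le> K" using lipschitz_on_nonneg[OF \<mu>_lip] .

lemma T_pos: "0 < T" using K0 L(1) by (simp add: T_def)

lemma T_bounds:
  assumes "t \<in> {0..<T}"
  shows "K * t \<le> 1/2" "\<bar>\<sigma> * t\<bar> \<le> 1/2" "p \<in> {0..1} \<Longrightarrow> \<bar>\<mu> p * t\<bar> \<le> 1/2"
proof -
  have D: "0 < 1 + K + L + \<bar>\<sigma>\<bar>" using K0 L(1) by simp
  have *: "(1 + K + L + \<bar>\<sigma>\<bar>) * t \<le> 1/2"
    using assms D by (simp add: T_def field_simps)
  have m: "k * t \<le> 1/2" if "k \<le> 1 + K + L + \<bar>\<sigma>\<bar>" for k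
    using mult_right_mono[OF that, of t] assms * by auto
  show "K * t \<le> 1/2" using L(1) by (intro m) simp
  show "\<bar>\<sigma> * t\<bar> \<le> 1/2" using m[of "\<bar>\<sigma>\<bar>"] K0 L(1) assms by (simp add: abs_mult)
  show "\<bar>\<mu> p * t\<bar> \<le> 1/2" if "p \<in> {0..1}"
    using m[of "\<bar>\<mu> p\<bar>"] K0 L(2)[OF that] assms by (simp add: abs_mult)
qed

text \<open>Two characteristics of initial distance \<open>q - p\<close> approach each other by at
  most \<open>K t (q - p)\<close>, which is no more than half of it. Labels increase to the right in
  the first wave and to the left in the second, hence the two orders.\<close>

lemma positions_mono:
  assumes t: "t \<in> {0..<T}" and p: "p \<in> {0..1}" "q \<in> {0..1}" "p \<le> q"
  shows "p - 3 + \<mu> p * t \<le> q - 3 + \<mu> q * t" "3 - q + \<mu> q * t \<le> 3 - p + \<mu> p * t"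
proof -
  have "\<bar>\<mu> p - \<mu> q\<bar> \<le> K * \<bar>p - q\<bar>" using lipschitz_onD[OF \<mu>_lip p(1,2)] by (simp add: dist_real_def)
  then have "\<bar>\<mu> p - \<mu> q\<bar> * t \<le> K * \<bar>p - q\<bar> * t" using t by (intro mult_right_mono) auto
  also have "\<dots> \<le> 1/2 * \<bar>p - q\<bar>" using mult_right_mono[OF T_bounds(1)[OF t], of "\<bar>p - q\<bar>"] by (simp add: mult_ac)
  finally have "\<bar>\<mu> p * t - \<mu> q * t\<bar> \<le> 1/2 * (q - p)" using t p by (simp add: abs_mult left_diff_distrib[symmetric])
  moreover have gen: "A - B \<le> d \<and> B - A \<le> d" if "\<bar>A - B\<bar> \<le> 1/2 * d" "0 \<le> d" for A B d :: real
    using that by linarith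
  ultimately have "\<mu> p * t - \<mu> q * t \<le> q - p" "\<mu> q * t - \<mu> p * t \<le> q - p" using p(3) gen by auto
  then show "p - 3 + \<mu> p * t \<le> q - 3 + \<mu> q * t" "3 - q + \<mu> q * t \<le> 3 - p + \<mu> p * t" by simp_all
qed

lemma positions_cont: "continuous_on UNIV (\<lambda>p::real. p - 3)" "continuous_on UNIV (\<lambda>p::real. 3 - p)"
  by (intro continuous_intros)+

text \<open>The label whose characteristic reaches \<open>x\<close> at time \<open>t\<close>: a
  generalised inverse of the position map, with value in \<open>[0, 1]\<close> also outside the
  wave. In \<open>\<rho>R\<close> the inequality is reversed because labels decrease to the right
  there.\<close>

definition \<rho>L :: "real \<Rightarrow> real \<Rightarrow> real" where
  "\<rho>L t x = (SOME \<rho>. \<rho> \<in> {0..1} \<and> (\<forall>p\<in>{0..1}. (p < \<rho> \<longrightarrow> p - 3 + \<mu> p * t < x) \<and> (\<rho> < p \<longrightarrow> \<not> p - 3 + \<mu> p * t < x)))"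

definition \<rho>R :: "real \<Rightarrow> real \<Rightarrow> real" where
  "\<rho>R t x = (SOME \<rho>. \<rho> \<in> {0..1} \<and> (\<forall>p\<in>{0..1}. (p < \<rho> \<longrightarrow> x \<le> 3 - p + \<mu> p * t) \<and> (\<rho> < p \<longrightarrow> \<not> x \<le> 3 - p + \<mu> p * t)))"

lemma \<rho>L:
  assumes "t \<in> {0..<T}"
  shows "\<rho>L t x \<in> {0..1}" "p \<in> {0..1} \<Longrightarrow> p < \<rho>L t x \<Longrightarrow> p - 3 + \<mu> p * t < x" "p \<in> {0..1} \<Longrightarrow> \<rho>L t x < p \<Longrightarrow> x \<le> p - 3 + \<mu> p * t"
proof -
  have "\<exists>\<rho>\<in>{0..1}. \<forall>p\<in>{0..1}. (p < \<rho> \<longrightarrow> p - 3 + \<mu> p * t < x) \<and> (\<rho> < p \<longrightarrow> \<not> p - 3 + \<mu> p * t < x)"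
    by (rule unit_interval_threshold) (use positions_mono(1)[OF assms] in fastforce)
  then have "\<exists>\<rho>. \<rho> \<in> {0..1} \<and> (\<forall>p\<in>{0..1}. (p < \<rho> \<longrightarrow> p - 3 + \<mu> p * t < x) \<and> (\<rho> < p \<longrightarrow> \<not> p - 3 + \<mu> p * t < x))"
    by blast
  from someI_ex[OF this, folded \<rho>L_def]
  show "\<rho>L t x \<in> {0..1}" "p \<in> {0..1} \<Longrightarrow> p < \<rho>L t x \<Longrightarrow> p - 3 + \<mu> p * t < x" "p \<in> {0..1} \<Longrightarrow> \<rho>L t x < p \<Longrightarrow> x \<le> p - 3 + \<mu> p * t"
    by (auto simp: not_less)
qed

lemma \<rho>R:
  assumes "t \<in> {0..<T}"
  shows "\<rho>R t x \<in> {0..1}" "p \<in> {0..1} \<Longrightarrow> p < \<rho>R t x \<Longrightarrow> x \<le> 3 - p + \<mu> p * t" "p \<in> {0..1} \<Longrightarrow> \<rho>R t x < p \<Longrightarrow> 3 - p + \<mu> p * t < x"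
proof -
  have "\<exists>\<rho>\<in>{0..1}. \<forall>p\<in>{0..1}. (p < \<rho> \<longrightarrow> x \<le> 3 - p + \<mu> p * t) \<and> (\<rho> < p \<longrightarrow> \<not> x \<le> 3 - p + \<mu> p * t)"
    by (rule unit_interval_threshold) (use positions_mono(2)[OF assms] in fastforce)
  then have "\<exists>\<rho>. \<rho> \<in> {0..1} \<and> (\<forall>p\<in>{0..1}. (p < \<rho> \<longrightarrow> x \<le> 3 - p + \<mu> p * t) \<and> (\<rho> < p \<longrightarrow> \<not> x \<le> 3 - p + \<mu> p * t))"
    by blast
  from someI_ex[OF this, folded \<rho>R_def]
  show "\<rho>R t x \<in> {0..1}" "p \<in> {0..1} \<Longrightarrow> p < \<rho>R t x \<Longrightarrow> x \<le> 3 - p + \<mu> p * t" "p \<in> {0..1} \<Longrightarrow> \<rho>R t x < p \<Longrightarrow> 3 - p + \<mu> p * t < x"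
    by (auto simp: not_le)
qed

text \<open>The cuts at -4, 0 and 4 lie between the transitions, which move by at most 1/2 from
  their starting places, so the solution is constant near each cut.\<close>

definition state :: "real \<Rightarrow> real \<Rightarrow> real^4" where
  "state t x = (if x \<le> -4 then (if -5 + \<sigma> * t < x then W else Ul)
     else if x \<le> 0 then \<Phi> (\<rho>L t x) else if x \<le> 4 then \<Phi> (\<rho>R t x) else (if 5 + \<sigma> * t < x then Ur else W))"

lemma layered_parts:
  fixes e :: "real^4 \<Rightarrow> 'b::euclidean_space"
  assumes t: "t \<in> {0..<T}" and \<omega>: "continuous_on UNIV \<omega>"
    and e: "\<And>p. p \<in> {0..1} \<Longrightarrow> ((\<lambda>p. e (\<Phi> p)) has_vector_derivative \<omega> p) (at p within {0..1})"
  shows "x \<le> -2 - 1/2 - 1 \<Longrightarrow> layer (\<lambda>p. p - 3) \<mu> \<omega> (t, x) = 0"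
    "x > -2 + 1/2 \<Longrightarrow> layer (\<lambda>p. p - 3) \<mu> \<omega> (t, x) = e (\<Phi> 1) - e W"
    "x \<le> 2 - 1/2 \<Longrightarrow> layer (\<lambda>p. 3 - p) \<mu> (\<lambda>p. - \<omega> p) (t, x) = 0"
    "x > 3 + 1/2 \<Longrightarrow> layer (\<lambda>p. 3 - p) \<mu> (\<lambda>p. - \<omega> p) (t, x) = e W - e (\<Phi> 1)"
    "layer (\<lambda>p. p - 3) \<mu> \<omega> (t, x) = e (\<Phi> (\<rho>L t x)) - e W"
    "layer (\<lambda>p. 3 - p) \<mu> (\<lambda>p. - \<omega> p) (t, x) = e (\<Phi> (\<rho>R t x)) - e (\<Phi> 1)"
proof -
  have b: "- (1/2) \<le> \<mu> p * t \<and> \<mu> p * t \<le> 1/2" if "p \<in> {0..1}" for p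
    using T_bounds(3)[OF t that] by linarith
  have e': "((\<lambda>p. - e (\<Phi> p)) has_vector_derivative - \<omega> p) (at p within {0..1})" if "p \<in> {0..1}" for p
    using e[OF that] by (rule has_vector_derivative_minus)
  have \<omega>': "continuous_on UNIV (\<lambda>p. - \<omega> p)" using \<omega> by (intro continuous_intros)
  note up = layer_eval[OF positions_cont(1) \<Phi>_cont(3) \<omega> e, where t = t and x = x and l = 0]
  note dn = layer_eval[OF positions_cont(2) \<Phi>_cont(3) \<omega>' e', where t = t and x = x and r = 1]
  show "layer (\<lambda>p. p - 3) \<mu> \<omega> (t, x) = e (\<Phi> (\<rho>L t x)) - e W"
    using up[of "\<rho>L t x"] \<rho>L[OF t, where x = x] \<Phi>0 by auto
  show "layer (\<lambda>p. 3 - p) \<mu> (\<lambda>p. - \<omega> p) (t, x) = e (\<Phi> (\<rho>R t x)) - e (\<Phi> 1)"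
    using dn[of "\<rho>R t x"] \<rho>R[OF t, where x = x] by auto
  have X: "p - 3 + \<mu> p * t \<le> -2 + 1/2" "-2 - 1/2 - 1 \<le> p - 3 + \<mu> p * t"
    "3 - p + \<mu> p * t \<le> 3 + 1/2" "2 - 1/2 \<le> 3 - p + \<mu> p * t" if "p \<in> {0..1}" for p
    using b[OF that] that by auto
  show "layer (\<lambda>p. p - 3) \<mu> \<omega> (t, x) = 0" if "x \<le> -2 - 1/2 - 1"
    using up[of 0] order_trans[OF that X(2)] by auto
  show "layer (\<lambda>p. p - 3) \<mu> \<omega> (t, x) = e (\<Phi> 1) - e W" if "x > -2 + 1/2"
    using up[of 1] le_less_trans[OF X(1) that] \<Phi>0 by auto
  show "layer (\<lambda>p. 3 - p) \<mu> (\<lambda>p. - \<omega> p) (t, x) = 0" if "x \<le> 2 - 1/2"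
    using dn[of 1] order_trans[OF that X(4)] by auto
  show "layer (\<lambda>p. 3 - p) \<mu> (\<lambda>p. - \<omega> p) (t, x) = e W - e (\<Phi> 1)" if "x > 3 + 1/2"
    using dn[of 0] le_less_trans[OF X(3) that] \<Phi>0 by auto
qed

text \<open>A chain rule that never differentiates the solution: composing with \<open>e\<close>
  replaces the jump density by the derivative of \<open>e\<close> along the curve. Taking for
  \<open>e\<close> the identity, the flux, the entropy, its flux, a coordinate or a relative entropy
  yields everything asked of the solution.\<close>

lemma layered_state:
  fixes e :: "real^4 \<Rightarrow> 'b::euclidean_space"
  assumes t: "t \<in> {0..<T}" and \<omega>: "continuous_on UNIV \<omega>"
    and e: "\<And>p. p \<in> {0..1} \<Longrightarrow> ((\<lambda>p. e (\<Phi> p)) has_vector_derivative \<omega> p) (at p within {0..1})"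
  shows "layered (e Ul) (e W) (e Ur) \<omega> (t, x) = e (state t x)"
proof -
  have s: "- (1/2) \<le> \<sigma> * t \<and> \<sigma> * t \<le> 1/2" using T_bounds(2)[OF t] by linarith
  note parts = layered_parts[OF t \<omega> e, where x = x]
  consider "x \<le> -4" | "-4 < x" "x \<le> 0" | "0 < x" "x \<le> 4" | "4 < x" by linarith
  then show ?thesis
  proof cases
    case 1 then show ?thesis using parts(1,3) s by (auto simp: layered_def state_def layer_constant step_def)
  next
    case 2 then show ?thesis using parts(3,5) s by (auto simp: layered_def state_def layer_constant step_def)
  next
    case 3 then show ?thesis using parts(2,6) s by (auto simp: layered_def state_def layer_constant step_def)
  next
    case 4 then show ?thesis using parts(2,4) s by (auto simp: layered_def state_def layer_constant step_def)
  qed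
qed

lemma U_state: "t \<in> {0..<T} \<Longrightarrow> U (t, x) = state t x"
  unfolding U_def using layered_state[of t \<Phi>' "\<lambda>u. u"] \<Phi>_cont \<Phi>_deriv by auto

lemma state_mem: "t \<in> {0..<T} \<Longrightarrow> state t x \<in> insert Ul (insert Ur (\<Phi> ` {0..1}))"
proof -
  assume t: "t \<in> {0..<T}"
  have "W \<in> \<Phi> ` {0..1}" using \<Phi>0 by force
  then show ?thesis using \<rho>L(1)[OF t, of x] \<rho>R(1)[OF t, of x] by (auto simp: state_def)
qed

lemma state_pos: "t \<in> {0..<T} \<Longrightarrow> 0 < state t x $ 1"
  using state_mem[of t x] Ul Ur \<Phi>_pos by auto

text \<open>The jump relations make the flux jumps \<sigma> times the density jumps, so the two
  shocks have the same form as the waves and \<open>weak_balance_layer\<close> covers all four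
  transitions.\<close>

lemma layered_balance:
  assumes \<omega>: "continuous_on UNIV \<omega>" and j: "fw - fl = \<sigma> *\<^sub>R (w - l)" "fr - fw = \<sigma> *\<^sub>R (r - w)"
  shows "weak_balance T (layered l w r \<omega>) (layered fl fw fr (\<lambda>p. \<mu> p *\<^sub>R \<omega> p))"
proof -
  have n: "(\<lambda>p. - (\<mu> p *\<^sub>R \<omega> p)) = (\<lambda>p. \<mu> p *\<^sub>R (- \<omega> p))" by simp
  show ?thesis unfolding layered_def[abs_def] j n
    by (intro weak_balance_add weak_balance_const weak_balance_layer T_pos continuous_intros positions_cont \<Phi>_cont \<omega>)
qed

lemma layered_bv:
  assumes \<omega>: "continuous_on UNIV \<omega>"
  shows "uniform_bv T (layered l w r \<omega>)"
  unfolding layered_def[abs_def]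
  by (intro uniform_bv_add uniform_bv_const uniform_bv_layer T_pos continuous_intros positions_cont \<Phi>_cont \<omega>)

lemma layered_dissipation:
  fixes \<omega> :: "real \<Rightarrow> real"
  assumes \<omega>: "continuous_on UNIV \<omega>" and j: "fw - fl \<le> \<sigma> * (w - l)" "fr - fw \<le> \<sigma> * (r - w)"
  shows "weak_dissipation T (layered l w r \<omega>) (layered fl fw fr (\<lambda>p. \<mu> p * \<omega> p))"
proof -
  \<comment> \<open>\<open>k1\<close> and \<open>k2\<close> are the entropy defects of the two
    shocks. With the modified values \<open>fw'\<close> and \<open>fr'\<close> the jump relations
    hold exactly, and the defects are put back as pure flux jumps of nonpositive size.\<close>
  define k1 where "k1 = fw - fl - \<sigma> * (w - l)"
  define k2 where "k2 = fr - fw - \<sigma> * (r - w)"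
  have k: "k1 \<le> 0" "k2 \<le> 0" using j by (auto simp: k1_def k2_def)
  define fw' where "fw' = fl + \<sigma> * (w - l)"
  define fr' where "fr' = fw' + \<sigma> * (r - w)"
  have "weak_balance T (layered l w r \<omega>) (layered fl fw' fr' (\<lambda>p. \<mu> p *\<^sub>R \<omega> p))"
    by (rule layered_balance[OF \<omega>]) (auto simp: fw'_def fr'_def)
  then have "weak_dissipation T (\<lambda>z. layered l w r \<omega> z + (0 + 0)) (\<lambda>z. layered fl fw' fr' (\<lambda>p. \<mu> p *\<^sub>R \<omega> p) z
       + (k1 * step (snd z - (-5) - \<sigma> * fst z) + k2 * step (snd z - 5 - \<sigma> * fst z)))"
    by (intro weak_dissipation_add weak_balance_imp_dissipation weak_dissipation_jump k)
  moreover have "layered fl fw' fr' (\<lambda>p. \<mu> p *\<^sub>R \<omega> p) z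
       + (k1 * step (snd z - (-5) - \<sigma> * fst z) + k2 * step (snd z - 5 - \<sigma> * fst z)) = layered fl fw fr (\<lambda>p. \<mu> p * \<omega> p) z" for z
    by (cases z) (simp add: layered_def layer_constant fw'_def fr'_def k1_def k2_def algebra_simps)
  ultimately show ?thesis by simp
qed


section \<open>Entropy, fluxes and relative entropies along the curve\<close>

lemma deriv_along:
  assumes "p \<in> {0..1}" "(e has_derivative e') (at (\<Phi> p))"
  shows "((\<lambda>p. e (\<Phi> p)) has_vector_derivative e' (\<Phi>' p)) (at p within {0..1})"
  by (rule has_vector_derivative_along[OF \<Phi>_deriv[OF assms(1)] assms(2)])

definition \<omega>E :: "real \<Rightarrow> real" where "\<omega>E p = dent \<gamma> (\<Phi> p) (\<Phi>' p)"

lemma \<omega>E_cont: "continuous_on UNIV \<omega>E"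
  unfolding \<omega>E_def[abs_def] dent_def pres_def magB_def
  using \<Phi>_pos by (intro continuous_intros \<Phi>_cont) (auto simp: less_le)

lemma dent_linear_cont: "continuous_on UNIV (\<lambda>p. dent \<gamma> V (\<Phi>' p))"
  unfolding dent_def by (intro continuous_intros \<Phi>_cont)

lemma dent_linear: "0 < V$1 \<Longrightarrow> linear (dent \<gamma> V)"
  by (rule has_derivative_linear[OF ent_has_derivative[OF \<gamma>]])

lemma ent_along:
  "p \<in> {0..1} \<Longrightarrow> ((\<lambda>p. ent \<gamma> (\<Phi> p)) has_vector_derivative \<omega>E p) (at p within {0..1})"
  unfolding \<omega>E_def by (rule deriv_along[OF _ ent_has_derivative[OF \<gamma> \<Phi>_pos]])

text \<open>On an eigenvector the relation defining \<open>Q\<close> gives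
  \<open>dQ = d\<eta> dF \<Phi>' = \<mu> d\<eta> \<Phi>'\<close>, so entropy and entropy flux are
  superpositions travelling at the same speeds.\<close>

lemma Q_along:
  assumes p: "p \<in> {0..1}"
  shows "((\<lambda>p. Q (\<Phi> p)) has_vector_derivative \<mu> p * \<omega>E p) (at p within {0..1})"
proof -
  have "(Q has_derivative (\<lambda>d. dent \<gamma> (\<Phi> p) (dflux \<beta> \<gamma> (\<Phi> p) d))) (at (\<Phi> p))"
    using Q \<Phi>_pos[of p] unfolding is_entropy_flux_def
    by (auto simp: phys_dom_def frechet_ent[OF \<gamma> \<Phi>_pos] frechet_flux[OF \<Phi>_pos] dest!: bspec[of _ _ "\<Phi> p"])
  from deriv_along[OF p this] show ?thesis
    using linear_scale[OF dent_linear[OF \<Phi>_pos], of p "\<mu> p" "\<Phi>' p"] by (simp add: \<Phi>_eigen[OF p] \<omega>E_def)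
qed

lemma flux_along:
  assumes p: "p \<in> {0..1}"
  shows "((\<lambda>p. flux \<beta> \<gamma> (\<Phi> p)) has_vector_derivative \<mu> p *\<^sub>R \<Phi>' p) (at p within {0..1})"
  using deriv_along[OF p flux_has_derivative[OF \<Phi>_pos, of \<beta> \<gamma> p]] by (simp add: \<Phi>_eigen[OF p])

lemma rel_ent_along:
  assumes p: "p \<in> {0..1}" and V: "0 < V$1"
  shows "((\<lambda>p. rel_ent \<gamma> (\<Phi> p) V) has_vector_derivative \<omega>E p - dent \<gamma> V (\<Phi>' p)) (at p within {0..1})"
  using deriv_along[OF p rel_ent_has_derivative[OF \<gamma> \<Phi>_pos V]] by (simp add: \<omega>E_def)

lemma weak_solution: "entropy_weak_sol \<beta> \<gamma> Q T U (\<lambda>x. U (0, x))"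
  unfolding entropy_weak_sol_def
proof (intro conjI allI impI)
  have wp: "weak_balance T U (layered (flux \<beta> \<gamma> Ul) (flux \<beta> \<gamma> W) (flux \<beta> \<gamma> Ur) (\<lambda>p. \<mu> p *\<^sub>R \<Phi>' p))"
    unfolding U_def by (rule layered_balance[OF \<Phi>_cont(2) rh])
  have fl: "flux \<beta> \<gamma> (U z) = layered (flux \<beta> \<gamma> Ul) (flux \<beta> \<gamma> W) (flux \<beta> \<gamma> Ur) (\<lambda>p. \<mu> p *\<^sub>R \<Phi>' p) z"
    if "z \<in> strip T" for z
  proof -
    have t: "fst z \<in> {0..<T}" using that by auto
    have c: "continuous_on UNIV (\<lambda>p. \<mu> p *\<^sub>R \<Phi>' p)" by (intro continuous_intros \<Phi>_cont)
    show ?thesis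
      using layered_state[OF t c, of "flux \<beta> \<gamma>" "snd z"] U_state[OF t, of "snd z"] flux_along by auto
  qed
  have ws: "weak_dissipation T (layered (ent \<gamma> Ul) (ent \<gamma> W) (ent \<gamma> Ur) \<omega>E) (layered (Q Ul) (Q W) (Q Ur) (\<lambda>p. \<mu> p * \<omega>E p))"
    by (rule layered_dissipation[OF \<omega>E_cont dissip])
  have en: "ent \<gamma> (U z) = layered (ent \<gamma> Ul) (ent \<gamma> W) (ent \<gamma> Ur) \<omega>E z"
    "Q (U z) = layered (Q Ul) (Q W) (Q Ur) (\<lambda>p. \<mu> p * \<omega>E p) z"
    if "z \<in> strip T" for z
  proof -
    have t: "fst z \<in> {0..<T}" using that by auto
    have c: "continuous_on UNIV (\<lambda>p. \<mu> p * \<omega>E p)" by (intro continuous_intros \<Phi>_cont \<omega>E_cont)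
    show "ent \<gamma> (U z) = layered (ent \<gamma> Ul) (ent \<gamma> W) (ent \<gamma> Ur) \<omega>E z"
      using layered_state[OF t \<omega>E_cont, of "ent \<gamma>" "snd z"] U_state[OF t, of "snd z"] ent_along by auto
    show "Q (U z) = layered (Q Ul) (Q W) (Q Ur) (\<lambda>p. \<mu> p * \<omega>E p) z"
      using layered_state[OF t c, of Q "snd z"] U_state[OF t, of "snd z"] Q_along by auto
  qed
  have Um: "U \<in> borel_measurable borel" using wp by (simp add: weak_balance_def)
  then show "set_borel_measurable lborel (strip T) U"
    unfolding set_borel_measurable_def by measurable
  show "(\<lambda>x. U (0, x)) \<in> borel_measurable lborel"
    using Um by (auto intro: measurable_compose[rotated] simp: borel_prod[symmetric] simp del: borel_prod)
  fix \<phi> :: "real \<times> real \<Rightarrow> real"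
  show "(LBINT z:strip T. (pdt \<phi> z *\<^sub>R U z + pdx \<phi> z *\<^sub>R flux \<beta> \<gamma> (U z)))
        + (LBINT x. \<phi> (0, x) *\<^sub>R U (0, x)) = 0" if \<phi>: "test_fn ({..<T} \<times> UNIV) \<phi>"
  proof -
    have "(LBINT z:strip T. (pdt \<phi> z *\<^sub>R U z + pdx \<phi> z *\<^sub>R flux \<beta> \<gamma> (U z)))
       = (LBINT z:strip T. (pdt \<phi> z *\<^sub>R U z + pdx \<phi> z *\<^sub>R
          layered (flux \<beta> \<gamma> Ul) (flux \<beta> \<gamma> W) (flux \<beta> \<gamma> Ur) (\<lambda>p. \<mu> p *\<^sub>R \<Phi>' p) z))"
      by (rule set_lebesgue_integral_cong) (use fl in auto)
    then show ?thesis using wp \<phi> by (simp add: weak_balance_def)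
  qed
  show "0 \<le> (LBINT z:strip T. (pdt \<phi> z * ent \<gamma> (U z) + pdx \<phi> z * Q (U z)))"
    if \<phi>: "test_fn (strip T) \<phi> \<and> (\<forall>z. 0 \<le> \<phi> z)"
  proof -
    have "(LBINT z:strip T. (pdt \<phi> z * ent \<gamma> (U z) + pdx \<phi> z * Q (U z)))
       = (LBINT z:strip T. (pdt \<phi> z * layered (ent \<gamma> Ul) (ent \<gamma> W) (ent \<gamma> Ur) \<omega>E z
          + pdx \<phi> z * layered (Q Ul) (Q W) (Q Ur) (\<lambda>p. \<mu> p * \<omega>E p) z))"
      by (rule set_lebesgue_integral_cong) (use en in auto)
    then show ?thesis using ws \<phi> by (simp add: weak_dissipation_def)
  qed
qed

lemma bounded_variation: "bv_loc (strip T) (\<lambda>z. U z $ i)"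
proof -
  have "uniform_bv T (layered (Ul$i) (W$i) (Ur$i) (\<lambda>p. \<Phi>' p $ i))"
    by (intro layered_bv continuous_intros \<Phi>_cont)
  then have b: "bv_loc (strip T) (layered (Ul$i) (W$i) (Ur$i) (\<lambda>p. \<Phi>' p $ i))"
    by (rule uniform_bv_imp_bv_loc)
  have eq: "U z $ i = layered (Ul$i) (W$i) (Ur$i) (\<lambda>p. \<Phi>' p $ i) z" if "z \<in> strip T" for z
  proof -
    have t: "fst z \<in> {0..<T}" using that by auto
    have "((\<lambda>p. \<Phi> p $ i) has_vector_derivative \<Phi>' p $ i) (at p within {0..1})" if "p \<in> {0..1}" for p
      by (rule bounded_linear.has_vector_derivative[OF bounded_linear_vec_nth \<Phi>_deriv[OF that]])
    moreover have "continuous_on UNIV (\<lambda>p. \<Phi>' p $ i)" by (intro continuous_intros \<Phi>_cont)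
    ultimately show ?thesis
      using layered_state[OF t, of "\<lambda>p. \<Phi>' p $ i" "\<lambda>u. u $ i" "snd z"] U_state[OF t, of "snd z"] by auto
  qed
  show ?thesis by (rule bv_loc_cong[OF b eq])
qed

section \<open>The energy as an affine function of time\<close>

definition growth_rate :: real where
  "growth_rate = (LBINT p:{0..1}. (\<sigma> - \<mu> p) * ((\<omega>E p - dent \<gamma> Ul (\<Phi>' p)) - a * (\<omega>E p - dent \<gamma> Ur (\<Phi>' p))))"

lemma growth_rate_pos: "0 < growth_rate" using growth by (simp add: growth_rate_def \<omega>E_def)

text \<open>For \<open>\<bar>h\<bar> \<le> 1\<close> only the left shock and the left wave lie in
  \<open>{..h}\<close>, and the relative entropy to \<open>Ul\<close> starts from 0 at the far left,
  so \<open>layer_left_mass\<close> gives both contributions.\<close>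

lemma left_energy:
  assumes t: "t \<in> {0..<T}" and h: "\<bar>h\<bar> \<le> 1"
  defines "A \<equiv> (h + 5 - \<sigma> * t) * rel_ent \<gamma> W Ul + (LBINT p:{0..1}. (h - (p - 3) - \<mu> p * t) * (\<omega>E p - dent \<gamma> Ul (\<Phi>' p)))"
  shows "(\<integral>\<^sup>+x\<in>{..h}. ennreal (rel_ent \<gamma> (U (t, x)) Ul) \<partial>lborel) = ennreal A" "0 \<le> A"
proof -
  let ?\<omega> = "\<lambda>p. \<omega>E p - dent \<gamma> Ul (\<Phi>' p)"
  have \<omega>: "continuous_on UNIV ?\<omega>" by (intro continuous_intros \<omega>E_cont dent_linear_cont)
  have s: "- (1/2) \<le> \<sigma> * t \<and> \<sigma> * t \<le> 1/2" using T_bounds(2)[OF t] by linarith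
  have b: "- (1/2) \<le> \<mu> p * t \<and> \<mu> p * t \<le> 1/2" if "p \<in> {0..1}" for p
    using T_bounds(3)[OF t that] by linarith
  have 1: "has_bochner_integral lborel (\<lambda>x. indicator {..h} x * layer (\<lambda>_. -5) (\<lambda>_. \<sigma>) (\<lambda>_. rel_ent \<gamma> W Ul) (t, x))
      (LBINT p:{0..1::real}. (h - (-5) - \<sigma> * t) * rel_ent \<gamma> W Ul)"
    by (rule layer_left_mass[of "\<lambda>_. -5" "\<lambda>_. \<sigma>" _ "-6" t h]) (use s h in auto)
  have 2: "has_bochner_integral lborel (\<lambda>x. indicator {..h} x * layer (\<lambda>p. p - 3) \<mu> ?\<omega> (t, x))
      (LBINT p:{0..1}. (h - (p - 3) - \<mu> p * t) * ?\<omega> p)"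
  proof (rule layer_left_mass[where l = "-6", OF positions_cont(1) \<Phi>_cont(3) \<omega>])
    show "-6 \<le> p - 3 + \<mu> p * t \<and> p - 3 + \<mu> p * t \<le> h" if "p \<in> {0..1}" for p
      using b[OF that] h that by auto
  qed
  have "indicator {..h} x * layer (\<lambda>_. -5) (\<lambda>_. \<sigma>) (\<lambda>_. rel_ent \<gamma> W Ul) (t, x) + indicator {..h} x * layer (\<lambda>p. p - 3) \<mu> ?\<omega> (t, x)
     = indicator {..h} x * rel_ent \<gamma> (U (t, x)) Ul" for x
  proof (cases "x \<le> h")
    case True
    have "layer (\<lambda>p. 3 - p) \<mu> (\<lambda>p. - ?\<omega> p) (t, x) = 0"
      by (rule layered_parts(3)[OF t \<omega>, of "\<lambda>u. rel_ent \<gamma> u Ul"]) (use rel_ent_along[OF _ Ul] True h in auto)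
    moreover have "layer (\<lambda>_. 5) (\<lambda>_. \<sigma>) (\<lambda>_. k) (t, x) = (0::real)" for k
    proof -
      have "x - 5 - \<sigma> * t \<le> 0" using True h s by linarith
      then show ?thesis by (simp add: layer_constant)
    qed
    ultimately show ?thesis
      using layered_state[OF t \<omega>, of "\<lambda>u. rel_ent \<gamma> u Ul" x] rel_ent_along[OF _ Ul] True
      by (simp add: U_state[OF t] layered_def rel_ent_self[OF \<gamma> Ul])
  qed simp
  with has_bochner_integral_add[OF 1 2]
  have hb: "has_bochner_integral lborel (\<lambda>x. indicator {..h} x * rel_ent \<gamma> (U (t, x)) Ul) A"
    by (simp add: A_def set_lebesgue_integral_def)
  have nn: "0 \<le> rel_ent \<gamma> (U (t, x)) Ul" for x
    using rel_ent_nonneg[OF \<gamma> state_pos[OF t] Ul] by (simp add: U_state[OF t])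
  show "(\<integral>\<^sup>+x\<in>{..h}. ennreal (rel_ent \<gamma> (U (t, x)) Ul) \<partial>lborel) = ennreal A" "0 \<le> A"
    by (rule nn_integral_of_nonneg_mass[OF hb nn])+
qed

text \<open>The relative entropy to \<open>Ur\<close> is 0 at the far right, so the right wave and
  the right shock contribute through their complements. Hence the negated density, and the jump
  \<open>?k\<close> from the relative entropy of \<open>W\<close> down to 0.\<close>

lemma right_energy:
  assumes t: "t \<in> {0..<T}" and h: "\<bar>h\<bar> \<le> 1"
  defines "A \<equiv> (5 + \<sigma> * t - h) * rel_ent \<gamma> W Ur + (LBINT p:{0..1}. (3 - p + \<mu> p * t - h) * (\<omega>E p - dent \<gamma> Ur (\<Phi>' p)))"
  shows "(\<integral>\<^sup>+x\<in>{h<..}. ennreal (rel_ent \<gamma> (U (t, x)) Ur) \<partial>lborel) = ennreal A" "0 \<le> A"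
proof -
  let ?\<omega> = "\<lambda>p. \<omega>E p - dent \<gamma> Ur (\<Phi>' p)"
  let ?k = "- rel_ent \<gamma> W Ur"
  have \<omega>: "continuous_on UNIV ?\<omega>" by (intro continuous_intros \<omega>E_cont dent_linear_cont)
  have \<omega>': "continuous_on UNIV (\<lambda>p. - ?\<omega> p)" by (rule continuous_on_minus[OF \<omega>])
  have s: "- (1/2) \<le> \<sigma> * t \<and> \<sigma> * t \<le> 1/2" using T_bounds(2)[OF t] by linarith
  have b: "- (1/2) \<le> \<mu> p * t \<and> \<mu> p * t \<le> 1/2" if "p \<in> {0..1}" for p
    using T_bounds(3)[OF t that] by linarith
  have 1: "has_bochner_integral lborel (\<lambda>x. indicator {h<..} x * ((LBINT p:{0..1::real}. ?k) - layer (\<lambda>_. 5) (\<lambda>_. \<sigma>) (\<lambda>_. ?k) (t, x)))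
      (LBINT p:{0..1::real}. (5 + \<sigma> * t - h) * ?k)"
    by (rule layer_right_mass[of "\<lambda>_. 5" "\<lambda>_. \<sigma>" _ h t 6]) (use s h in auto)
  have 2: "has_bochner_integral lborel (\<lambda>x. indicator {h<..} x * ((LBINT p:{0..1}. - ?\<omega> p) - layer (\<lambda>p. 3 - p) \<mu> (\<lambda>p. - ?\<omega> p) (t, x)))
      (LBINT p:{0..1}. (3 - p + \<mu> p * t - h) * - ?\<omega> p)"
  proof (rule layer_right_mass[where r = "6", OF positions_cont(2) \<Phi>_cont(3) \<omega>'])
    show "h \<le> 3 - p + \<mu> p * t \<and> 3 - p + \<mu> p * t \<le> 6" if "p \<in> {0..1}" for p
      using b[OF that] h that by auto
  qed
  have tot: "(LBINT p:{0..1}. ?\<omega> p) = rel_ent \<gamma> (\<Phi> 1) Ur - rel_ent \<gamma> W Ur"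
    using integral_FTC_Icc[of 0 1 "\<lambda>p. rel_ent \<gamma> (\<Phi> p) Ur" ?\<omega>] rel_ent_along[OF _ Ur] \<omega> \<Phi>0
    by (auto simp: set_lebesgue_integral_def intro: continuous_on_subset)
  have eqx: "indicator {h<..} x * ((LBINT p:{0..1::real}. ?k) - layer (\<lambda>_. 5) (\<lambda>_. \<sigma>) (\<lambda>_. ?k) (t, x))
     + indicator {h<..} x * ((LBINT p:{0..1}. - ?\<omega> p) - layer (\<lambda>p. 3 - p) \<mu> (\<lambda>p. - ?\<omega> p) (t, x))
     = - (indicator {h<..} x * rel_ent \<gamma> (U (t, x)) Ur)" for x
  proof (cases "h < x")
    case True
    have l2: "layer (\<lambda>p. p - 3) \<mu> ?\<omega> (t, x) = rel_ent \<gamma> (\<Phi> 1) Ur - rel_ent \<gamma> W Ur"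
      by (rule layered_parts(2)[OF t \<omega>, of "\<lambda>u. rel_ent \<gamma> u Ur"]) (use rel_ent_along[OF _ Ur] True h in auto)
    have l1: "layer (\<lambda>_. -5) (\<lambda>_. \<sigma>) (\<lambda>_. k) (t, x) = k" for k :: real
    proof -
      have "0 < x - (-5) - \<sigma> * t" using True h s by linarith
      then show ?thesis by (simp add: layer_constant)
    qed
    have R: "rel_ent \<gamma> (U (t, x)) Ur = rel_ent \<gamma> (\<Phi> 1) Ur + layer (\<lambda>p. 3 - p) \<mu> (\<lambda>p. - ?\<omega> p) (t, x) + layer (\<lambda>_. 5) (\<lambda>_. \<sigma>) (\<lambda>_. ?k) (t, x)"
      using layered_state[OF t \<omega>, of "\<lambda>u. rel_ent \<gamma> u Ur" x] rel_ent_along[OF _ Ur]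
      by (simp add: U_state[OF t] layered_def rel_ent_self[OF \<gamma> Ur] l1 l2)
    have m: "(LBINT p:{0..1}. - ?\<omega> p) = rel_ent \<gamma> W Ur - rel_ent \<gamma> (\<Phi> 1) Ur"
      "(LBINT p:{0..1::real}. ?k) = ?k"
      using tot by (simp_all only: set_lebesgue_integral_def scaleR_minus_right Bochner_Integration.integral_minus) simp_all
    show ?thesis using True unfolding R m by simp
  qed simp
  have "has_bochner_integral lborel (\<lambda>x. indicator {h<..} x * rel_ent \<gamma> (U (t, x)) Ur)
     (- ((LBINT p:{0..1::real}. (5 + \<sigma> * t - h) * ?k) + (LBINT p:{0..1}. (3 - p + \<mu> p * t - h) * - ?\<omega> p)))"
    using has_bochner_integral_minus[OF has_bochner_integral_add[OF 1 2]] unfolding eqx minus_minus .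
  moreover have "- ((LBINT p:{0..1::real}. (5 + \<sigma> * t - h) * ?k) + (LBINT p:{0..1}. (3 - p + \<mu> p * t - h) * - ?\<omega> p)) = A"
    unfolding A_def set_lebesgue_integral_def mult_minus_right scaleR_minus_right Bochner_Integration.integral_minus by simp
  ultimately have hb: "has_bochner_integral lborel (\<lambda>x. indicator {h<..} x * rel_ent \<gamma> (U (t, x)) Ur) A"
    by simp
  have nn: "0 \<le> rel_ent \<gamma> (U (t, x)) Ur" for x
    using rel_ent_nonneg[OF \<gamma> state_pos[OF t] Ur] by (simp add: U_state[OF t])
  show "(\<integral>\<^sup>+x\<in>{h<..}. ennreal (rel_ent \<gamma> (U (t, x)) Ur) \<partial>lborel) = ennreal A" "0 \<le> A"
    by (rule nn_integral_of_nonneg_mass[OF hb nn])+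
qed

lemma energy:
  "\<exists>e0. \<forall>t\<in>{0..<T}. \<forall>h. \<bar>h\<bar> \<le> 1 \<longrightarrow>
     Ea \<gamma> a Ul Ur (\<lambda>x. U (t, x)) h = ennreal (e0 + growth_rate * t) \<and> 0 \<le> e0 + growth_rate * t"
proof -
  let ?l = "\<lambda>p. \<omega>E p - dent \<gamma> Ul (\<Phi>' p)" and ?r = "\<lambda>p. \<omega>E p - dent \<gamma> Ur (\<Phi>' p)"
  have c: "continuous_on UNIV ?l" "continuous_on UNIV ?r" by (intro continuous_intros \<omega>E_cont dent_linear_cont)+
  have i: "set_integrable lborel {0..1} f" if "continuous_on UNIV f" for f :: "real \<Rightarrow> real"
    unfolding set_integrable_def using that by (intro borel_integrable_compact) (auto intro: continuous_on_subset)
  define I where "I f = (LBINT p:{0..1}. f p)" for f :: "real \<Rightarrow> real"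
  have add: "I (\<lambda>p. f p + g p) = I f + I g" if "continuous_on UNIV f" "continuous_on UNIV g" for f g
    unfolding I_def by (intro set_integral_add(2) i that)
  have mul: "I (\<lambda>p. k * f p) = k * I f" for k f unfolding I_def by simp
  have tot: "I ?l = rel_ent \<gamma> (\<Phi> 1) Ul - rel_ent \<gamma> W Ul" "I ?r = rel_ent \<gamma> (\<Phi> 1) Ur - rel_ent \<gamma> W Ur"
    using integral_FTC_Icc[of 0 1 "\<lambda>p. rel_ent \<gamma> (\<Phi> p) Ul" ?l] rel_ent_along[OF _ Ul]
      integral_FTC_Icc[of 0 1 "\<lambda>p. rel_ent \<gamma> (\<Phi> p) Ur" ?r] rel_ent_along[OF _ Ur] c \<Phi>0
    by (auto simp: I_def set_lebesgue_integral_def intro: continuous_on_subset)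
  have el: "I (\<lambda>p. (h - (p - 3) - \<mu> p * t) * ?l p) = (h + 3) * I ?l + (- 1) * I (\<lambda>p. p * ?l p) + (- t) * I (\<lambda>p. \<mu> p * ?l p)" for h t
  proof -
    have "(\<lambda>p. (h - (p - 3) - \<mu> p * t) * ?l p) = (\<lambda>p. ((h + 3) * ?l p + (- 1) * (p * ?l p)) + (- t) * (\<mu> p * ?l p))"
      by (auto simp: algebra_simps)
    then show ?thesis by (simp only:) (subst add, (intro continuous_intros c \<Phi>_cont)+, subst add, (intro continuous_intros c \<Phi>_cont)+, simp only: mul)
  qed
  have er: "I (\<lambda>p. (3 - p + \<mu> p * t - h) * ?r p) = (3 - h) * I ?r + (- 1) * I (\<lambda>p. p * ?r p) + t * I (\<lambda>p. \<mu> p * ?r p)" for h t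
  proof -
    have "(\<lambda>p. (3 - p + \<mu> p * t - h) * ?r p) = (\<lambda>p. ((3 - h) * ?r p + (- 1) * (p * ?r p)) + t * (\<mu> p * ?r p))"
      by (auto simp: algebra_simps)
    then show ?thesis by (simp only:) (subst add, (intro continuous_intros c \<Phi>_cont)+, subst add, (intro continuous_intros c \<Phi>_cont)+, simp only: mul)
  qed
  have g: "growth_rate = \<sigma> * I ?l + (- (a * \<sigma>)) * I ?r + ((- 1) * I (\<lambda>p. \<mu> p * ?l p) + a * I (\<lambda>p. \<mu> p * ?r p))"
  proof -
    have "(\<lambda>p. (\<sigma> - \<mu> p) * (?l p - a * ?r p)) = (\<lambda>p. (\<sigma> * ?l p + (- (a * \<sigma>)) * ?r p) + ((- 1) * (\<mu> p * ?l p) + a * (\<mu> p * ?r p)))"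
      by (auto simp: algebra_simps)
    moreover have "growth_rate = I (\<lambda>p. (\<sigma> - \<mu> p) * (?l p - a * ?r p))" by (simp add: growth_rate_def I_def)
    ultimately show ?thesis by (simp only:) (subst add, (intro continuous_intros c \<Phi>_cont)+, subst add, (intro continuous_intros c \<Phi>_cont)+,
       subst add, (intro continuous_intros c \<Phi>_cont)+, simp only: mul)
  qed
  define e0 where "e0 = 5 * rel_ent \<gamma> W Ul + 3 * I ?l - I (\<lambda>p. p * ?l p) + a * (5 * rel_ent \<gamma> W Ur + 3 * I ?r - I (\<lambda>p. p * ?r p))"
  show ?thesis
  proof (intro exI[of _ e0] ballI allI impI)
    fix t h assume t: "t \<in> {0..<T}" and h: "\<bar>h\<bar> \<le> (1::real)"
    define A1 where "A1 = (h + 5 - \<sigma> * t) * rel_ent \<gamma> W Ul + I (\<lambda>p. (h - (p - 3) - \<mu> p * t) * ?l p)"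
    define A2 where "A2 = (5 + \<sigma> * t - h) * rel_ent \<gamma> W Ur + I (\<lambda>p. (3 - p + \<mu> p * t - h) * ?r p)"
    have A: "0 \<le> A1" "0 \<le> A2" "Ea \<gamma> a Ul Ur (\<lambda>x. U (t, x)) h = ennreal A1 + ennreal a * ennreal A2"
      using left_energy[OF t h] right_energy[OF t h] by (auto simp: Ea_def A1_def A2_def I_def)
    \<comment> \<open>Both \<open>h\<close> and \<open>\<sigma> * t\<close> multiply the plateau
      value of \<open>G\<close>, which is 0 by \<open>balance\<close>. This removes the shift, and
      it is also how the separate shock term merges into the factor \<open>\<sigma> - \<mu>\<close>
      of the growth rate.\<close>
    have "A1 + a * A2 = e0 + growth_rate * t + h * (rel_ent \<gamma> (\<Phi> 1) Ul - a * rel_ent \<gamma> (\<Phi> 1) Ur)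
       - \<sigma> * t * (rel_ent \<gamma> (\<Phi> 1) Ul - a * rel_ent \<gamma> (\<Phi> 1) Ur)"
      unfolding A1_def A2_def el er e0_def g tot by (simp add: algebra_simps)
    then have e: "A1 + a * A2 = e0 + growth_rate * t" by (simp add: balance)
    have "ennreal A1 + ennreal a * ennreal A2 = ennreal (A1 + a * A2)"
      using A a by (simp add: ennreal_plus ennreal_mult)
    then show "Ea \<gamma> a Ul Ur (\<lambda>x. U (t, x)) h = ennreal (e0 + growth_rate * t) \<and> 0 \<le> e0 + growth_rate * t"
      using A a e by (metis add_nonneg_nonneg less_imp_le mult_nonneg_nonneg)
  qed
qed

theorem not_a_contraction: "\<not> a_contraction \<beta> \<gamma> Q a Ul Ur \<sigma>"
proof
  assume ac: "a_contraction \<beta> \<gamma> Q a Ul Ur \<sigma>"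
  define S where "S = insert Ul (insert Ur (\<Phi> ` {0..1}))"
  \<comment> \<open>A bounded convex set containing all values of the solution. It stays in the
    region of positive volume because that region is convex.\<close>
  define UK where "UK = convex hull S"
  have "compact S" unfolding S_def
    using \<Phi>_cont(1) by (intro compact_insert compact_continuous_image) (auto intro: continuous_on_subset)
  then have UKb: "bounded UK" unfolding UK_def by (intro bounded_convex_hull compact_imp_bounded)
  have "S \<subseteq> phys_dom" using Ul Ur \<Phi>_pos by (auto simp: S_def phys_dom_def)
  then have UKp: "UK \<subseteq> phys_dom" unfolding UK_def by (intro hull_minimal phys_dom_convex)
  have mem: "U (t, x) \<in> UK" if "t \<in> {0..<T}" for t x
    using state_mem[OF that, of x] hull_subset[of S convex] by (auto simp: U_state[OF that] UK_def S_def)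
  obtain e0 where e0: "\<And>t h. t \<in> {0..<T} \<Longrightarrow> \<bar>h\<bar> \<le> 1 \<Longrightarrow>
     Ea \<gamma> a Ul Ur (\<lambda>x. U (t, x)) h = ennreal (e0 + growth_rate * t)" "\<And>t. t \<in> {0..<T} \<Longrightarrow> 0 \<le> e0 + growth_rate * t"
    using energy by (metis abs_zero zero_le_one)
  have fin: "Ea \<gamma> a Ul Ur (\<lambda>x. U (0, x)) 0 < \<infinity>" using e0(1)[of 0 0] T_pos by simp
  have "\<exists>h :: real \<Rightarrow> real. h 0 = 0 \<and> (\<exists>L. L-lipschitz_on {0..<T} h) \<and>
    (\<exists>N. N \<in> null_sets lborel \<and>
       (\<forall>s t. s \<notin> N \<and> t \<notin> N \<and> 0 < s \<and> s < t \<and> t < T \<longrightarrow>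
          Ea \<gamma> a Ul Ur (\<lambda>x. U (t, x)) (h t) \<le> Ea \<gamma> a Ul Ur (\<lambda>x. U (s, x)) (h s)))"
    by (rule a_contractionD[OF ac UKb _ UKp T_pos weak_solution _ _ bounded_variation fin])
       (use mem T_pos in \<open>auto simp: UK_def\<close>)
  then obtain h :: "real \<Rightarrow> real" and M N where h: "h 0 = 0" "M-lipschitz_on {0..<T} h" "N \<in> null_sets lborel"
    "\<And>s t. s \<notin> N \<Longrightarrow> t \<notin> N \<Longrightarrow> 0 < s \<Longrightarrow> s < t \<Longrightarrow> t < T \<Longrightarrow>
       Ea \<gamma> a Ul Ur (\<lambda>x. U (t, x)) (h t) \<le> Ea \<gamma> a Ul Ur (\<lambda>x. U (s, x)) (h s)"
    by blast
  \<comment> \<open>Up to \<open>\<delta>\<close> the shift stays inside the plateau. Using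
    \<open>M + 1\<close> avoids division by a zero Lipschitz constant.\<close>
  define \<delta> where "\<delta> = min T (1 / (M + 1))"
  have M: "0 \<le> M" using lipschitz_on_nonneg[OF h(2)] .
  have \<delta>: "0 < \<delta>" "\<delta> \<le> T" using T_pos M by (auto simp: \<delta>_def)
  have hb: "\<bar>h t\<bar> \<le> 1" if "0 < t" "t < \<delta>" for t
  proof -
    have "\<bar>h t\<bar> \<le> M * t"
      using lipschitz_onD[OF h(2), of t 0] that \<delta> T_pos h(1) by (auto simp: dist_real_def)
    also have "\<dots> \<le> (M + 1) * (1 / (M + 1))" using that M by (intro mult_mono) (auto simp: \<delta>_def)
    also have "\<dots> = 1" using M by simp
    finally show ?thesis .
  qed
  \<comment> \<open>Times taken on either side of \<open>\<delta> / 2\<close> are ordered, and each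
    can avoid the null set on its own.\<close>
  obtain s where s: "0 < s" "s < \<delta> / 2" "s \<notin> N" using null_set_avoid[OF h(3), of 0 "\<delta> / 2"] \<delta> by auto
  obtain t where t: "\<delta> / 2 < t" "t < \<delta>" "t \<notin> N" using null_set_avoid[OF h(3), of "\<delta> / 2" \<delta>] \<delta> by auto
  have st: "s \<in> {0..<T}" "t \<in> {0..<T}" "s < t" "0 < t" "s < \<delta>" using s t \<delta> by auto
  have "ennreal (e0 + growth_rate * t) \<le> ennreal (e0 + growth_rate * s)"
    using h(4)[of s t] s t st e0(1)[OF st(2) hb] e0(1)[OF st(1) hb] by auto
  then have "e0 + growth_rate * t \<le> e0 + growth_rate * s" using e0(2)[OF st(1)] by (simp add: ennreal_le_iff)
  then show False using growth_rate_pos st by simp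
qed

end

section \<open>The fast integral curve\<close>

text \<open>Banach's fixed point theorem for \<open>z = exp (- 2 L t) y\<close>: the exponential
  weight makes the integral operator contract by 1/2 on the whole interval at once, whatever the
  size of \<open>L\<close>. Freezing time outside \<open>[0, 1]\<close> by \<open>cl\<close> turns
  the iterates into bounded continuous functions on the line.\<close>

lemma picard_unit_interval:
  fixes f :: "real \<Rightarrow> real \<Rightarrow> real"
  assumes cont: "continuous_on ({0..1} \<times> UNIV) (\<lambda>z. f (fst z) (snd z))"
    and lip: "\<And>t x y. t \<in> {0..1} \<Longrightarrow> \<bar>f t x - f t y\<bar> \<le> L * \<bar>x - y\<bar>" and L: "0 < L"
  shows "\<exists>y. y 0 = y0 \<and> (\<forall>t\<in>{0..1}. (y has_real_derivative f t (y t)) (at t within {0..1}))"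
proof -
  define cl :: "real \<Rightarrow> real" where "cl t = max 0 (min 1 t)" for t
  have cl: "cl t \<in> {0..1}" "continuous_on UNIV cl" for t
    unfolding cl_def by (auto intro!: continuous_intros)
  have cl_id: "cl t = t" if "t \<in> {0..1}" for t using that by (auto simp: cl_def)
  define g where "g z s = f s (exp (2 * L * s) * apply_bcontfun z s)" for z :: "real \<Rightarrow>\<^sub>C real" and s
  have gc: "continuous_on {0..1} (g z)" for z
    unfolding g_def
    by (rule continuous_on_compose2[OF cont, where f = "\<lambda>s. (s, exp (2 * L * s) * apply_bcontfun z s)", simplified])
       (auto intro!: continuous_intros)
  define P where "P z t = exp (- 2 * L * cl t) * (y0 + integral {0..cl t} (g z))" for z t
  have Pc: "continuous_on UNIV (P z)" for z
  proof -
    have "continuous_on {0..1} (\<lambda>x. integral {0..x} (g z))"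
      by (rule indefinite_integral_continuous_1[OF integrable_continuous_real[OF gc]])
    then have "continuous_on UNIV (\<lambda>t. integral {0..cl t} (g z))"
      by (rule continuous_on_compose2[OF _ cl(2)]) (use cl(1) in auto)
    then show ?thesis unfolding P_def using cl(2) by (intro continuous_intros)
  qed
  have Pb: "P z \<in> bcontfun" for z
  proof -
    have "range (P z) \<subseteq> P z ` {0..1}"
    proof
      fix y assume "y \<in> range (P z)"
      then obtain t where "y = P z t" by auto
      then have "y = P z (cl t)" using cl_id[OF cl(1)[of t]] by (simp add: P_def)
      then show "y \<in> P z ` {0..1}" using cl(1) by auto
    qed
    moreover have "bounded (P z ` {0..1})"
      using Pc by (intro compact_imp_bounded compact_continuous_image) (auto intro: continuous_on_subset)
    ultimately show ?thesis using Pc by (auto simp: bcontfun_def intro: bounded_subset)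
  qed
  define F where "F z = Bcontfun (P z)" for z
  have F: "apply_bcontfun (F z) = P z" for z
    unfolding F_def by (rule Bcontfun_inverse[OF Pb])
  have contr: "dist (F z) (F w) \<le> 1/2 * dist z w" for z w
  proof (rule dist_bound)
    fix t
    define \<tau> where "\<tau> = cl t"
    define D where "D = dist z w"
    have \<tau>: "0 \<le> \<tau>" "\<tau> \<le> 1" using cl(1)[of t] by (auto simp: \<tau>_def)
    have D: "0 \<le> D" "\<And>s. \<bar>apply_bcontfun z s - apply_bcontfun w s\<bar> \<le> D"
      using dist_fun_lt_imp_dist_val_lt dist_bounded[of z _ w] by (auto simp: D_def dist_real_def)
    have i: "g z integrable_on {0..\<tau>}" "g w integrable_on {0..\<tau>}"
      using \<tau> by (auto intro!: integrable_continuous_real continuous_on_subset[OF gc])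
    have "((\<lambda>s. L * D * exp (2 * L * s)) has_integral D / 2 * exp (2 * L * \<tau>) - D / 2 * exp (2 * L * 0)) {0..\<tau>}"
      using \<tau> L by (intro fundamental_theorem_of_calculus)
        (auto intro!: derivative_eq_intros simp: has_real_derivative_iff_has_vector_derivative[symmetric])
    then have hi: "((\<lambda>s. L * D * exp (2 * L * s)) has_integral D / 2 * (exp (2 * L * \<tau>) - 1)) {0..\<tau>}"
      by (simp add: algebra_simps)
    have I0: "norm (integral {0..\<tau>} (\<lambda>s. g z s - g w s)) \<le> integral {0..\<tau>} (\<lambda>s. L * D * exp (2 * L * s))"
    proof (rule integral_norm_bound_integral)
      show "(\<lambda>s. g z s - g w s) integrable_on {0..\<tau>}" by (intro integrable_diff i)
      show "(\<lambda>s. L * D * exp (2 * L * s)) integrable_on {0..\<tau>}" using hi by blast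
      fix s assume s: "s \<in> {0..\<tau>}"
      have "\<bar>g z s - g w s\<bar> \<le> L * \<bar>exp (2 * L * s) * apply_bcontfun z s - exp (2 * L * s) * apply_bcontfun w s\<bar>"
        unfolding g_def using s \<tau> by (intro lip) auto
      also have "\<dots> = L * exp (2 * L * s) * \<bar>apply_bcontfun z s - apply_bcontfun w s\<bar>"
        by (simp add: right_diff_distrib[symmetric] abs_mult)
      also have "\<dots> \<le> L * exp (2 * L * s) * D" using L D by (intro mult_left_mono) auto
      finally show "norm (g z s - g w s) \<le> L * D * exp (2 * L * s)" by (simp add: mult_ac)
    qed
    have I: "\<bar>integral {0..\<tau>} (g z) - integral {0..\<tau>} (g w)\<bar> \<le> D / 2 * (exp (2 * L * \<tau>) - 1)"
      using I0 unfolding integral_unique[OF hi] integral_diff[OF i] by simp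
    have "dist (P z t) (P w t) = exp (- 2 * L * \<tau>) * \<bar>integral {0..\<tau>} (g z) - integral {0..\<tau>} (g w)\<bar>"
      by (simp add: P_def \<tau>_def dist_real_def right_diff_distrib[symmetric] abs_mult)
    also have "\<dots> \<le> exp (- 2 * L * \<tau>) * (D / 2 * (exp (2 * L * \<tau>) - 1))" by (intro mult_left_mono I) auto
    also have "\<dots> = D / 2 * (1 - exp (- 2 * L * \<tau>))" by (simp add: algebra_simps exp_minus)
    also have "\<dots> \<le> D / 2 * 1" using D by (intro mult_left_mono) auto
    finally show "dist (apply_bcontfun (F z) t) (apply_bcontfun (F w) t) \<le> 1/2 * dist z w"
      by (simp add: F D_def)
  qed
  have "\<exists>!z. F z = z" by (rule banach_fix_type[of "1/2"]) (use contr in auto)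
  then obtain z where z: "F z = z" by blast
  define y where "y t = exp (2 * L * t) * apply_bcontfun z t" for t
  have gy: "g z s = f s (y s)" for s by (simp add: g_def y_def)
  have yI: "y t = y0 + integral {0..t} (g z)" if "t \<in> {0..1}" for t
  proof -
    have "apply_bcontfun z t = P z t" using F[of z] z by simp
    then show ?thesis using cl_id[OF that] by (simp add: y_def P_def exp_minus field_simps)
  qed
  have "(y has_real_derivative f t (y t)) (at t within {0..1})" if t: "t \<in> {0..1}" for t
  proof -
    have "((\<lambda>t. y0 + integral {0..t} (g z)) has_real_derivative g z t) (at t within {0..1})"
      using integral_has_real_derivative[OF gc t] by (auto intro!: derivative_eq_intros)
    then have d: "((\<lambda>t. y0 + integral {0..t} (g z)) has_real_derivative f t (y t)) (at t within {0..1})"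
      by (simp only: gy[of t])
    show ?thesis
      by (rule has_field_derivative_transform_within[OF d zero_less_one t]) (use yI in auto)
  qed
  moreover have "y 0 = y0" using yI[of 0] by simp
  ultimately show ?thesis by blast
qed

section \<open>The fast speed as a function of the volume and the squared field\<close>

definition sound_sq_at :: "real \<Rightarrow> real \<Rightarrow> real" where "sound_sq_at \<gamma> v = \<gamma> * v powr (- \<gamma> - 1)"

text \<open>Here \<open>y\<close> stands for \<open>B^2\<close>. \<open>speed_sum\<close> and
  \<open>speed_gap\<close> are the sum and the difference of the two squared characteristic speeds,
  and \<open>fast_sq\<close> is the larger of the two.\<close>

definition speed_sum :: "real \<Rightarrow> real \<Rightarrow> real \<Rightarrow> real \<Rightarrow> real" where "speed_sum \<beta> \<gamma> v y = (y + \<beta>\<^sup>2) / v + sound_sq_at \<gamma> v"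

definition speed_gap :: "real \<Rightarrow> real \<Rightarrow> real \<Rightarrow> real \<Rightarrow> real" where
  "speed_gap \<beta> \<gamma> v y = sqrt ((speed_sum \<beta> \<gamma> v y)\<^sup>2 - 4 * \<beta>\<^sup>2 * sound_sq_at \<gamma> v / v)"

definition fast_sq :: "real \<Rightarrow> real \<Rightarrow> real \<Rightarrow> real \<Rightarrow> real" where
  "fast_sq \<beta> \<gamma> v y = (speed_sum \<beta> \<gamma> v y + speed_gap \<beta> \<gamma> v y) / 2"

lemma sound_sq_at_pos: "1 < \<gamma> \<Longrightarrow> 0 < v \<Longrightarrow> 0 < sound_sq_at \<gamma> v"
  by (simp add: sound_sq_at_def)

lemma sound_power2: "1 < \<gamma> \<Longrightarrow> 0 < v \<Longrightarrow> (sound \<gamma> v)\<^sup>2 = sound_sq_at \<gamma> v"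
  using DERIV_imp_deriv[OF pres_has_derivative[of v \<gamma>]] sound_sq_at_pos[of \<gamma> v] by (simp add: sound_def sound_sq_at_def)

lemma alpha_fast:
  "1 < \<gamma> \<Longrightarrow> 0 < U$1 \<Longrightarrow> alpha 1 \<beta> \<gamma> U = fast_sq \<beta> \<gamma> (U$1) ((magB U)\<^sup>2)"
  by (simp add: alpha_def Let_def sound_power2 fast_sq_def speed_sum_def speed_gap_def)

lemma alpha_slow:
  "1 < \<gamma> \<Longrightarrow> 0 < U$1 \<Longrightarrow> alpha (-1) \<beta> \<gamma> U = (speed_sum \<beta> \<gamma> (U$1) ((magB U)\<^sup>2) - speed_gap \<beta> \<gamma> (U$1) ((magB U)\<^sup>2)) / 2"
  by (simp add: alpha_def Let_def sound_power2 speed_sum_def speed_gap_def)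

context
  fixes \<beta> \<gamma> v y :: real
  assumes \<gamma>: "1 < \<gamma>" and v: "0 < v" and y: "0 < y"
begin

private abbreviation (input) "c \<equiv> sound_sq_at \<gamma> v"
private abbreviation (input) "A \<equiv> speed_sum \<beta> \<gamma> v y"
private abbreviation (input) "S \<equiv> speed_gap \<beta> \<gamma> v y"
private abbreviation (input) "m \<equiv> fast_sq \<beta> \<gamma> v y"

lemma speed_sum_pos: "0 < A"
  using sound_sq_at_pos[OF \<gamma> v] v y by (auto simp: speed_sum_def intro!: add_nonneg_pos)

text \<open>The right side exceeds the left by \<open>y / v * (\<beta>^2 / v + c)\<close> plus the
  square of \<open>\<beta>^2 / v - c\<close>. Keeping \<open>y / v * A\<close> instead of mere
  positivity gives a quantitative bound on \<open>A / S\<close>.\<close>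

lemma disc_ge: "y / v * A \<le> A\<^sup>2 - 4 * \<beta>\<^sup>2 * c / v"
proof -
  define D where "D = \<beta>\<^sup>2 / v + c"
  have D: "0 \<le> D" using sound_sq_at_pos[OF \<gamma> v] v by (simp add: D_def)
  have A: "A = D + y / v" using v by (simp add: speed_sum_def D_def add_divide_distrib)
  have "A\<^sup>2 - 4 * \<beta>\<^sup>2 * c / v - y / v * A = y / v * D + (\<beta>\<^sup>2 / v - c)\<^sup>2"
    unfolding A D_def by (simp add: power2_eq_square algebra_simps)
  moreover have "0 \<le> y / v * D + (\<beta>\<^sup>2 / v - c)\<^sup>2" using D v y by simp
  ultimately show ?thesis by linarith
qed

lemma disc_pos: "0 < A\<^sup>2 - 4 * \<beta>\<^sup>2 * c / v"
  using disc_ge speed_sum_pos v y by (intro less_le_trans[OF _ disc_ge]) auto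

lemma speed_gap_pos: "0 < S" using disc_pos by (simp add: speed_gap_def)

lemma speed_gap_sq: "S\<^sup>2 = A\<^sup>2 - 4 * \<beta>\<^sup>2 * c / v" using disc_pos by (simp add: speed_gap_def)

lemma speed_gap_le: "S \<le> A"
proof -
  have "0 \<le> 4 * \<beta>\<^sup>2 * c / v" using sound_sq_at_pos[OF \<gamma> v] v by simp
  then have "S\<^sup>2 \<le> A\<^sup>2" unfolding speed_gap_sq by linarith
  then show ?thesis using speed_sum_pos by (simp add: power2_le_iff_abs_le abs_le_iff)
qed

lemma fast_sq_le: "m \<le> A" using speed_gap_le by (simp add: fast_sq_def)

lemma fast_sq_root: "m\<^sup>2 - A * m + \<beta>\<^sup>2 * c / v = 0"
proof -
  have "4 * (m\<^sup>2 - A * m + \<beta>\<^sup>2 * c / v) = S\<^sup>2 - (A\<^sup>2 - 4 * \<beta>\<^sup>2 * c / v)"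
    by (simp add: fast_sq_def power2_eq_square field_simps)
  then show ?thesis by (simp add: speed_gap_sq)
qed

text \<open>The characteristic equation of \<open>m\<close> in factored form. It yields the two
  lower bounds on \<open>m\<close> and, on the curve, the compatibility of the induction components
  of the eigenvector.\<close>

lemma fast_sq_factor: "(m - c) * (m * v - \<beta>\<^sup>2) = m * y"
proof -
  have "(m - c) * (m * v - \<beta>\<^sup>2) - m * y = v * (m\<^sup>2 - A * m + \<beta>\<^sup>2 * c / v)"
    using v by (simp add: speed_sum_def power2_eq_square field_simps)
  then show ?thesis by (simp add: fast_sq_root)
qed

lemma fast_sq_pos: "0 < m" using speed_sum_pos speed_gap_pos by (simp add: fast_sq_def)

text \<open>By the factored equation both differences have the same sign. Were both negative,
  \<open>2 m v\<close> would be less than \<open>\<beta>^2 + c v\<close>, against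
  \<open>2 m \<ge> A\<close>.\<close>

lemma fast_sq_gt: "c < m" "\<beta>\<^sup>2 < m * v"
proof -
  have "0 < (m - c) * (m * v - \<beta>\<^sup>2)" unfolding fast_sq_factor using fast_sq_pos y by simp
  then have *: "(0 < m - c \<and> 0 < m * v - \<beta>\<^sup>2) \<or> (m - c < 0 \<and> m * v - \<beta>\<^sup>2 < 0)"
    by (auto simp: zero_less_mult_iff)
  have "A \<le> 2 * m" using speed_gap_pos by (simp add: fast_sq_def)
  then have "A * v \<le> 2 * m * v" using v by (intro mult_right_mono) auto
  moreover have "A * v = y + \<beta>\<^sup>2 + c * v" using v by (simp add: speed_sum_def field_simps)
  ultimately have "y + \<beta>\<^sup>2 + c * v \<le> 2 * (m * v)" by simp
  moreover have "m * v < c * v" if "m < c" using that v by simp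
  ultimately show "c < m" "\<beta>\<^sup>2 < m * v" using * y by auto
qed

lemma fast_sq_ge: "y / v \<le> m"
proof -
  have "m * y \<le> m * (m * v)"
    unfolding fast_sq_factor[symmetric] using fast_sq_gt sound_sq_at_pos[OF \<gamma> v] fast_sq_pos by (intro mult_mono) auto
  then have "y \<le> m * v" using fast_sq_pos by (simp add: mult_le_cancel_left)
  then show ?thesis using v by (simp add: field_simps)
qed

text \<open>The ratio \<open>A / S\<close> governs how fast \<open>S\<close> varies with
  \<open>y\<close>. From \<open>A v \<le> y + E\<close> and \<open>S^2 \<ge> (y / v) A\<close> it is
  bounded uniformly as long as \<open>y\<close> stays above \<open>y0\<close>.\<close>

lemma speed_sum_le_gap:
  assumes y0: "0 < y0" "y0 \<le> y" and E: "\<beta>\<^sup>2 + v * c \<le> E"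
  shows "A \<le> sqrt ((y0 + E) / y0) * S"
proof -
  have E0: "0 \<le> E" using E sound_sq_at_pos[OF \<gamma> v] v by (smt (verit) mult_nonneg_nonneg zero_le_power2)
  have "A * v = y + (\<beta>\<^sup>2 + v * c)" using v by (simp add: speed_sum_def field_simps)
  also have "\<dots> \<le> y + E" using E by simp
  also have "\<dots> \<le> (y0 + E) / y0 * y"
  proof -
    have "E * y0 \<le> E * y" using E0 y0 by (intro mult_left_mono)
    then show ?thesis using y0 by (simp add: field_simps)
  qed
  finally have "A * v \<le> (y0 + E) / y0 * y" .
  then have "A \<le> (y0 + E) / y0 * y / v" by (subst pos_le_divide_eq) (use v in auto)
  then have "A\<^sup>2 \<le> (y0 + E) / y0 * (y / v) * A"
    using mult_right_mono[of A "(y0 + E) / y0 * y / v" A] speed_sum_pos by (simp add: power2_eq_square)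
  also have "\<dots> = (y0 + E) / y0 * (y / v * A)" by simp
  also have "\<dots> \<le> (y0 + E) / y0 * S\<^sup>2"
    unfolding speed_gap_sq using disc_ge y0 E0 by (intro mult_left_mono) auto
  also have "\<dots> = (sqrt ((y0 + E) / y0) * S)\<^sup>2" using y0 E0 by (simp add: power_mult_distrib)
  finally have "A\<^sup>2 \<le> (sqrt ((y0 + E) / y0) * S)\<^sup>2" .
  moreover have "0 \<le> sqrt ((y0 + E) / y0) * S"
    using y0 E0 by (intro mult_nonneg_nonneg less_imp_le[OF speed_gap_pos]) simp
  ultimately show ?thesis by (rule power2_le_imp_le)
qed

end

text \<open>\<open>S^2\<close> and \<open>A^2\<close> differ by a term free of \<open>y\<close>, so
  \<open>(S_y - S_z) (S_y + S_z) = (A_y - A_z) (A_y + A_z)\<close>, and the bound on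
  \<open>A / S\<close> cancels the sums.\<close>

lemma speed_gap_lipschitz:
  assumes \<gamma>: "1 < \<gamma>" and v: "0 < v" and y0: "0 < y0" "y0 \<le> y" "y0 \<le> z" and E: "\<beta>\<^sup>2 + v * sound_sq_at \<gamma> v \<le> E"
  shows "\<bar>speed_gap \<beta> \<gamma> v y - speed_gap \<beta> \<gamma> v z\<bar> \<le> sqrt ((y0 + E) / y0) * (\<bar>y - z\<bar> / v)"
proof -
  define k where "k = sqrt ((y0 + E) / y0)"
  let ?Sy = "speed_gap \<beta> \<gamma> v y" and ?Sz = "speed_gap \<beta> \<gamma> v z" and ?Ay = "speed_sum \<beta> \<gamma> v y" and ?Az = "speed_sum \<beta> \<gamma> v z"
  have yz: "0 < y" "0 < z" using y0 by auto
  have S: "0 < ?Sy" "0 < ?Sz" using speed_gap_pos[OF \<gamma> v] yz by auto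
  have A: "0 < ?Ay" "0 < ?Az" using speed_sum_pos[OF \<gamma> v] yz by auto
  have k: "?Ay \<le> k * ?Sy" "?Az \<le> k * ?Sz"
    unfolding k_def using speed_sum_le_gap[OF \<gamma> v] y0 E yz by auto
  have dA: "?Ay - ?Az = (y - z) / v" using v by (simp add: speed_sum_def field_simps)
  have "\<bar>?Sy - ?Sz\<bar> * (?Sy + ?Sz) = \<bar>?Sy\<^sup>2 - ?Sz\<^sup>2\<bar>"
    using S by (simp add: power2_eq_square square_diff_square_factored abs_mult mult.commute)
  also have "\<dots> = \<bar>?Ay - ?Az\<bar> * (?Ay + ?Az)"
    unfolding speed_gap_sq[OF \<gamma> v yz(1)] speed_gap_sq[OF \<gamma> v yz(2)]
    using A by (simp add: power2_eq_square square_diff_square_factored abs_mult mult.commute)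
  also have "\<dots> \<le> \<bar>?Ay - ?Az\<bar> * (k * (?Sy + ?Sz))"
    using k by (intro mult_left_mono) (auto simp: algebra_simps)
  finally have "\<bar>?Sy - ?Sz\<bar> * (?Sy + ?Sz) \<le> (k * \<bar>?Ay - ?Az\<bar>) * (?Sy + ?Sz)" by (simp add: mult_ac)
  then have "\<bar>?Sy - ?Sz\<bar> \<le> k * \<bar>?Ay - ?Az\<bar>" using S by simp
  then show ?thesis unfolding dA k_def using v by (simp add: abs_divide)
qed

lemma nondecreasing_unit_interval:
  fixes f :: "real \<Rightarrow> real"
  assumes d: "\<And>p. p \<in> {0..1} \<Longrightarrow> (f has_real_derivative f' p) (at p within {0..1})"
    and n: "\<And>p. p \<in> {0..1} \<Longrightarrow> 0 \<le> f' p" and pq: "0 \<le> p" "p \<le> q" "q \<le> 1"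
  shows "f p \<le> f q"
proof (cases "p = q")
  case False
  then have "p < q" using pq by simp
  moreover have "(f has_derivative (*) (f' x)) (at x within {p..q})" if "x \<in> {p..q}" for x
    using d[of x] that pq has_derivative_subset[of f "(*) (f' x)" x "{0..1}" "{p..q}"]
    by (auto simp: has_field_derivative_def)
  ultimately obtain x where x: "x \<in> {p<..<q}" "f q - f p = f' x * (q - p)"
    using mvt_simple[of p q f "\<lambda>x. (*) (f' x)"] by auto
  have "0 \<le> f' x * (q - p)" using n[of x] x(1) pq by (intro mult_nonneg_nonneg) auto
  then show ?thesis using x(2) by simp
qed simp

lemma has_vector_derivative_vec4:
  fixes f :: "real \<Rightarrow> real^4"
  assumes "\<And>i. ((\<lambda>x. f x $ i) has_real_derivative f' $ i) (at x within S)"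
  shows "(f has_vector_derivative f') (at x within S)"
  unfolding has_vector_derivative_def
  by (rule has_derivative_vec4) (use assms in \<open>simp add: has_field_derivative_def mult_commute_abs\<close>)

lemma continuous_on_vector4:
  fixes a b c d :: "real \<Rightarrow> real"
  assumes "continuous_on S a" "continuous_on S b" "continuous_on S c" "continuous_on S d"
  shows "continuous_on S (\<lambda>x. vector [a x, b x, c x, d x] :: real^4)"
proof -
  have "continuous_on S (\<lambda>x. \<chi> i. (vector [a x, b x, c x, d x] :: real^4) $ i)"
  proof (rule continuous_on_vec_lambda)
    fix i :: 4
    show "continuous_on S (\<lambda>x. (vector [a x, b x, c x, d x] :: real^4) $ i)"
      using exhaust_4[of i] assms by auto
  qed
  then show ?thesis by simp
qed

text \<open>A primitive of \<open>-c\<close>: since the fast speed exceeds \<open>c\<close>, it bounds the growth of \<open>u\<close> along the fast curve.\<close>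
definition riemann_u :: "real \<Rightarrow> real \<Rightarrow> real" where
  "riemann_u \<gamma> v = 2 * sqrt \<gamma> / (\<gamma> - 1) * v powr (- (\<gamma> - 1) / 2)"

lemma riemann_u_derivative:
  assumes "1 < \<gamma>" "0 < v"
  shows "(riemann_u \<gamma> has_real_derivative - sqrt \<gamma> * v powr (- (\<gamma> + 1) / 2)) (at v)"
proof -
  have e: "- (\<gamma> - 1) / 2 - 1 = - (\<gamma> + 1) / 2" by (simp add: field_simps)
  have "(riemann_u \<gamma> has_real_derivative 2 * sqrt \<gamma> / (\<gamma> - 1) * (- (\<gamma> - 1) / 2 * v powr (- (\<gamma> - 1) / 2 - 1))) (at v)"
    unfolding riemann_u_def[abs_def] by (intro DERIV_cmult has_real_derivative_powr assms)
  moreover have "2 * sqrt \<gamma> / (\<gamma> - 1) * (- (\<gamma> - 1) / 2 * v powr (- (\<gamma> - 1) / 2 - 1)) = - sqrt \<gamma> * v powr (- (\<gamma> + 1) / 2)"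
    unfolding e using assms(1) by (simp add: field_simps)
  ultimately show ?thesis by metis
qed

lemma sound_sq_at_sqrt: "1 < \<gamma> \<Longrightarrow> 0 < v \<Longrightarrow> (sqrt \<gamma> * v powr (- (\<gamma> + 1) / 2))\<^sup>2 = sound_sq_at \<gamma> v"
  using powr_add[of v "- (\<gamma> + 1) / 2" "- (\<gamma> + 1) / 2"]
  by (simp add: power_mult_distrib sound_sq_at_def power2_eq_square[of "_ powr _"])

text \<open>The Lipschitz estimate needs \<open>y\<close> bounded away from 0, so the right-hand
  side is evaluated at \<open>max y y0\<close>. As \<open>m > c\<close> makes it nonnegative, the
  solution never falls below \<open>y0\<close> and the truncation is inactive.\<close>

lemma fast_profile_exists:
  assumes \<gamma>: "1 < \<gamma>" and v1: "0 < v1" "v1 < vW" and y0: "0 < y0"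
  shows "\<exists>Y. Y 0 = y0 \<and> (\<forall>p\<in>{0..1}. 0 < Y p \<and>
     (Y has_real_derivative 2 * (vW - v1) * (fast_sq \<beta> \<gamma> (vW - p * (vW - v1)) (Y p) - sound_sq_at \<gamma> (vW - p * (vW - v1)))) (at p within {0..1}))"
proof -
  define \<delta> where "\<delta> = vW - v1"
  define vp where "vp p = vW - p * \<delta>" for p :: real
  have \<delta>: "0 < \<delta>" using v1 by (simp add: \<delta>_def)
  have vp: "v1 \<le> vp p" "0 < vp p" if "p \<in> {0..1}" for p
  proof -
    have "p * \<delta> \<le> 1 * \<delta>" using that \<delta> by (intro mult_right_mono) auto
    then show "v1 \<le> vp p" by (simp add: vp_def \<delta>_def)
    then show "0 < vp p" using v1 by simp
  qed
  \<comment> \<open>A bound for \<open>\<beta>^2 + v c\<close> along the whole path: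
    \<open>v c = \<gamma> v powr (- \<gamma>)\<close> is largest at the final volume
    \<open>v1\<close>.\<close>
  define E where "E = \<beta>\<^sup>2 + \<gamma> * v1 powr (- \<gamma>)"
  have E: "\<beta>\<^sup>2 + vp p * sound_sq_at \<gamma> (vp p) \<le> E" if "p \<in> {0..1}" for p
  proof -
    have "vp p * sound_sq_at \<gamma> (vp p) = \<gamma> * vp p powr (- \<gamma>)"
      using powr_add[of "vp p" 1 "- \<gamma> - 1"] vp(2)[OF that] by (simp add: sound_sq_at_def)
    also have "\<dots> \<le> \<gamma> * v1 powr (- \<gamma>)"
      using \<gamma> v1 vp[OF that] by (intro mult_left_mono powr_mono2') auto
    finally show ?thesis by (simp add: E_def)
  qed
  define k where "k = sqrt ((y0 + E) / y0)"
  have "0 \<le> E" using \<gamma> by (simp add: E_def)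
  then have k: "0 \<le> k" using y0 by (simp add: k_def)
  define F where "F p y = 2 * \<delta> * (fast_sq \<beta> \<gamma> (vp p) (max y y0) - sound_sq_at \<gamma> (vp p))" for p y
  have cont: "continuous_on ({0..1} \<times> UNIV) (\<lambda>z. F (fst z) (snd z))"
    unfolding F_def fast_sq_def speed_gap_def speed_sum_def sound_sq_at_def vp_def
    by (intro continuous_intros) (use vp(2) in \<open>auto simp: vp_def less_le\<close>)
  have lip: "\<bar>F p x - F p y\<bar> \<le> \<delta> * (1 + k) / v1 * \<bar>x - y\<bar>" if p: "p \<in> {0..1}" for p x y
  proof -
    let ?x = "max x y0" and ?y = "max y y0"
    have d: "\<bar>?x - ?y\<bar> \<le> \<bar>x - y\<bar>" by (simp add: max_def)
    have A: "\<bar>speed_sum \<beta> \<gamma> (vp p) ?x - speed_sum \<beta> \<gamma> (vp p) ?y\<bar> = \<bar>?x - ?y\<bar> / vp p"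
      using vp(2)[OF p] by (simp add: speed_sum_def diff_divide_distrib[symmetric] abs_divide)
    have S: "\<bar>speed_gap \<beta> \<gamma> (vp p) ?x - speed_gap \<beta> \<gamma> (vp p) ?y\<bar> \<le> k * (\<bar>?x - ?y\<bar> / vp p)"
      unfolding k_def by (rule speed_gap_lipschitz[OF \<gamma> vp(2)[OF p] y0 _ _ E[OF p]]) auto
    have "\<bar>F p x - F p y\<bar> = \<delta> * \<bar>(speed_sum \<beta> \<gamma> (vp p) ?x - speed_sum \<beta> \<gamma> (vp p) ?y) + (speed_gap \<beta> \<gamma> (vp p) ?x - speed_gap \<beta> \<gamma> (vp p) ?y)\<bar>"
    proof -
      have "F p x - F p y = \<delta> * ((speed_sum \<beta> \<gamma> (vp p) ?x - speed_sum \<beta> \<gamma> (vp p) ?y) + (speed_gap \<beta> \<gamma> (vp p) ?x - speed_gap \<beta> \<gamma> (vp p) ?y))"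
        by (simp add: F_def fast_sq_def field_simps)
      then show ?thesis using \<delta> by (simp add: abs_mult)
    qed
    also have "\<dots> \<le> \<delta> * (\<bar>?x - ?y\<bar> / vp p + k * (\<bar>?x - ?y\<bar> / vp p))"
      using A S \<delta> by (intro mult_left_mono order_trans[OF abs_triangle_ineq add_mono]) auto
    also have "\<dots> = \<delta> * (1 + k) * (\<bar>?x - ?y\<bar> / vp p)" by (simp add: algebra_simps add_divide_distrib)
    also have "\<dots> \<le> \<delta> * (1 + k) * (\<bar>x - y\<bar> / v1)"
      using d vp[OF p] v1 \<delta> k by (intro mult_left_mono frac_le) auto
    finally show ?thesis by simp
  qed
  obtain Y where Y: "Y 0 = y0" "\<And>p. p \<in> {0..1} \<Longrightarrow> (Y has_real_derivative F p (Y p)) (at p within {0..1})"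
    using picard_unit_interval[OF cont lip, of y0] \<delta> k v1 by (auto simp: zero_less_mult_iff)
  have Fpos: "0 \<le> F p y" if "p \<in> {0..1}" for p y
  proof -
    have "0 < max y y0" using y0 by simp
    from fast_sq_gt(1)[OF \<gamma> vp(2)[OF that] this, of \<beta>] show ?thesis
      unfolding F_def using \<delta> by (intro mult_nonneg_nonneg) auto
  qed
  have Yge: "y0 \<le> Y p" if "p \<in> {0..1}" for p
    using nondecreasing_unit_interval[of Y "\<lambda>p. F p (Y p)" 0 p] Y Fpos that by auto
  have "F p (Y p) = 2 * (vW - v1) * (fast_sq \<beta> \<gamma> (vW - p * (vW - v1)) (Y p) - sound_sq_at \<gamma> (vW - p * (vW - v1)))" if "p \<in> {0..1}" for p
    using Yge[OF that] by (simp add: F_def vp_def \<delta>_def max_def)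
  then show ?thesis using Y Yge y0 by (intro exI[of _ Y]) fastforce
qed

definition simple_wave where
  "simple_wave \<beta> \<gamma> \<Phi> \<Phi>' \<mu> \<mu>' \<longleftrightarrow> continuous_on {0..1} \<Phi>' \<and> continuous_on {0..1} \<mu>' \<and>
     (\<forall>p\<in>{0..1::real}. 0 < \<Phi> p $ 1 \<and> (\<Phi> has_vector_derivative \<Phi>' p) (at p within {0..1}) \<and>
        dflux \<beta> \<gamma> (\<Phi> p) (\<Phi>' p) = \<mu> p *\<^sub>R \<Phi>' p \<and> (\<mu> has_real_derivative \<mu>' p) (at p within {0..1}))"

text \<open>
  With \<open>m = \<lambda>\<^sup>2\<close> and \<open>y = B\<^sup>2\<close>, an eigenvector \<open>(dv, dq, du, dw)\<close> of the flux satisfies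
  \<open>dy = - 2 (m - c\<^sup>2) dv\<close>, \<open>du = - \<lambda> dv\<close>, \<open>dw = - \<beta> dB / \<lambda>\<close>. The curve is parametrised by decreasing \<open>v\<close>,
  so that only the scalar equation for \<open>y\<close> has to be solved. The bound on \<open>q\<close> comes from the monotonicity
  of \<open>(y + \<beta>\<^sup>2) v\<^sup>2\<close>, the bound on \<open>w\<close> from comparison with \<open>ln y\<close>.
\<close>
lemma fast_curve:
  fixes W :: "real^4" and \<beta> \<gamma> \<kappa> v1 :: real
  assumes \<gamma>: "1 < \<gamma>" and W: "0 < W$1" "magB W \<noteq> 0" and \<kappa>: "\<kappa> = 1 \<or> \<kappa> = -1"
    and v1: "0 < v1" "v1 < W$1"
  defines "Kq \<equiv> ((magB W)\<^sup>2 + \<beta>\<^sup>2) * (W$1)\<^sup>2"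
  obtains \<Phi> \<Phi>' :: "real \<Rightarrow> real^4" and \<mu> \<mu>' :: "real \<Rightarrow> real" where
    "simple_wave \<beta> \<gamma> \<Phi> \<Phi>' \<mu> \<mu>'" "\<And>p. p \<in> {0..1} \<Longrightarrow> 0 \<le> \<kappa> * \<mu>' p"
    "\<Phi> 0 = W" "\<mu> 0 = \<kappa> * sqrt (alpha 1 \<beta> \<gamma> W)"
    "\<Phi> 1 $ 1 = v1" "riemann_u \<gamma> v1 - riemann_u \<gamma> (W$1) \<le> \<kappa> * (\<Phi> 1 $ 3 - W$3)"
    "(\<Phi> 1 $ 2)\<^sup>2 \<le> Kq"
    "\<bar>\<Phi> 1 $ 4 - W$4\<bar> \<le> \<bar>\<beta>\<bar> * sqrt (W$1) / 2 * (ln (Kq / v1\<^sup>2) - ln ((magB W)\<^sup>2))"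
proof -
  define \<delta> where "\<delta> = W$1 - v1"
  define v where "v p = W$1 - p * \<delta>" for p :: real
  have \<delta>: "0 < \<delta>" using v1 by (simp add: \<delta>_def)
  have vpos: "0 < v p" and vle: "v p \<le> W$1" if "p \<in> {0..1}" for p
  proof -
    have "p * \<delta> \<le> 1 * \<delta>" using that \<delta> by (intro mult_right_mono) auto
    then show "0 < v p" using v1 \<delta>_def unfolding v_def by linarith
    show "v p \<le> W$1" using that \<delta> by (simp add: v_def)
  qed
  have v01: "v 0 = W$1" "v 1 = v1" by (auto simp: v_def \<delta>_def)
  have y0: "0 < (magB W)\<^sup>2" using W by simp
  define c where "c p = sound_sq_at \<gamma> (v p)" for p
  obtain Y where Y0: "Y 0 = (magB W)\<^sup>2" and Ypos: "\<And>p. p \<in> {0..1} \<Longrightarrow> 0 < Y p"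
    and dY': "\<And>p. p \<in> {0..1} \<Longrightarrow> (Y has_real_derivative 2 * \<delta> * (fast_sq \<beta> \<gamma> (v p) (Y p) - c p)) (at p within {0..1})"
    using fast_profile_exists[OF \<gamma> v1 y0, of \<beta>] unfolding v_def \<delta>_def c_def by blast
  define m where "m p = fast_sq \<beta> \<gamma> (v p) (Y p)" for p
  note dY = dY'[folded m_def]
  define S where "S p = speed_gap \<beta> \<gamma> (v p) (Y p)" for p
  define A where "A p = speed_sum \<beta> \<gamma> (v p) (Y p)" for p
  have mc: "c p < m p" and mv: "\<beta>\<^sup>2 < m p * v p" and mpos: "0 < m p" and Spos: "0 < S p" and mY: "Y p \<le> m p * v p"
    and mA: "m p \<le> A p" and fac: "(m p - c p) * (m p * v p - \<beta>\<^sup>2) = m p * Y p" and cpos: "0 < c p" if "p \<in> {0..1}" for p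
    using fast_sq_gt[OF \<gamma> vpos[OF that] Ypos[OF that], of \<beta>] fast_sq_pos[OF \<gamma> vpos[OF that] Ypos[OF that], of \<beta>]
      speed_gap_pos[OF \<gamma> vpos[OF that] Ypos[OF that], of \<beta>] fast_sq_ge[OF \<gamma> vpos[OF that] Ypos[OF that], of \<beta>]
      fast_sq_le[OF \<gamma> vpos[OF that] Ypos[OF that], of \<beta>] fast_sq_factor[OF \<gamma> vpos[OF that] Ypos[OF that], of \<beta>] sound_sq_at_pos[OF \<gamma> vpos[OF that]] vpos[OF that]
    unfolding m_def S_def c_def A_def by (auto simp: pos_divide_le_eq)
  define Y' where "Y' p = 2 * \<delta> * (m p - c p)" for p
  have Y'pos: "0 \<le> Y' p" if "p \<in> {0..1}" for p using mc[OF that] \<delta> by (simp add: Y'_def)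
  have dv: "(v has_real_derivative - \<delta>) (at p within {0..1})" for p
    unfolding v_def[abs_def] by (auto intro!: derivative_eq_intros)
  define c' where "c' p = \<delta> * (\<gamma> * (\<gamma> + 1) * v p powr (- \<gamma> - 2))" for p
  have c'pos: "0 \<le> c' p" for p using \<delta> \<gamma> by (simp add: c'_def)
  have dc: "(c has_real_derivative c' p) (at p within {0..1})" if p: "p \<in> {0..1}" for p
  proof -
    have "((\<lambda>x. \<gamma> * x powr (- \<gamma> - 1)) has_real_derivative \<gamma> * ((- \<gamma> - 1) * v p powr (- \<gamma> - 1 - 1))) (at (v p))"
      by (intro DERIV_cmult has_real_derivative_powr vpos[OF p])
    from DERIV_chain2[OF this dv[of p]] show ?thesis
      unfolding c_def[abs_def] sound_sq_at_def by (rule DERIV_cong) (simp add: c'_def algebra_simps)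
  qed
  define A' where "A' p = Y' p / v p + (Y p + \<beta>\<^sup>2) * \<delta> / (v p)\<^sup>2 + c' p" for p
  have dA: "(A has_real_derivative A' p) (at p within {0..1})" if p: "p \<in> {0..1}" for p
    unfolding A_def[abs_def] speed_sum_def c_def[symmetric]
    using dY[OF p] dv[of p] dc[OF p] vpos[OF p]
    by (auto intro!: derivative_eq_intros simp: A'_def Y'_def field_simps power2_eq_square)
  define N where "N p = \<beta>\<^sup>2 * c p / v p" for p
  define N' where "N' p = \<beta>\<^sup>2 * c' p / v p + \<beta>\<^sup>2 * c p * \<delta> / (v p)\<^sup>2" for p
  have dN: "(N has_real_derivative N' p) (at p within {0..1})" if p: "p \<in> {0..1}" for p
    unfolding N_def[abs_def]
    using dv[of p] dc[OF p] vpos[OF p]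
    by (auto intro!: derivative_eq_intros simp: N'_def field_simps power2_eq_square)
  have S_eq: "S = (\<lambda>p. sqrt ((A p)\<^sup>2 - 4 * N p))"
    by (simp add: fun_eq_iff S_def speed_gap_def A_def N_def c_def)
  have Sarg: "0 < (A p)\<^sup>2 - 4 * N p" if "p \<in> {0..1}" for p
    using disc_pos[OF \<gamma> vpos[OF that] Ypos[OF that], of \<beta>] by (simp add: A_def N_def c_def)
  have dS: "(S has_real_derivative (A p * A' p - 2 * N' p) / S p) (at p within {0..1})" if p: "p \<in> {0..1}" for p
  proof -
    have "((\<lambda>p. (A p)\<^sup>2 - 4 * N p) has_real_derivative 2 * (A p * A' p) - 4 * N' p) (at p within {0..1})"
      using dA[OF p] dN[OF p] by (auto intro!: derivative_eq_intros)
    note DERIV_chain2[OF DERIV_real_sqrt[OF Sarg[OF p]] this]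
    moreover have "inverse s / 2 * (2 * x - 4 * z) = (x - 2 * z) / s" for s x z :: real
      by (cases "s = 0") (simp_all add: field_simps)
    ultimately show ?thesis unfolding S_eq by (simp only:)
  qed
  \<comment> \<open>Differentiating \<open>m^2 - A m + N = 0\<close> gives
    \<open>(2 m - A) m' = A' m - N'\<close>, and \<open>2 m - A = S\<close>.\<close>
  define m' where "m' p = (A' p * m p - N' p) / S p" for p
  have m_eq: "m = (\<lambda>p. (A p + S p) / 2)" by (simp add: fun_eq_iff m_def fast_sq_def A_def S_def)
  have dm: "(m has_real_derivative m' p) (at p within {0..1})" if p: "p \<in> {0..1}" for p
  proof -
    have "((\<lambda>p. (A p + S p) / 2) has_real_derivative (A' p + (A p * A' p - 2 * N' p) / S p) / 2) (at p within {0..1})"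
      by (intro DERIV_cdivide DERIV_add dA dS p)
    moreover have "(A' p + (A p * A' p - 2 * N' p) / S p) / 2 = m' p"
      using Spos[OF p] unfolding m'_def m_eq by (simp add: field_simps)
    ultimately show ?thesis unfolding m_eq by simp
  qed
  have m'pos: "0 \<le> m' p" if p: "p \<in> {0..1}" for p
  proof -
    \<comment> \<open>The grouping makes every summand nonnegative through \<open>m > c\<close> and
      \<open>m v > \<beta>^2\<close>. This is the monotonicity of the fast speed along the
      curve.\<close>
    have "A' p * m p - N' p = m p * Y' p / v p + m p * Y p * \<delta> / (v p)\<^sup>2 + \<beta>\<^sup>2 * \<delta> * (m p - c p) / (v p)\<^sup>2
        + c' p * ((m p * v p - \<beta>\<^sup>2) / v p)"
      using vpos[OF p] by (simp add: A'_def N'_def field_simps power2_eq_square)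
    also have "\<dots> \<ge> 0"
      using mpos[OF p] Y'pos[OF p] vpos[OF p] Ypos[OF p] \<delta> mc[OF p] c'pos[of p] mv[OF p]
      by (intro add_nonneg_nonneg mult_nonneg_nonneg divide_nonneg_nonneg) auto
    finally show ?thesis using Spos[OF p] by (simp add: m'_def)
  qed
  \<comment> \<open>As \<open>Y\<close> stays positive, the field keeps its initial sign and is
    recovered from its square.\<close>
  define \<tau> where "\<tau> = sgn (magB W)"
  have \<tau>: "\<tau> * \<bar>magB W\<bar> = magB W" "\<tau> * \<tau> = 1" using W(2) by (auto simp: \<tau>_def sgn_if)
  define B where "B p = \<tau> * sqrt (Y p)" for p
  have B0: "B 0 = magB W" by (simp add: B_def Y0 \<tau>)
  have BY: "B p * B p = Y p" if "p \<in> {0..1}" for p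
  proof -
    have "B p * B p = (\<tau> * \<tau>) * (sqrt (Y p) * sqrt (Y p))" by (simp add: B_def)
    then show ?thesis using Ypos[OF that] by (simp add: \<tau>)
  qed
  define B' where "B' p = \<delta> * (m p - c p) * B p / Y p" for p
  have dB: "(B has_real_derivative B' p) (at p within {0..1})" if p: "p \<in> {0..1}" for p
  proof -
    have "((\<lambda>p. sqrt (Y p)) has_real_derivative inverse (sqrt (Y p)) / 2 * (2 * \<delta> * (m p - c p))) (at p within {0..1})"
      by (rule DERIV_chain2[OF DERIV_real_sqrt[OF Ypos[OF p]] dY[OF p]])
    then have "(B has_real_derivative \<tau> * (inverse (sqrt (Y p)) / 2 * (2 * \<delta> * (m p - c p)))) (at p within {0..1})"
      unfolding B_def[abs_def] by (rule DERIV_cmult)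
    moreover have "inverse (sqrt (Y p)) = sqrt (Y p) / Y p"
      using Ypos[OF p] by (simp add: field_simps)
    moreover have "t * (s / y / 2 * (2 * d * k)) = d * k * (t * s) / y" for t s y d k :: real
      by (cases "y = 0") (simp_all add: field_simps)
    ultimately show ?thesis by (simp only: B'_def B_def)
  qed
  define \<mu> where "\<mu> p = \<kappa> * sqrt (m p)" for p
  have \<kappa>2: "\<kappa> * \<kappa> = 1" using \<kappa> by auto
  have \<mu>2: "\<mu> p * \<mu> p = m p" if "p \<in> {0..1}" for p
  proof -
    have "\<mu> p * \<mu> p = (\<kappa> * \<kappa>) * (sqrt (m p) * sqrt (m p))" by (simp add: \<mu>_def)
    then show ?thesis using mpos[OF that] by (simp add: \<kappa>2)
  qed
  have \<mu>0: "\<mu> p \<noteq> 0" if "p \<in> {0..1}" for p using \<mu>2[OF that] mpos[OF that] by auto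
  define \<mu>' where "\<mu>' p = \<kappa> * (inverse (sqrt (m p)) / 2 * m' p)" for p
  have d\<mu>: "(\<mu> has_real_derivative \<mu>' p) (at p within {0..1})" if p: "p \<in> {0..1}" for p
    unfolding \<mu>_def[abs_def] \<mu>'_def
    by (intro DERIV_cmult DERIV_chain2[OF DERIV_real_sqrt[OF mpos[OF p]] dm[OF p]])
  have cont: "continuous_on {0..1} Y" "continuous_on {0..1} v" "continuous_on {0..1} c" "continuous_on {0..1} A"
    "continuous_on {0..1} S" "continuous_on {0..1} m" "continuous_on {0..1} B" "continuous_on {0..1} \<mu>"
    by (rule DERIV_continuous_on, (rule dY dv dc dA dS dm dB d\<mu>)?, assumption?)+
  have contc': "continuous_on {0..1} c'"
    unfolding c'_def[abs_def] by (intro continuous_intros cont) (use vpos in \<open>auto simp: less_le\<close>)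
  have contB': "continuous_on {0..1} B'"
    unfolding B'_def[abs_def] by (intro continuous_intros cont) (use Ypos in \<open>auto simp: less_le\<close>)
  have cont\<mu>': "continuous_on {0..1} \<mu>'"
    unfolding \<mu>'_def[abs_def] m'_def A'_def N'_def Y'_def
    by (intro continuous_intros cont contc') (use vpos mpos Spos in \<open>auto simp: less_le\<close>)
  \<comment> \<open>\<open>u\<close> and \<open>w\<close> do not enter the equations for
    \<open>v\<close> and \<open>Y\<close>, so they are obtained afterwards by integration.\<close>
  have contu': "continuous_on {0..1} (\<lambda>p. \<mu> p * \<delta>)" by (intro continuous_intros cont)
  obtain u0 where u0: "\<And>p. p \<in> {0..1} \<Longrightarrow> (u0 has_vector_derivative \<mu> p * \<delta>) (at p within {0..1})"
    using antiderivative_continuous[OF contu'] by blast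
  have contw': "continuous_on {0..1} (\<lambda>p. - \<beta> * B' p / \<mu> p)" by (intro continuous_intros cont contB') (use \<mu>0 in auto)
  obtain w0 where w0: "\<And>p. p \<in> {0..1} \<Longrightarrow> (w0 has_vector_derivative - \<beta> * B' p / \<mu> p) (at p within {0..1})"
    using antiderivative_continuous[OF contw'] by blast
  define u where "u p = W$3 + (u0 p - u0 0)" for p
  define w where "w p = W$4 + (w0 p - w0 0)" for p
  have du: "(u has_real_derivative \<mu> p * \<delta>) (at p within {0..1})" if "p \<in> {0..1}" for p
    unfolding u_def[abs_def] using u0[OF that]
    by (auto intro!: derivative_eq_intros simp: has_real_derivative_iff_has_vector_derivative)
  have dw: "(w has_real_derivative - \<beta> * B' p / \<mu> p) (at p within {0..1})" if "p \<in> {0..1}" for p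
    unfolding w_def[abs_def] using w0[OF that]
    by (auto intro!: derivative_eq_intros simp: has_real_derivative_iff_has_vector_derivative)
  define \<Phi> :: "real \<Rightarrow> real^4" where "\<Phi> p = vector [v p, v p * B p, u p, w p]" for p
  define \<Phi>' :: "real \<Rightarrow> real^4" where "\<Phi>' p = vector [- \<delta>, v p * B' p - \<delta> * B p, \<mu> p * \<delta>, - \<beta> * B' p / \<mu> p]" for p
  have mag: "magB (\<Phi> p) = B p" if "p \<in> {0..1}" for p
    using vpos[OF that] by (simp add: magB_def \<Phi>_def)
  have d\<Phi>: "(\<Phi> has_vector_derivative \<Phi>' p) (at p within {0..1})" if p: "p \<in> {0..1}" for p
  proof (rule has_vector_derivative_vec4)
    fix i :: 4
    have q: "((\<lambda>p. v p * B p) has_real_derivative v p * B' p - \<delta> * B p) (at p within {0..1})"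
      using DERIV_mult[OF dv[of p] dB[OF p]] by (rule DERIV_cong) simp
    show "((\<lambda>x. \<Phi> x $ i) has_real_derivative \<Phi>' p $ i) (at p within {0..1})"
      using exhaust_4[of i] q dv[of p] du[OF p] dw[OF p] by (auto simp: \<Phi>_def \<Phi>'_def)
  qed
  have c\<Phi>: "continuous_on {0..1} \<Phi>'" unfolding \<Phi>'_def[abs_def]
    by (intro continuous_on_vector4 continuous_intros cont contB') (use \<mu>0 in auto)
  have eig: "dflux \<beta> \<gamma> (\<Phi> p) (\<Phi>' p) = \<mu> p *\<^sub>R \<Phi>' p" if p: "p \<in> {0..1}" for p
  proof -
    have b: "(\<Phi>' p $ 2 - B p * \<Phi>' p $ 1) / \<Phi> p $ 1 = B' p"
      using vpos[OF p] by (simp add: \<Phi>_def \<Phi>'_def)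
    \<comment> \<open>The induction part of the eigenvector relation,
      \<open>(m v - \<beta>^2) B' = m \<delta> B\<close>, is the factored characteristic equation
      times \<open>\<delta> B / Y\<close>.\<close>
    have e2: "\<beta>\<^sup>2 * B' p = m p * (v p * B' p - \<delta> * B p)"
    proof -
      have "(m p * v p - \<beta>\<^sup>2) * B' p = \<delta> * B p / Y p * ((m p - c p) * (m p * v p - \<beta>\<^sup>2))"
        by (simp add: B'_def)
      also have "\<dots> = m p * \<delta> * B p" unfolding fac[OF p] using Ypos[OF p] by simp
      finally show ?thesis by (simp add: algebra_simps)
    qed
    have 2: "\<beta> * (\<beta> * B' p / \<mu> p) = \<mu> p * (v p * B' p - \<delta> * B p)"
    proof -
      have "\<beta> * (\<beta> * B' p / \<mu> p) = (\<beta>\<^sup>2 * B' p) / \<mu> p" by (simp add: power2_eq_square)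
      also have "\<dots> = (\<mu> p * \<mu> p) * (v p * B' p - \<delta> * B p) / \<mu> p" unfolding e2 \<mu>2[OF p] ..
      also have "\<dots> = \<mu> p * (v p * B' p - \<delta> * B p)" using \<mu>0[OF p] by simp
      finally show ?thesis .
    qed
    have 3: "c p * \<delta> + B p * B' p = \<mu> p * (\<mu> p * \<delta>)"
    proof -
      have "B p * B' p = \<delta> * (m p - c p) * (B p * B p) / Y p" by (simp add: B'_def)
      also have "\<dots> = \<delta> * (m p - c p)" unfolding BY[OF p] using Ypos[OF p] by simp
      finally show ?thesis using \<mu>2[OF p] by (simp add: algebra_simps mult.assoc[symmetric])
    qed
    have d: "dflux \<beta> \<gamma> (\<Phi> p) (\<Phi>' p) = vector [- (\<mu> p * \<delta>), \<beta> * (\<beta> * B' p / \<mu> p), c p * \<delta> + B p * B' p, - \<beta> * B' p]"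
      unfolding dflux_def mag[OF p] b by (simp add: \<Phi>_def \<Phi>'_def c_def sound_sq_at_def)
    show ?thesis unfolding d 2 3 using \<mu>0[OF p] by (simp add: vec4_eq_iff \<Phi>'_def)
  qed
  show thesis
  proof (rule that[of \<Phi> \<Phi>' \<mu> \<mu>'])
    show "simple_wave \<beta> \<gamma> \<Phi> \<Phi>' \<mu> \<mu>'"
      unfolding simple_wave_def using c\<Phi> cont\<mu>' d\<Phi> eig d\<mu> vpos by (simp add: \<Phi>_def)
    show "0 \<le> \<kappa> * \<mu>' p" if p: "p \<in> {0..1}" for p
    proof -
      have "\<kappa> * \<mu>' p = (\<kappa> * \<kappa>) * (inverse (sqrt (m p)) / 2 * m' p)" by (simp add: \<mu>'_def)
      moreover have "0 \<le> inverse (sqrt (m p)) / 2 * m' p" using m'pos[OF p] mpos[OF p] by simp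
      ultimately show ?thesis by (simp only: \<kappa>2 mult_1)
    qed
    show "\<Phi> 0 = W"
      using W by (simp add: vec4_eq_iff \<Phi>_def v01 B0 u_def w_def magB_def)
    show "\<mu> 0 = \<kappa> * sqrt (alpha 1 \<beta> \<gamma> W)"
      by (simp add: \<mu>_def m_def v01 Y0 alpha_fast[OF \<gamma> W(1)])
    show "\<Phi> 1 $ 1 = v1" by (simp add: \<Phi>_def v01)
    have "\<kappa> * u 0 - riemann_u \<gamma> (v 0) \<le> \<kappa> * u 1 - riemann_u \<gamma> (v 1)"
    proof (rule nondecreasing_unit_interval[of "\<lambda>p. \<kappa> * u p - riemann_u \<gamma> (v p)"
          "\<lambda>p. \<delta> * (sqrt (m p) - sqrt \<gamma> * v p powr (- (\<gamma> + 1) / 2))"])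
      fix p :: real assume p: "p \<in> {0..1}"
      show "((\<lambda>p. \<kappa> * u p - riemann_u \<gamma> (v p)) has_real_derivative \<delta> * (sqrt (m p) - sqrt \<gamma> * v p powr (- (\<gamma> + 1) / 2))) (at p within {0..1})"
      proof (rule DERIV_cong)
        show "((\<lambda>p. \<kappa> * u p - riemann_u \<gamma> (v p)) has_real_derivative \<kappa> * (\<mu> p * \<delta>) - (- sqrt \<gamma> * v p powr (- (\<gamma> + 1) / 2)) * (- \<delta>)) (at p within {0..1})"
          by (intro DERIV_diff DERIV_cmult du p DERIV_chain2[OF riemann_u_derivative[OF \<gamma> vpos[OF p]] dv])
        have "\<kappa> * (\<mu> p * \<delta>) = (\<kappa> * \<kappa>) * (sqrt (m p) * \<delta>)" by (simp add: \<mu>_def)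
        then have e: "\<kappa> * (\<mu> p * \<delta>) = sqrt (m p) * \<delta>" by (simp only: \<kappa>2 mult_1)
        show "\<kappa> * (\<mu> p * \<delta>) - (- sqrt \<gamma> * v p powr (- (\<gamma> + 1) / 2)) * (- \<delta>) = \<delta> * (sqrt (m p) - sqrt \<gamma> * v p powr (- (\<gamma> + 1) / 2))"
          unfolding e by (simp add: algebra_simps)
      qed
      have "sqrt \<gamma> * v p powr (- (\<gamma> + 1) / 2) \<le> sqrt (m p)"
        using mc[OF p] unfolding c_def sound_sq_at_sqrt[OF \<gamma> vpos[OF p], symmetric] by (intro real_le_rsqrt) simp
      then show "0 \<le> \<delta> * (sqrt (m p) - sqrt \<gamma> * v p powr (- (\<gamma> + 1) / 2))" using \<delta> by simp
    qed auto
    then show "riemann_u \<gamma> v1 - riemann_u \<gamma> (W$1) \<le> \<kappa> * (\<Phi> 1 $ 3 - W$3)"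
      by (simp add: \<Phi>_def v01 u_def algebra_simps)
    \<comment> \<open>\<open>m \<le> A\<close> means \<open>v (m - c) \<le> y + \<beta>^2\<close>,
      so the growth of \<open>y\<close> cannot outweigh the decrease of \<open>v^2\<close>. This
      bounds \<open>q^2 = y v^2\<close>.\<close>
    have "- ((Y 0 + \<beta>\<^sup>2) * (v 0)\<^sup>2) \<le> - ((Y 1 + \<beta>\<^sup>2) * (v 1)\<^sup>2)"
    proof (rule nondecreasing_unit_interval[of "\<lambda>p. - ((Y p + \<beta>\<^sup>2) * (v p)\<^sup>2)"
          "\<lambda>p. 2 * \<delta> * v p * ((Y p + \<beta>\<^sup>2) - v p * (m p - c p))"])
      fix p :: real assume p: "p \<in> {0..1}"
      show "((\<lambda>p. - ((Y p + \<beta>\<^sup>2) * (v p)\<^sup>2)) has_real_derivative 2 * \<delta> * v p * ((Y p + \<beta>\<^sup>2) - v p * (m p - c p))) (at p within {0..1})"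
        using dY[OF p] dv[of p] by (auto intro!: derivative_eq_intros simp: algebra_simps power2_eq_square)
      have "v p * (m p - c p) \<le> v p * (A p - c p)" using mA[OF p] vpos[OF p] by (intro mult_left_mono) auto
      also have "\<dots> = Y p + \<beta>\<^sup>2" using vpos[OF p] by (simp add: A_def speed_sum_def c_def)
      finally show "0 \<le> 2 * \<delta> * v p * ((Y p + \<beta>\<^sup>2) - v p * (m p - c p))" using \<delta> vpos[OF p] by simp
    qed auto
    then have YK: "(Y 1 + \<beta>\<^sup>2) * v1\<^sup>2 \<le> Kq" by (simp add: Kq_def v01 Y0)
    then have YK': "Y 1 * v1\<^sup>2 \<le> Kq" by (simp add: algebra_simps) (smt (verit) zero_le_mult_iff zero_le_power2)
    then show "(\<Phi> 1 $ 2)\<^sup>2 \<le> Kq"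
      using BY[of 1] by (simp add: \<Phi>_def v01 power2_eq_square mult_ac)
    define k where "k = \<bar>\<beta>\<bar> * sqrt (W$1) / 2"
    \<comment> \<open>Since \<open>B' = B Y' / (2 Y)\<close>, what remains is
      \<open>\<bar>B\<bar> / \<bar>\<mu>\<bar> = sqrt (Y / m)\<close>, at most
      \<open>sqrt (W$1)\<close> by \<open>Y \<le> m v\<close>. The integrand of \<open>w\<close> is
      thus controlled by the derivative of \<open>ln Y\<close>.\<close>
    have wb: "\<bar>- \<beta> * B' p / \<mu> p\<bar> \<le> k * (Y' p / Y p)" if p: "p \<in> {0..1}" for p
    proof -
      have aB: "\<bar>B p\<bar> = sqrt (Y p)" using BY[OF p] by (metis real_sqrt_abs2)
      have a\<mu>: "\<bar>\<mu> p\<bar> = sqrt (m p)" using \<mu>2[OF p] by (metis real_sqrt_abs2)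
      have "Y p \<le> m p * W$1" using mY[OF p] vle[OF p] mpos[OF p] by (smt (verit) mult_left_mono)
      then have "sqrt (Y p) \<le> sqrt (W$1) * sqrt (m p)" by (simp add: real_sqrt_mult[symmetric] mult.commute)
      then have s: "sqrt (Y p) / sqrt (m p) \<le> sqrt (W$1)" using mpos[OF p] by (simp add: pos_divide_le_eq)
      have "\<bar>- \<beta> * B' p / \<mu> p\<bar> = \<bar>\<beta>\<bar> * (\<delta> * (m p - c p) / Y p) * (sqrt (Y p) / sqrt (m p))"
        using mc[OF p] \<delta> Ypos[OF p] by (simp add: B'_def abs_mult abs_divide aB a\<mu>)
      also have "\<dots> \<le> \<bar>\<beta>\<bar> * (\<delta> * (m p - c p) / Y p) * sqrt (W$1)"
        using s mc[OF p] \<delta> Ypos[OF p] by (intro mult_left_mono) auto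
      also have "\<dots> = k * (Y' p / Y p)" by (simp add: k_def Y'_def)
      finally show ?thesis .
    qed
    have dln: "((\<lambda>p. k * ln (Y p)) has_real_derivative k * (Y' p / Y p)) (at p within {0..1})" if p: "p \<in> {0..1}" for p
    proof (rule DERIV_cmult)
      show "((\<lambda>p. ln (Y p)) has_real_derivative Y' p / Y p) (at p within {0..1})"
        using DERIV_chain2[OF DERIV_ln[OF Ypos[OF p]] dY[OF p]] by (rule DERIV_cong) (simp add: Y'_def field_simps)
    qed
    have "k * ln (Y 0) - w 0 \<le> k * ln (Y 1) - w 1"
    proof (rule nondecreasing_unit_interval[of "\<lambda>p. k * ln (Y p) - w p" "\<lambda>p. k * (Y' p / Y p) - (- \<beta> * B' p / \<mu> p)"])
      show "0 \<le> k * (Y' p / Y p) - (- \<beta> * B' p / \<mu> p)" if "p \<in> {0..1}" for p using wb[OF that] by linarith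
    qed (intro DERIV_diff dln dw, auto)
    moreover have "k * ln (Y 0) + w 0 \<le> k * ln (Y 1) + w 1"
    proof (rule nondecreasing_unit_interval[of "\<lambda>p. k * ln (Y p) + w p" "\<lambda>p. k * (Y' p / Y p) + (- \<beta> * B' p / \<mu> p)"])
      show "0 \<le> k * (Y' p / Y p) + (- \<beta> * B' p / \<mu> p)" if "p \<in> {0..1}" for p using wb[OF that] by linarith
    qed (intro DERIV_add dln dw, auto)
    ultimately have "\<bar>w 1 - w 0\<bar> \<le> k * (ln (Y 1) - ln (Y 0))" by (simp add: abs_le_iff algebra_simps)
    also have "\<dots> \<le> k * (ln (Kq / v1\<^sup>2) - ln ((magB W)\<^sup>2))"
    proof (rule mult_left_mono)
      have "Y 1 \<le> Kq / v1\<^sup>2" using YK' v1 by (simp add: pos_le_divide_eq)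
      then have "ln (Y 1) \<le> ln (Kq / v1\<^sup>2)" using Ypos[of 1] by (intro ln_mono) auto
      then show "ln (Y 1) - ln (Y 0) \<le> ln (Kq / v1\<^sup>2) - ln ((magB W)\<^sup>2)" by (simp add: Y0)
      show "0 \<le> k" using W by (simp add: k_def)
    qed
    finally show "\<bar>\<Phi> 1 $ 4 - W$4\<bar> \<le> \<bar>\<beta>\<bar> * sqrt (W$1) / 2 * (ln (Kq / v1\<^sup>2) - ln ((magB W)\<^sup>2))"
      by (simp add: \<Phi>_def w_def k_def)
  qed
qed

section \<open>Failure of contraction\<close>

text \<open>The closed set where \<open>f \<ge> 0\<close> has a least point; a positive value there
  would, by the intermediate value theorem, give an earlier zero.\<close>

lemma first_zero_unit_interval:
  fixes f :: "real \<Rightarrow> real"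
  assumes c: "continuous_on {0..1} f" and f: "f 0 < 0" "0 \<le> f 1"
  obtains P where "0 < P" "P \<le> 1" "f P = 0" "\<And>q. 0 \<le> q \<Longrightarrow> q \<le> P \<Longrightarrow> f q \<le> 0"
proof -
  define Z where "Z = {p \<in> {0..1}. 0 \<le> f p}"
  have Zeq: "Z = {0..1} \<inter> f -` {0..}" by (auto simp: Z_def)
  have "closed Z" unfolding Zeq by (rule continuous_closed_preimage[OF c]) auto
  then have "compact Z" unfolding compact_eq_bounded_closed by (auto simp: Z_def intro: bounded_subset[of "{0..1}"])
  moreover have "1 \<in> Z" using f by (simp add: Z_def)
  ultimately obtain P where P: "P \<in> Z" "\<And>q. q \<in> Z \<Longrightarrow> P \<le> q"
    using compact_attains_inf[of Z] by auto
  have P01: "0 \<le> P" "P \<le> 1" "0 \<le> f P" using P(1) by (auto simp: Z_def)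
  have "\<exists>x\<ge>0. x \<le> P \<and> f x = 0"
    using P01 f by (intro IVT') (auto intro: continuous_on_subset[OF c])
  then obtain x where x: "0 \<le> x" "x \<le> P" "f x = 0" by blast
  then have "P \<le> x" using P01 by (intro P(2)) (auto simp: Z_def)
  then have fP: "f P = 0" using x by simp
  have "0 < P" using P01 fP f by (cases "P = 0") auto
  moreover have "f q \<le> 0" if "0 \<le> q" "q \<le> P" for q
  proof (cases "q = P")
    case False
    then have "q \<notin> Z" using P(2)[of q] that by auto
    then show ?thesis using that P01 by (auto simp: Z_def)
  qed (simp add: fP)
  ultimately show ?thesis using that P01 fP by blast
qed

text \<open>Serves to stop a curve at parameter \<open>P\<close> and stretch the arc back to
  \<open>[0, 1]\<close>. The clamp freezes it outside, which supplies the continuity on the whole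
  line that \<open>bump\<close> demands.\<close>

lemma clamp_scale_continuous:
  fixes f :: "real \<Rightarrow> 'c::topological_space"
  assumes "0 < P" "P \<le> 1" "continuous_on {0..1} f"
  shows "continuous_on S (\<lambda>q. f (P * max 0 (min 1 q)))"
  by (rule continuous_on_compose2[OF assms(3)]) (use assms in \<open>auto intro!: continuous_intros mult_le_one\<close>)

lemma clamp_scale_chain:
  fixes f f' :: "real \<Rightarrow> 'c::real_normed_vector"
  assumes P: "0 < P" "P \<le> 1" and q: "q \<in> {0..1}"
    and f: "\<And>p. p \<in> {0..1} \<Longrightarrow> (f has_vector_derivative f' p) (at p within {0..1})"
  shows "((\<lambda>q. f (P * max 0 (min 1 q))) has_vector_derivative P *\<^sub>R f' (P * max 0 (min 1 q))) (at q within {0..1})"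
proof -
  have e01: "max 0 (min 1 q) = q" if "q \<in> {0..1}" for q :: real using that by auto
  have sub: "(\<lambda>q. P * q) ` {0..1} \<subseteq> {0..1}" using P by (auto intro: mult_le_one)
  have Pq: "P * q \<in> {0..1}" using sub q by blast
  have "((f \<circ> (\<lambda>q. P * q)) has_vector_derivative P *\<^sub>R f' (P * q)) (at q within {0..1})"
  proof (rule vector_diff_chain_within)
    show "((\<lambda>q. P * q) has_vector_derivative P) (at q within {0..1})"
      by (auto intro!: derivative_eq_intros simp: has_real_derivative_iff_has_vector_derivative[symmetric])
    show "(f has_vector_derivative f' (P * q)) (at (P * q) within (\<lambda>q. P * q) ` {0..1})"
      by (rule has_vector_derivative_within_subset[OF f[OF Pq] sub])
  qed
  then show ?thesis unfolding e01[OF q]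
    by (rule has_vector_derivative_transform_within[OF _ zero_less_one q]) (simp add: e01)
qed

text \<open>
  The sign \<open>s\<close> is \<open>1\<close> for a curve from \<open>Ul\<close>, where \<open>G < 0\<close>, and \<open>-1\<close> for a curve from \<open>Ur\<close>, where \<open>G > 0\<close>;
  \<open>s \<mu>' \<le> 0\<close> makes \<open>\<mu>' G \<ge> 0\<close> up to the first zero of \<open>G\<close>.
\<close>
lemma curve_not_a_contraction:
  fixes \<beta> \<gamma> a \<sigma> s :: real and Ul Ur W :: "real^4" and \<Phi> \<Phi>' :: "real \<Rightarrow> real^4" and \<mu> \<mu>' :: "real \<Rightarrow> real"
  defines "G \<equiv> \<lambda>p. rel_ent \<gamma> (\<Phi> p) Ul - a * rel_ent \<gamma> (\<Phi> p) Ur"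
  assumes \<gamma>: "1 < \<gamma>" and Q: "is_entropy_flux \<beta> \<gamma> Q" and a: "0 < a"
    and Ul: "0 < Ul$1" and Ur: "0 < Ur$1"
    and rh: "flux \<beta> \<gamma> W - flux \<beta> \<gamma> Ul = \<sigma> *\<^sub>R (W - Ul)" "flux \<beta> \<gamma> Ur - flux \<beta> \<gamma> W = \<sigma> *\<^sub>R (Ur - W)"
    and dissip: "Q W - Q Ul \<le> \<sigma> * (ent \<gamma> W - ent \<gamma> Ul)" "Q Ur - Q W \<le> \<sigma> * (ent \<gamma> Ur - ent \<gamma> W)"
    and \<Phi>0: "\<Phi> 0 = W"
    and wave: "simple_wave \<beta> \<gamma> \<Phi> \<Phi>' \<mu> \<mu>'"
    and s: "s = 1 \<or> s = -1" and s\<mu>: "\<And>p. p \<in> {0..1} \<Longrightarrow> s * \<mu>' p \<le> 0"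
    and G0: "s * G 0 < 0" and G1: "0 \<le> s * G 1" and \<sigma>G: "(\<sigma> - \<mu> 0) * G 0 < 0"
  shows "\<not> a_contraction \<beta> \<gamma> Q a Ul Ur \<sigma>"
proof -
  have pos: "\<And>p. p \<in> {0..1} \<Longrightarrow> 0 < \<Phi> p $ 1"
    and d\<Phi>: "\<And>p. p \<in> {0..1} \<Longrightarrow> (\<Phi> has_vector_derivative \<Phi>' p) (at p within {0..1})"
    and c\<Phi>': "continuous_on {0..1} \<Phi>'" and c\<mu>': "continuous_on {0..1} \<mu>'"
    and eig: "\<And>p. p \<in> {0..1} \<Longrightarrow> dflux \<beta> \<gamma> (\<Phi> p) (\<Phi>' p) = \<mu> p *\<^sub>R \<Phi>' p"
    and d\<mu>: "\<And>p. p \<in> {0..1} \<Longrightarrow> (\<mu> has_real_derivative \<mu>' p) (at p within {0..1})"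
    using wave by (auto simp: simple_wave_def)
  define g where "g = G"
  define g' where "g' p = (dent \<gamma> (\<Phi> p) (\<Phi>' p) - dent \<gamma> Ul (\<Phi>' p)) - a * (dent \<gamma> (\<Phi> p) (\<Phi>' p) - dent \<gamma> Ur (\<Phi>' p))" for p
  have along: "((\<lambda>p. e (\<Phi> p)) has_real_derivative e' (\<Phi>' p)) (at p within {0..1})"
    if "p \<in> {0..1}" "(e has_derivative e') (at (\<Phi> p))" for e :: "real^4 \<Rightarrow> real" and e' p
    using has_vector_derivative_along[OF d\<Phi>[OF that(1)] that(2)]
    by (simp add: has_real_derivative_iff_has_vector_derivative)
  have dg: "(g has_real_derivative g' p) (at p within {0..1})" if p: "p \<in> {0..1}" for p
    unfolding g_def G_def g'_def
    by (intro DERIV_diff DERIV_cmult along[OF p] rel_ent_has_derivative \<gamma> pos p Ul Ur)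
  have cg: "continuous_on {0..1} g" by (rule DERIV_continuous_on[OF dg])
  have c\<Phi>: "continuous_on {0..1} \<Phi>"
    using d\<Phi> by (intro continuous_on_vector_derivative) auto
  have c\<mu>: "continuous_on {0..1} \<mu>" by (rule DERIV_continuous_on[OF d\<mu>])
  have "continuous_on {0..1} (\<lambda>p. s * g p)" using cg by (intro continuous_intros)
  then obtain P where P: "0 < P" "P \<le> 1" "s * g P = 0" "\<And>q. 0 \<le> q \<Longrightarrow> q \<le> P \<Longrightarrow> s * g q \<le> 0"
    using first_zero_unit_interval[of "\<lambda>p. s * g p"] G0 G1 unfolding g_def by metis
  have gP: "g P = 0" using P(3) s by auto
  define e where "e q = P * max 0 (min 1 q)" for q :: real
  have e: "e q \<in> {0..1}" "0 \<le> e q" "e q \<le> P" for q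
  proof -
    show *: "0 \<le> e q" "e q \<le> P" using P(1) by (auto simp: e_def intro: mult_left_le)
    then show "e q \<in> {0..1}" using P(2) by auto
  qed
  have e01: "e q = P * q" if "q \<in> {0..1}" for q using that by (auto simp: e_def)
  have ce: "continuous_on S e" for S unfolding e_def[abs_def] by (intro continuous_intros)
  note comp = clamp_scale_continuous[OF P(1,2), folded e_def]
  note chain = clamp_scale_chain[OF P(1,2), folded e_def]
  note chain_real = clamp_scale_chain[where 'c = real, OF P(1,2), folded e_def has_real_derivative_iff_has_vector_derivative]
  obtain M where M: "0 \<le> M" "\<And>p. p \<in> {0..1} \<Longrightarrow> \<bar>\<mu>' p\<bar> \<le> M"
  proof -
    have "bounded (\<mu>' ` {0..1})" using c\<mu>' by (intro compact_imp_bounded compact_continuous_image) auto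
    then obtain M where "0 < M" "\<And>p. p \<in> {0..1} \<Longrightarrow> norm (\<mu>' p) \<le> M" by (auto simp: bounded_pos)
    then show ?thesis using that[of M] by auto
  qed
  have lip: "M-lipschitz_on {0..1} \<mu>"
    by (rule bounded_derivative_imp_lipschitz[where f' = "\<lambda>p. (*) (\<mu>' p)"])
       (use d\<mu> M in \<open>auto simp: has_field_derivative_def intro!: onorm_bound mult_right_mono simp: abs_mult\<close>)
  have lip': "M-lipschitz_on {0..1} (\<lambda>q. \<mu> (e q))"
  proof (rule lipschitz_onI)
    fix x y :: real assume xy: "x \<in> {0..1}" "y \<in> {0..1}"
    have "dist (\<mu> (e x)) (\<mu> (e y)) \<le> M * dist (e x) (e y)" by (rule lipschitz_onD[OF lip e(1) e(1)])
    also have "dist (e x) (e y) = P * dist x y"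
      unfolding e01[OF xy(1)] e01[OF xy(2)] dist_real_def right_diff_distrib[symmetric] abs_mult using P(1) by simp
    also have "M * (P * dist x y) \<le> M * (1 * dist x y)" using P M by (intro mult_left_mono mult_right_mono) auto
    finally show "dist (\<mu> (e x)) (\<mu> (e y)) \<le> M * dist x y" by simp
  qed (rule M)
  have lin: "dent \<gamma> V (P *\<^sub>R d) = P * dent \<gamma> V d" for V d by (simp add: dent_def algebra_simps)
  have growth: "0 < (LBINT q:{0..1}. (\<sigma> - \<mu> (e q)) * (P * g' (e q)))"
  proof -
    \<comment> \<open>\<open>H'\<close> differs from the growth integrand by the term with
      \<open>\<mu>' g\<close>, whose sign is favourable up to \<open>P\<close>. At the right end
      \<open>H\<close> vanishes because \<open>g P = 0\<close>.\<close>
    define H where "H q = (\<sigma> - \<mu> (e q)) * g (e q)" for q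
    define H' where "H' q = (\<sigma> - \<mu> (e q)) * (P * g' (e q)) - (P * \<mu>' (e q)) * g (e q)" for q
    have cg': "continuous_on {0..1} g'"
      unfolding g'_def[abs_def] dent_def pres_def magB_def
      by (intro continuous_intros c\<Phi> c\<Phi>') (use pos in \<open>auto simp: less_le\<close>)
    have dH: "(H has_vector_derivative H' q) (at q within {0..1})" if q: "q \<in> {0..1}" for q
    proof -
      have "(H has_real_derivative (0 - P *\<^sub>R \<mu>' (e q)) * g (e q) + (P *\<^sub>R g' (e q)) * (\<sigma> - \<mu> (e q))) (at q within {0..1})"
        unfolding H_def[abs_def]
        by (rule DERIV_mult[OF DERIV_diff[OF DERIV_const chain_real[OF q d\<mu>]] chain_real[OF q dg]])
      then show ?thesis unfolding has_real_derivative_iff_has_vector_derivative[symmetric]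
        by (rule DERIV_cong) (simp add: H'_def algebra_simps)
    qed
    have cH: "continuous_on {0..1} H'"
      unfolding H'_def[abs_def] by (intro continuous_intros comp c\<mu> cg' c\<mu>' cg)
    have "(LBINT q. indicator {0..1} q *\<^sub>R H' q) = H 1 - H 0"
      by (rule integral_FTC_Icc[OF _ dH cH]) auto
    moreover have "H 1 - H 0 > 0"
      using \<sigma>G gP by (simp add: H_def e_def g_def)
    moreover have "(LBINT q. indicator {0..1} q *\<^sub>R H' q) \<le> (LBINT q:{0..1}. (\<sigma> - \<mu> (e q)) * (P * g' (e q)))"
      unfolding set_lebesgue_integral_def
    proof (rule integral_mono)
      show "integrable lborel (\<lambda>q. indicator {0..1} q *\<^sub>R H' q)"
        using cH by (intro borel_integrable_compact) auto
      show "integrable lborel (\<lambda>q. indicator {0..1} q *\<^sub>R ((\<sigma> - \<mu> (e q)) * (P * g' (e q))))"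
        by (intro borel_integrable_compact continuous_intros comp c\<mu> cg') auto
      fix q :: real
      have "0 \<le> (s * \<mu>' (e q)) * (s * g (e q))"
        using s\<mu>[OF e(1)] P(4)[OF e(2,3)] by (intro mult_nonpos_nonpos) auto
      also have "\<dots> = \<mu>' (e q) * g (e q)" using s by auto
      finally have "0 \<le> (P * \<mu>' (e q)) * g (e q)" using P(1) by (simp add: mult.assoc)
      then show "indicator {0..1} q *\<^sub>R H' q \<le> indicator {0..1} q *\<^sub>R ((\<sigma> - \<mu> (e q)) * (P * g' (e q)))"
        by (auto simp: indicator_def H'_def)
    qed
    ultimately show ?thesis by linarith
  qed
  interpret bump \<beta> \<gamma> Q a Ul Ur W \<sigma> "\<lambda>q. \<Phi> (e q)" "\<lambda>q. P *\<^sub>R \<Phi>' (e q)" "\<lambda>q. \<mu> (e q)" M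
  proof unfold_locales
    show "0 < \<Phi> (e p) $ 1" for p using pos e by blast
    show "continuous_on UNIV (\<lambda>q. \<Phi> (e q))" "continuous_on UNIV (\<lambda>q. P *\<^sub>R \<Phi>' (e q))" "continuous_on UNIV (\<lambda>q. \<mu> (e q))"
      by (intro continuous_intros comp c\<Phi> c\<Phi>' c\<mu>)+
    show "((\<lambda>q. \<Phi> (e q)) has_vector_derivative P *\<^sub>R \<Phi>' (e p)) (at p within {0..1})" if "p \<in> {0..1}" for p
      by (rule chain[OF that d\<Phi>])
    show "dflux \<beta> \<gamma> (\<Phi> (e p)) (P *\<^sub>R \<Phi>' (e p)) = \<mu> (e p) *\<^sub>R P *\<^sub>R \<Phi>' (e p)" if "p \<in> {0..1}" for p
    proof -
      have "dflux \<beta> \<gamma> (\<Phi> (e p)) (P *\<^sub>R \<Phi>' (e p)) = P *\<^sub>R dflux \<beta> \<gamma> (\<Phi> (e p)) (\<Phi>' (e p))"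
        by (rule linear_scale[OF has_derivative_linear[OF flux_has_derivative[OF pos[OF e(1)]]]])
      then show ?thesis by (simp add: eig[OF e(1)] mult.commute)
    qed
    show "\<Phi> (e 0) = W" by (simp add: e_def \<Phi>0)
    show "rel_ent \<gamma> (\<Phi> (e 1)) Ul = a * rel_ent \<gamma> (\<Phi> (e 1)) Ur" using gP by (simp add: e_def g_def G_def)
    show "0 < (LBINT p:{0..1}. (\<sigma> - \<mu> (e p)) * (dent \<gamma> (\<Phi> (e p)) (P *\<^sub>R \<Phi>' (e p)) - dent \<gamma> Ul (P *\<^sub>R \<Phi>' (e p))
                   - a * (dent \<gamma> (\<Phi> (e p)) (P *\<^sub>R \<Phi>' (e p)) - dent \<gamma> Ur (P *\<^sub>R \<Phi>' (e p)))))"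
    proof -
      have "dent \<gamma> (\<Phi> (e p)) (P *\<^sub>R \<Phi>' (e p)) - dent \<gamma> Ul (P *\<^sub>R \<Phi>' (e p))
                   - a * (dent \<gamma> (\<Phi> (e p)) (P *\<^sub>R \<Phi>' (e p)) - dent \<gamma> Ur (P *\<^sub>R \<Phi>' (e p))) = P * g' (e p)" for p
        unfolding lin g'_def by (simp add: algebra_simps)
      then show ?thesis using growth by simp
    qed
  qed (use \<gamma> Q a Ul Ur rh dissip lip' in auto)
  show ?thesis by (rule not_a_contraction)
qed

section \<open>Growth of the weighted relative entropy difference\<close>

lemma quad_gap:
  fixes a d x :: real
  assumes "0 < a" "a < 1"
  shows "(1 - a) / 2 * x\<^sup>2 - (2 * a\<^sup>2 * d\<^sup>2 / (1 - a) + a * d\<^sup>2) \<le> x\<^sup>2 - a * (x + d)\<^sup>2"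
proof -
  define b where "b = 1 - a"
  \<comment> \<open>From completing the square: half of the leading coefficient of
    \<open>b x^2 - 2 a d x\<close> is kept, and the rest of the expression has its minimum at
    \<open>k\<close>.\<close>
  define k where "k = 2 * a * d / b"
  have b: "0 < b" using assms by (simp add: b_def)
  have bk: "b * k = 2 * a * d" using b by (simp add: k_def)
  have kk: "2 * a\<^sup>2 * d\<^sup>2 / b = b * k * k / 2" unfolding bk using b by (simp add: k_def power2_eq_square)
  have "x\<^sup>2 - a * (x + d)\<^sup>2 = b * x\<^sup>2 - b * k * x - a * d\<^sup>2"
    unfolding bk by (simp add: b_def power2_eq_square algebra_simps)
  then have "x\<^sup>2 - a * (x + d)\<^sup>2 - (b / 2 * x\<^sup>2 - (2 * a\<^sup>2 * d\<^sup>2 / b + a * d\<^sup>2)) = b / 2 * (x - k)\<^sup>2"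
    unfolding kk by (simp add: power2_eq_square field_simps)
  moreover have "0 \<le> b / 2 * (x - k)\<^sup>2" using b by simp
  ultimately show ?thesis unfolding b_def by linarith
qed

text \<open>For \<open>a \<le> 1\<close> the only term that can blow up as \<open>v\<close> tends to
  0 is \<open>(1 - a) v powr (1 - \<gamma>) / (\<gamma> - 1)\<close>, which has the good sign. The
  others are bounded on \<open>0 < v \<le> P\<close>.\<close>

lemma rel_internal_gap:
  assumes "1 < \<gamma>" "0 < a" "a \<le> 1" "0 < P" "0 < R" "0 < v" "v \<le> P"
  shows "- (P powr (1 - \<gamma>) / (\<gamma> - 1) + P powr (- \<gamma>) * P + a * (R powr (- \<gamma>) * P)) \<le> rel_internal \<gamma> v P - a * rel_internal \<gamma> v R"
proof -
  have 1: "0 \<le> (1 - a) * (v powr (1 - \<gamma>) / (\<gamma> - 1))" "0 \<le> a * (R powr (1 - \<gamma>) / (\<gamma> - 1))"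
    "0 \<le> P powr (- \<gamma>) * v" "0 \<le> a * (R powr (- \<gamma>) * R)" using assms by simp_all
  have 2: "a * (R powr (- \<gamma>) * v) \<le> a * (R powr (- \<gamma>) * P)" using assms by (intro mult_left_mono) auto
  have "rel_internal \<gamma> v P - a * rel_internal \<gamma> v R = (1 - a) * (v powr (1 - \<gamma>) / (\<gamma> - 1)) - P powr (1 - \<gamma>) / (\<gamma> - 1)
     + a * (R powr (1 - \<gamma>) / (\<gamma> - 1)) + P powr (- \<gamma>) * v - P powr (- \<gamma>) * P - a * (R powr (- \<gamma>) * v) + a * (R powr (- \<gamma>) * R)"
    unfolding rel_internal_def by (simp add: algebra_simps diff_divide_distrib)
  then show ?thesis using 1 2 by linarith
qed

text \<open>\<open>quad_gap\<close> is applied to \<open>u\<close>, \<open>w\<close> and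
  \<open>B\<close>. Only \<open>u\<close> keeps its square, and the 1/2 of the kinetic energy gives
  the coefficient \<open>(1 - a) / 4\<close>. The field part carries the factor \<open>v\<close>, at
  most \<open>P$1\<close>.\<close>

lemma rel_ent_gap:
  assumes \<gamma>: "1 < \<gamma>" and a: "0 < a" "a < 1" and P: "0 < P$1" and R: "0 < R$1"
  shows "\<exists>C. \<forall>V. 0 < V$1 \<and> V$1 \<le> P$1 \<longrightarrow> (1 - a) / 4 * (V$3 - P$3)\<^sup>2 - C \<le> rel_ent \<gamma> V P - a * rel_ent \<gamma> V R"
proof -
  define q where "q d = 2 * a\<^sup>2 * d\<^sup>2 / (1 - a) + a * d\<^sup>2" for d
  define C0 where "C0 = P$1 powr (1 - \<gamma>) / (\<gamma> - 1) + P$1 powr (- \<gamma>) * P$1 + a * (R$1 powr (- \<gamma>) * P$1)"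
  have q0: "0 \<le> q d" for d using a by (simp add: q_def)
  have "(1 - a) / 4 * (V$3 - P$3)\<^sup>2 - (C0 + q (P$3 - R$3) / 2 + q (P$4 - R$4) / 2 + P$1 * q (magB P - magB R) / 2) \<le> rel_ent \<gamma> V P - a * rel_ent \<gamma> V R"
    if V: "0 < V$1" "V$1 \<le> P$1" for V
  proof -
    let ?x = "V$3 - P$3" and ?y = "V$4 - P$4" and ?b = "magB V - magB P"
    have 3: "(1 - a) / 2 * ?x\<^sup>2 - q (P$3 - R$3) \<le> ?x\<^sup>2 - a * (V$3 - R$3)\<^sup>2"
      using quad_gap[OF a, of ?x "P$3 - R$3"] by (simp add: q_def)
    have "0 \<le> (1 - a) / 2 * ?y\<^sup>2" using a by simp
    then have 4: "- q (P$4 - R$4) \<le> ?y\<^sup>2 - a * (V$4 - R$4)\<^sup>2"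
      using quad_gap[OF a, of ?y "P$4 - R$4"] by (simp add: q_def)
    have "0 \<le> (1 - a) / 2 * ?b\<^sup>2" using a by simp
    then have "- q (magB P - magB R) \<le> ?b\<^sup>2 - a * (magB V - magB R)\<^sup>2"
      using quad_gap[OF a, of ?b "magB P - magB R"] by (simp add: q_def)
    then have "V$1 * - q (magB P - magB R) \<le> V$1 * (?b\<^sup>2 - a * (magB V - magB R)\<^sup>2)"
      using V by (intro mult_left_mono) auto
    moreover have "V$1 * q (magB P - magB R) \<le> P$1 * q (magB P - magB R)"
      using V q0 by (intro mult_right_mono) auto
    ultimately have 2: "- (P$1 * q (magB P - magB R)) \<le> V$1 * ?b\<^sup>2 - a * (V$1 * (magB V - magB R)\<^sup>2)"
      by (simp add: algebra_simps)
    have 1: "- C0 \<le> rel_internal \<gamma> (V$1) (P$1) - a * rel_internal \<gamma> (V$1) (R$1)"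
      unfolding C0_def by (rule rel_internal_gap) (use \<gamma> a P R V in auto)
    have "rel_ent \<gamma> V P - a * rel_ent \<gamma> V R = (rel_internal \<gamma> (V$1) (P$1) - a * rel_internal \<gamma> (V$1) (R$1))
       + (?x\<^sup>2 - a * (V$3 - R$3)\<^sup>2) / 2 + (?y\<^sup>2 - a * (V$4 - R$4)\<^sup>2) / 2 + (V$1 * ?b\<^sup>2 - a * (V$1 * (magB V - magB R)\<^sup>2)) / 2"
      unfolding rel_ent_eq[OF \<gamma> V(1) P] rel_ent_eq[OF \<gamma> V(1) R] by (simp add: field_simps)
    then show ?thesis using 1 2 3 4 by (simp add: field_simps)
  qed
  then show ?thesis by blast
qed

text \<open>At equal weights the quadratic parts in \<open>V\<close> cancel. Besides bounded terms
  in \<open>v\<close>, what is left is linear in \<open>u\<close>, \<open>w\<close> and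
  \<open>q\<close>, with differences of entropy variables as coefficients. The \<open>u\<close> term
  is kept exactly, the other two are estimated by their size.\<close>

lemma rel_ent_gap_unit:
  assumes \<gamma>: "1 < \<gamma>" and P: "0 < P$1" and R: "0 < R$1"
  shows "\<exists>C. \<forall>V. 0 < V$1 \<and> V$1 \<le> P$1 \<longrightarrow>
    (P$3 - R$3) * (P$3 - V$3) - \<bar>P$4 - R$4\<bar> * \<bar>V$4 - P$4\<bar> - \<bar>magB P - magB R\<bar> * \<bar>V$2\<bar> - C \<le> rel_ent \<gamma> V P - rel_ent \<gamma> V R"
proof -
  define C0 where "C0 = P$1 powr (1 - \<gamma>) / (\<gamma> - 1) + P$1 powr (- \<gamma>) * P$1 + R$1 powr (- \<gamma>) * P$1"
  define C where "C = C0 + (P$3 - R$3)\<^sup>2 / 2 + (P$4 - R$4)\<^sup>2 / 2 + P$1 * \<bar>(magB P)\<^sup>2 - (magB R)\<^sup>2\<bar> / 2"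
  have "(P$3 - R$3) * (P$3 - V$3) - \<bar>P$4 - R$4\<bar> * \<bar>V$4 - P$4\<bar> - \<bar>magB P - magB R\<bar> * \<bar>V$2\<bar> - C \<le> rel_ent \<gamma> V P - rel_ent \<gamma> V R"
    if V: "0 < V$1" "V$1 \<le> P$1" for V
  proof -
    have 1: "- C0 \<le> rel_internal \<gamma> (V$1) (P$1) - rel_internal \<gamma> (V$1) (R$1)"
      using rel_internal_gap[OF \<gamma>, of 1 "P$1" "R$1" "V$1"] P R V by (simp add: C0_def)
    have 3: "((V$3 - P$3)\<^sup>2 - (V$3 - R$3)\<^sup>2) / 2 = (P$3 - R$3) * (P$3 - V$3) - (P$3 - R$3)\<^sup>2 / 2"
      by (simp add: power2_eq_square field_simps)
    have "((V$4 - P$4)\<^sup>2 - (V$4 - R$4)\<^sup>2) / 2 = - ((P$4 - R$4) * (V$4 - P$4)) - (P$4 - R$4)\<^sup>2 / 2"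
      by (simp add: power2_eq_square field_simps)
    moreover have "(P$4 - R$4) * (V$4 - P$4) \<le> \<bar>P$4 - R$4\<bar> * \<bar>V$4 - P$4\<bar>" unfolding abs_mult[symmetric] by (rule abs_ge_self)
    ultimately have 4: "- (\<bar>P$4 - R$4\<bar> * \<bar>V$4 - P$4\<bar>) - (P$4 - R$4)\<^sup>2 / 2 \<le> ((V$4 - P$4)\<^sup>2 - (V$4 - R$4)\<^sup>2) / 2"
      by linarith
    have q: "V$1 * magB V = V$2" using V by (simp add: magB_def)
    have "(V$1 * (magB V - magB P)\<^sup>2 - V$1 * (magB V - magB R)\<^sup>2) / 2 = - ((magB P - magB R) * (V$1 * magB V)) + V$1 * ((magB P)\<^sup>2 - (magB R)\<^sup>2) / 2"
      by (simp add: power2_eq_square field_simps)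
    moreover have "(magB P - magB R) * (V$2) \<le> \<bar>magB P - magB R\<bar> * \<bar>V$2\<bar>" unfolding abs_mult[symmetric] by (rule abs_ge_self)
    moreover have "- (P$1 * \<bar>(magB P)\<^sup>2 - (magB R)\<^sup>2\<bar>) \<le> V$1 * ((magB P)\<^sup>2 - (magB R)\<^sup>2)"
    proof -
      have "\<bar>V$1 * ((magB P)\<^sup>2 - (magB R)\<^sup>2)\<bar> \<le> P$1 * \<bar>(magB P)\<^sup>2 - (magB R)\<^sup>2\<bar>"
        unfolding abs_mult using V by (intro mult_right_mono) auto
      then show ?thesis by (simp add: abs_le_iff)
    qed
    ultimately have 2: "- (\<bar>magB P - magB R\<bar> * \<bar>V$2\<bar>) - P$1 * \<bar>(magB P)\<^sup>2 - (magB R)\<^sup>2\<bar> / 2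
        \<le> (V$1 * (magB V - magB P)\<^sup>2 - V$1 * (magB V - magB R)\<^sup>2) / 2"
      unfolding q by linarith
    have "rel_ent \<gamma> V P - rel_ent \<gamma> V R = (rel_internal \<gamma> (V$1) (P$1) - rel_internal \<gamma> (V$1) (R$1))
       + ((V$3 - P$3)\<^sup>2 - (V$3 - R$3)\<^sup>2) / 2 + ((V$4 - P$4)\<^sup>2 - (V$4 - R$4)\<^sup>2) / 2
       + (V$1 * (magB V - magB P)\<^sup>2 - V$1 * (magB V - magB R)\<^sup>2) / 2"
      unfolding rel_ent_eq[OF \<gamma> V(1) P] rel_ent_eq[OF \<gamma> V(1) R] by (simp add: field_simps)
    then show ?thesis using 1 2 3 4 unfolding C_def by linarith
  qed
  then show ?thesis by blast
qed

text \<open>\<open>riemann_u\<close> blows up like \<open>v\<close> to the power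
  \<open>- (\<gamma> - 1) / 2\<close>, which beats any multiple of \<open>ln v\<close>. With
  \<open>b = 0\<close> this is mere unboundedness, the form used for
  \<open>a \<noteq> 1\<close>.\<close>

lemma riemann_u_dominates_log:
  assumes "1 < \<gamma>" "0 < d" "0 < vW"
  shows "\<exists>v1. 0 < v1 \<and> v1 < vW \<and> C + b * ln v1 < d * riemann_u \<gamma> v1"
proof -
  define e where "e = (\<gamma> - 1) / 2"
  define k where "k = d * (2 * sqrt \<gamma> / (\<gamma> - 1))"
  have e: "0 < e" and k: "0 < k" using assms by (auto simp: e_def k_def)
  have "eventually (\<lambda>v. C + b * ln v < k * v powr (- e)) (at_right 0)"
    using e k by real_asymp
  moreover have "eventually (\<lambda>v. 0 < v \<and> v < vW) (at_right 0)"
    using assms(3) eventually_at_right_real[of 0 vW] by (auto elim: eventually_mono)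
  ultimately have "eventually (\<lambda>v. 0 < v \<and> v < vW \<and> C + b * ln v < k * v powr (- e)) (at_right 0)"
    by eventually_elim auto
  then obtain v1 where "0 < v1" "v1 < vW" "C + b * ln v1 < k * v1 powr (- e)"
    using eventually_happens'[of "at_right (0::real)"] by auto
  moreover have "k * v1 powr (- e) = d * riemann_u \<gamma> v1" 
  proof -
    have "- e = - (\<gamma> - 1) / 2" unfolding e_def by (rule minus_divide_left)
    then show ?thesis unfolding riemann_u_def k_def by (simp only: mult.assoc)
  qed
  ultimately show ?thesis by auto
qed

section \<open>Slow shocks: position of the speed and sign of the velocity jump\<close>

lemma slow_speed_bound:
  assumes "1 < \<gamma>" "\<beta> \<noteq> 0" "0 < U$1" "magB U \<noteq> 0"
  shows "0 < alpha (-1) \<beta> \<gamma> U" "\<bar>\<sigma>\<bar> < sqrt (alpha (-1) \<beta> \<gamma> U) \<Longrightarrow> \<sigma>\<^sup>2 * U$1 < \<beta>\<^sup>2"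
proof -
  let ?v = "U$1" and ?y = "(magB U)\<^sup>2"
  have y: "0 < ?y" using assms by simp
  note f = speed_gap_sq[OF assms(1,3) y, of \<beta>] fast_sq_gt(1)[OF assms(1,3) y, of \<beta>] fast_sq_pos[OF assms(1,3) y, of \<beta>]
  \<comment> \<open>The product of the two squared speeds is \<open>\<beta>^2 c / v\<close>, and the
    fast one exceeds \<open>c\<close>, so the slow one lies below
    \<open>\<beta>^2 / v\<close>.\<close>
  have "4 * (alpha (-1) \<beta> \<gamma> U * fast_sq \<beta> \<gamma> ?v ?y) = (speed_sum \<beta> \<gamma> ?v ?y)\<^sup>2 - (speed_gap \<beta> \<gamma> ?v ?y)\<^sup>2"
    unfolding alpha_slow[OF assms(1,3)] fast_sq_def by (simp add: power2_eq_square field_simps)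
  then have "alpha (-1) \<beta> \<gamma> U * fast_sq \<beta> \<gamma> ?v ?y = \<beta>\<^sup>2 * sound_sq_at \<gamma> ?v / ?v" unfolding f(1) by simp
  note e = this
  moreover have "0 < \<beta>\<^sup>2 * sound_sq_at \<gamma> ?v / ?v" using assms sound_sq_at_pos[OF assms(1,3)] by simp
  ultimately show "0 < alpha (-1) \<beta> \<gamma> U" using f(3) zero_less_mult_pos2 by metis
  have "alpha (-1) \<beta> \<gamma> U * ?v * fast_sq \<beta> \<gamma> ?v ?y = \<beta>\<^sup>2 * sound_sq_at \<gamma> ?v" using assms(3) e by (simp add: field_simps)
  also have "\<dots> < \<beta>\<^sup>2 * fast_sq \<beta> \<gamma> ?v ?y" using f(2) assms(2) by simp
  finally have le: "alpha (-1) \<beta> \<gamma> U * ?v < \<beta>\<^sup>2" using f(3) by simp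
  assume "\<bar>\<sigma>\<bar> < sqrt (alpha (-1) \<beta> \<gamma> U)"
  then have "\<sigma>\<^sup>2 < alpha (-1) \<beta> \<gamma> U" by (metis real_sqrt_abs real_sqrt_less_iff)
  then have "\<sigma>\<^sup>2 * ?v < alpha (-1) \<beta> \<gamma> U * ?v" using assms(3) by simp
  then show "\<sigma>\<^sup>2 * ?v < \<beta>\<^sup>2" using le by linarith
qed

text \<open>Were \<open>vr \<ge> vl\<close>, the drop of \<open>v B\<close> would be at most
  \<open>vr\<close> times the drop of \<open>B\<close>, and with
  \<open>\<sigma>^2 vr < \<beta>^2\<close> the jump relation could not balance. The argument is for
  positive fields; negating both gives the other case.\<close>

lemma volume_drops_if_field_drops:
  fixes vl vr Bl Br \<sigma> \<beta> :: real
  assumes jump: "\<beta>\<^sup>2 * (Br - Bl) = \<sigma>\<^sup>2 * (vr * Br - vl * Bl)" and slow: "\<sigma>\<^sup>2 * vr < \<beta>\<^sup>2"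
    and B: "(0 < Br \<and> Br < Bl) \<or> (Bl < Br \<and> Br < 0)"
  shows "vr < vl"
proof -
  have *: "vr < vl" if j: "\<beta>\<^sup>2 * (y - x) = \<sigma>\<^sup>2 * (vr * y - vl * x)" and "0 < y" "y < x" for x y
  proof (rule ccontr)
    assume "\<not> vr < vl"
    then have "vl * x \<le> vr * x" using that by (intro mult_right_mono) auto
    then have "\<sigma>\<^sup>2 * (vl * x - vr * y) \<le> \<sigma>\<^sup>2 * (vr * x - vr * y)" by (intro mult_left_mono) auto
    also have "\<dots> = \<sigma>\<^sup>2 * vr * (x - y)" by (simp add: algebra_simps)
    also have "\<dots> < \<beta>\<^sup>2 * (x - y)" using that slow by (intro mult_strict_right_mono) auto
    also have "\<dots> = \<sigma>\<^sup>2 * (vl * x - vr * y)" using j by (simp add: algebra_simps)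
    finally show False by simp
  qed
  have "\<beta>\<^sup>2 * (- Br - - Bl) = \<sigma>\<^sup>2 * (vr * - Br - vl * - Bl)" using jump by (simp add: algebra_simps)
  then show ?thesis using B *[OF jump] *[of "- Br" "- Bl"] by linarith
qed

text \<open>The second relation comes from eliminating \<open>w\<close> between the second and
  fourth components of the jump condition; the first component ties the velocity jump to the volume
  jump.\<close>

lemma rankine_hugoniot_induction:
  assumes "flux \<beta> \<gamma> Ur - flux \<beta> \<gamma> Ul = \<sigma> *\<^sub>R (Ur - Ul)" "0 < Ul$1" "0 < Ur$1"
  shows "Ul$3 - Ur$3 = \<sigma> * (Ur$1 - Ul$1)"
    "\<beta>\<^sup>2 * (magB Ur - magB Ul) = \<sigma>\<^sup>2 * (Ur$1 * magB Ur - Ul$1 * magB Ul)"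
proof -
  have c: "(flux \<beta> \<gamma> Ur - flux \<beta> \<gamma> Ul) $ i = (\<sigma> *\<^sub>R (Ur - Ul)) $ i" for i using assms(1) by simp
  show "Ul$3 - Ur$3 = \<sigma> * (Ur$1 - Ul$1)" using c[of 1] by (simp add: flux_def)
  have 2: "\<beta> * (Ul$4 - Ur$4) = \<sigma> * (Ur$2 - Ul$2)" using c[of 2] by (simp add: flux_def algebra_simps)
  have 4: "\<beta> * (magB Ul - magB Ur) = \<sigma> * (Ur$4 - Ul$4)" using c[of 4] by (simp add: flux_def algebra_simps)
  have q: "Ur$1 * magB Ur = Ur$2" "Ul$1 * magB Ul = Ul$2" using assms by (auto simp: magB_def)
  have "\<beta>\<^sup>2 * (magB Ur - magB Ul) = - \<beta> * (\<beta> * (magB Ul - magB Ur))" by (simp add: power2_eq_square algebra_simps)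
  also have "\<dots> = \<sigma> * (\<beta> * (Ul$4 - Ur$4))" unfolding 4 by (simp add: algebra_simps)
  also have "\<dots> = \<sigma>\<^sup>2 * (Ur$2 - Ul$2)" unfolding 2 by (simp add: power2_eq_square)
  finally show "\<beta>\<^sup>2 * (magB Ur - magB Ul) = \<sigma>\<^sup>2 * (Ur$1 * magB Ur - Ul$1 * magB Ul)" unfolding q .
qed

lemma alpha_fast_pos:
  assumes "1 < \<gamma>" "0 < U$1" "magB U \<noteq> 0"
  shows "0 < alpha 1 \<beta> \<gamma> U"
  unfolding alpha_fast[OF assms(1,2)] using assms by (intro fast_sq_pos) auto

text \<open>\<open>\<sigma>\<close> lies below the negative slow speed at \<open>Ul\<close>, hence
  is negative, and above the one at \<open>Ur\<close>, hence
  \<open>\<sigma>^2 v_r < \<beta>^2\<close>. The drop of the field then forces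
  \<open>v_r < v_l\<close>, and \<open>u_l - u_r = \<sigma> (v_r - v_l)\<close> is a product of two
  negative numbers.\<close>

lemma two_shock_speeds_and_velocity:
  assumes \<gamma>: "1 < \<gamma>" and \<beta>: "\<beta> \<noteq> 0" and sh: "k_shock \<beta> \<gamma> Q 2 Ul Ur \<sigma>"
    and B: "(magB Ul > magB Ur \<and> magB Ur > 0) \<or> (magB Ul < magB Ur \<and> magB Ur < 0)"
  shows "char_speed \<beta> \<gamma> 1 Ul < \<sigma>" "\<sigma> < char_speed \<beta> \<gamma> 4 Ur" "Ur$3 < Ul$3"
proof -
  have pos: "0 < Ul$1" "0 < Ur$1" and B0: "magB Ul \<noteq> 0" "magB Ur \<noteq> 0"
    and rh: "flux \<beta> \<gamma> Ur - flux \<beta> \<gamma> Ul = \<sigma> *\<^sub>R (Ur - Ul)"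
    and l1: "char_speed \<beta> \<gamma> 1 Ul < \<sigma>" and l2: "- sqrt (alpha (-1) \<beta> \<gamma> Ur) < \<sigma>" "\<sigma> < - sqrt (alpha (-1) \<beta> \<gamma> Ul)"
    using sh by (auto simp: k_shock_def phys_dom_def char_speed_def)
  have \<sigma>: "\<sigma> < 0" using l2(2) real_sqrt_gt_zero[OF slow_speed_bound(1)[OF \<gamma> \<beta> pos(1) B0(1)]] by linarith
  show "char_speed \<beta> \<gamma> 1 Ul < \<sigma>" by (rule l1)
  have "char_speed \<beta> \<gamma> 4 Ur = sqrt (alpha 1 \<beta> \<gamma> Ur)" by (simp add: char_speed_def)
  then show "\<sigma> < char_speed \<beta> \<gamma> 4 Ur"
    using \<sigma> real_sqrt_gt_zero[OF alpha_fast_pos[OF \<gamma> pos(2) B0(2), of \<beta>]] by linarith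
  have "\<sigma>\<^sup>2 * Ur$1 < \<beta>\<^sup>2" by (rule slow_speed_bound(2)[OF \<gamma> \<beta> pos(2) B0(2)]) (use l2(1) \<sigma> in linarith)
  then have "Ur$1 < Ul$1"
    by (rule volume_drops_if_field_drops[OF rankine_hugoniot_induction(2)[OF rh pos]]) (use B in auto)
  then have "0 < \<sigma> * (Ur$1 - Ul$1)" using \<sigma> by (intro mult_neg_neg) auto
  then show "Ur$3 < Ul$3" using rankine_hugoniot_induction(1)[OF rh pos] by simp
qed

text \<open>The 2-shock argument reflected: now \<open>\<sigma> > 0\<close>, the slow bound is used
  at \<open>Ul\<close>, and the volume comparison is applied with the two states exchanged.\<close>

lemma three_shock_speeds_and_velocity:
  assumes \<gamma>: "1 < \<gamma>" and \<beta>: "\<beta> \<noteq> 0" and sh: "k_shock \<beta> \<gamma> Q 3 Ul Ur \<sigma>"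
    and B: "(magB Ur > magB Ul \<and> magB Ul > 0) \<or> (magB Ur < magB Ul \<and> magB Ul < 0)"
  shows "char_speed \<beta> \<gamma> 1 Ul < \<sigma>" "\<sigma> < char_speed \<beta> \<gamma> 4 Ur" "Ur$3 < Ul$3"
proof -
  have pos: "0 < Ul$1" "0 < Ur$1" and B0: "magB Ul \<noteq> 0" "magB Ur \<noteq> 0"
    and rh: "flux \<beta> \<gamma> Ur - flux \<beta> \<gamma> Ul = \<sigma> *\<^sub>R (Ur - Ul)"
    and l4: "\<sigma> < char_speed \<beta> \<gamma> 4 Ur" and l2: "sqrt (alpha (-1) \<beta> \<gamma> Ur) < \<sigma>" "\<sigma> < sqrt (alpha (-1) \<beta> \<gamma> Ul)"
    using sh by (auto simp: k_shock_def phys_dom_def char_speed_def)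
  have \<sigma>: "0 < \<sigma>" using l2(1) real_sqrt_gt_zero[OF slow_speed_bound(1)[OF \<gamma> \<beta> pos(2) B0(2)]] by linarith
  show "\<sigma> < char_speed \<beta> \<gamma> 4 Ur" by (rule l4)
  have "char_speed \<beta> \<gamma> 1 Ul = - sqrt (alpha 1 \<beta> \<gamma> Ul)" by (simp add: char_speed_def)
  then show "char_speed \<beta> \<gamma> 1 Ul < \<sigma>"
    using \<sigma> real_sqrt_gt_zero[OF alpha_fast_pos[OF \<gamma> pos(1) B0(1), of \<beta>]] by linarith
  note rhi = rankine_hugoniot_induction[OF rh pos]
  have slow: "\<sigma>\<^sup>2 * Ul$1 < \<beta>\<^sup>2" by (rule slow_speed_bound(2)[OF \<gamma> \<beta> pos(1) B0(1)]) (use l2(2) \<sigma> in linarith)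
  have "\<beta>\<^sup>2 * (magB Ul - magB Ur) = \<sigma>\<^sup>2 * (Ul$1 * magB Ul - Ur$1 * magB Ur)"
    using rhi(2) by (simp add: algebra_simps)
  then have "Ul$1 < Ur$1" by (rule volume_drops_if_field_drops[OF _ slow]) (use B in auto)
  then have "0 < \<sigma> * (Ur$1 - Ul$1)" using \<sigma> by simp
  then show "Ur$3 < Ul$3" using rhi(1) by simp
qed

section \<open>The three ranges of the weight\<close>

lemma le_square_of_le:
  fixes x X :: real
  assumes "1 \<le> X" "X \<le> \<kappa> * x" "\<kappa> = 1 \<or> \<kappa> = -1"
  shows "X \<le> x\<^sup>2"
proof -
  have "X * 1 \<le> X * X" using assms by (intro mult_left_mono) auto
  also have "\<dots> \<le> (\<kappa> * x) * (\<kappa> * x)" using assms by (intro mult_mono) auto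
  also have "\<dots> = x\<^sup>2" using assms(3) by (auto simp: power2_eq_square)
  finally show ?thesis by simp
qed

lemma shock_not_a_contraction:
  assumes \<gamma>: "1 < \<gamma>" and Q: "is_entropy_flux \<beta> \<gamma> Q" and a: "0 < a"
    and pos: "0 < Ul$1" "0 < Ur$1" and B0: "magB Ul \<noteq> 0" "magB Ur \<noteq> 0"
    and rh: "flux \<beta> \<gamma> Ur - flux \<beta> \<gamma> Ul = \<sigma> *\<^sub>R (Ur - Ul)"
    and dissip: "Q Ur - Q Ul \<le> \<sigma> * (ent \<gamma> Ur - ent \<gamma> Ul)"
    and speeds: "char_speed \<beta> \<gamma> 1 Ul < \<sigma>" "\<sigma> < char_speed \<beta> \<gamma> 4 Ur" and u: "Ur$3 < Ul$3"
  shows "\<not> a_contraction \<beta> \<gamma> Q a Ul Ur \<sigma>"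
proof -
  have rel: "0 < rel_ent \<gamma> Ul Ur" "0 < rel_ent \<gamma> Ur Ul"
    using rel_ent_pos[OF \<gamma>] pos u by auto
  \<comment> \<open>The cases \<open>a < 1\<close> and \<open>a = 1\<close> share the 1-family curve
    from \<open>Ul\<close>. They differ only in how small \<open>v1\<close> must be for
    \<open>G\<close> to be nonnegative at its end.\<close>
  have left: "\<not> a_contraction \<beta> \<gamma> Q a Ul Ur \<sigma>" if v1: "0 < v1" "v1 < Ul$1"
    and big: "\<And>V. V$1 = v1 \<Longrightarrow> riemann_u \<gamma> v1 - riemann_u \<gamma> (Ul$1) \<le> - (V$3 - Ul$3) \<Longrightarrow> (V$2)\<^sup>2 \<le> ((magB Ul)\<^sup>2 + \<beta>\<^sup>2) * (Ul$1)\<^sup>2 \<Longrightarrow>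
       \<bar>V$4 - Ul$4\<bar> \<le> \<bar>\<beta>\<bar> * sqrt (Ul$1) / 2 * (ln (((magB Ul)\<^sup>2 + \<beta>\<^sup>2) * (Ul$1)\<^sup>2 / v1\<^sup>2) - ln ((magB Ul)\<^sup>2)) \<Longrightarrow>
       0 \<le> rel_ent \<gamma> V Ul - a * rel_ent \<gamma> V Ur" for v1
  proof -
    obtain \<Phi> \<Phi>' :: "real \<Rightarrow> real^4" and \<mu> \<mu>' :: "real \<Rightarrow> real" where c:
      "simple_wave \<beta> \<gamma> \<Phi> \<Phi>' \<mu> \<mu>'" "\<And>p. p \<in> {0..1} \<Longrightarrow> 0 \<le> - 1 * \<mu>' p"
      "\<Phi> 0 = Ul" "\<mu> 0 = - 1 * sqrt (alpha 1 \<beta> \<gamma> Ul)"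
      "\<Phi> 1 $ 1 = v1" "riemann_u \<gamma> v1 - riemann_u \<gamma> (Ul$1) \<le> - 1 * (\<Phi> 1 $ 3 - Ul$3)"
      "(\<Phi> 1 $ 2)\<^sup>2 \<le> ((magB Ul)\<^sup>2 + \<beta>\<^sup>2) * (Ul$1)\<^sup>2"
      "\<bar>\<Phi> 1 $ 4 - Ul$4\<bar> \<le> \<bar>\<beta>\<bar> * sqrt (Ul$1) / 2 * (ln (((magB Ul)\<^sup>2 + \<beta>\<^sup>2) * (Ul$1)\<^sup>2 / v1\<^sup>2) - ln ((magB Ul)\<^sup>2))"
      by (rule fast_curve[OF \<gamma> pos(1) B0(1) _ v1, of "- 1" \<beta>], simp, rule that, assumption+)
    have G1: "0 \<le> rel_ent \<gamma> (\<Phi> 1) Ul - a * rel_ent \<gamma> (\<Phi> 1) Ur"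
      by (rule big[OF c(5) _ c(7,8)]) (use c(6) in simp)
    have "\<sigma> - \<mu> 0 > 0" using speeds(1) by (simp add: c(4) char_speed_def)
    moreover have G0: "rel_ent \<gamma> (\<Phi> 0) Ul - a * rel_ent \<gamma> (\<Phi> 0) Ur < 0"
      using rel a pos by (simp add: c(3) rel_ent_self[OF \<gamma>])
    ultimately have "(\<sigma> - \<mu> 0) * (rel_ent \<gamma> (\<Phi> 0) Ul - a * rel_ent \<gamma> (\<Phi> 0) Ur) < 0"
      by (rule mult_pos_neg)
    then show ?thesis
      by (intro curve_not_a_contraction[OF \<gamma> Q a pos _ rh _ dissip c(3) c(1), of 1])
         (use c(2) G0 G1 in auto)
  qed
  consider "a < 1" | "a = 1" | "1 < a" by linarith
  then show ?thesis
  proof cases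
    case 1
    obtain C where C: "\<And>V. 0 < V$1 \<and> V$1 \<le> Ul$1 \<Longrightarrow> (1 - a) / 4 * (V$3 - Ul$3)\<^sup>2 - C \<le> rel_ent \<gamma> V Ul - a * rel_ent \<gamma> V Ur"
      using rel_ent_gap[OF \<gamma> a 1 pos] by blast
    \<comment> \<open>The size of the squared velocity difference at which
      \<open>rel_ent_gap\<close> becomes nonnegative. The maximum with 1 allows passing from a
      linear bound on the velocity to its square.\<close>
    define X where "X = max 1 (4 * C / (1 - a))"
    obtain v1 where v1: "0 < v1" "v1 < Ul$1" "(X + riemann_u \<gamma> (Ul$1)) + 0 * ln v1 < 1 * riemann_u \<gamma> v1"
      using riemann_u_dominates_log[OF \<gamma> zero_less_one pos(1)] by blast
    show ?thesis
    proof (rule left[OF v1(1,2)])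
      fix V :: "real^4" assume V: "V$1 = v1" "riemann_u \<gamma> v1 - riemann_u \<gamma> (Ul$1) \<le> - (V$3 - Ul$3)"
      have "X \<le> (V$3 - Ul$3)\<^sup>2"
        by (rule le_square_of_le[of _ "-1"]) (use V v1 in \<open>auto simp: X_def\<close>)
      then have "4 * C / (1 - a) \<le> (V$3 - Ul$3)\<^sup>2" by (simp add: X_def)
      then have "C \<le> (1 - a) / 4 * (V$3 - Ul$3)\<^sup>2" using 1 by (simp add: field_simps)
      then show "0 \<le> rel_ent \<gamma> V Ul - a * rel_ent \<gamma> V Ur" using C[of V] V v1 by auto
    qed
  next
    case 2
    obtain C where C: "\<And>V. 0 < V$1 \<and> V$1 \<le> Ul$1 \<Longrightarrow>
      (Ul$3 - Ur$3) * (Ul$3 - V$3) - \<bar>Ul$4 - Ur$4\<bar> * \<bar>V$4 - Ul$4\<bar> - \<bar>magB Ul - magB Ur\<bar> * \<bar>V$2\<bar> - C \<le> rel_ent \<gamma> V Ul - rel_ent \<gamma> V Ur"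
      using rel_ent_gap_unit[OF \<gamma> pos] by blast
    define K where "K = ((magB Ul)\<^sup>2 + \<beta>\<^sup>2) * (Ul$1)\<^sup>2"
    define k where "k = \<bar>\<beta>\<bar> * sqrt (Ul$1) / 2"
    define d where "d = Ul$3 - Ur$3"
    define D4 where "D4 = \<bar>Ul$4 - Ur$4\<bar>"
    define D2 where "D2 = \<bar>magB Ul - magB Ur\<bar>"
    have d: "0 < d" using u by (simp add: d_def)
    have K: "0 < K" unfolding K_def using B0 pos by (intro mult_pos_pos add_pos_nonneg) auto
    \<comment> \<open>The coefficient \<open>- 2 * D4 * k\<close> comes from
      \<open>ln (K / v1^2) = ln K - 2 ln v1\<close> in the bound on \<open>w\<close>. The bound on
      \<open>q\<close> and the remaining constants form the part free of \<open>v1\<close>.\<close>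
    obtain v1 where v1: "0 < v1" "v1 < Ul$1"
      "(d * riemann_u \<gamma> (Ul$1) + D4 * (k * (ln K - ln ((magB Ul)\<^sup>2))) + D2 * sqrt K + C) + (- 2 * D4 * k) * ln v1 < d * riemann_u \<gamma> v1"
      using riemann_u_dominates_log[OF \<gamma> d pos(1)] by blast
    show ?thesis
    proof (rule left[OF v1(1,2), folded K_def k_def])
      fix V :: "real^4" assume V: "V$1 = v1" "riemann_u \<gamma> v1 - riemann_u \<gamma> (Ul$1) \<le> - (V$3 - Ul$3)" "(V$2)\<^sup>2 \<le> K"
        "\<bar>V$4 - Ul$4\<bar> \<le> k * (ln (K / v1\<^sup>2) - ln ((magB Ul)\<^sup>2))"
      have "ln (K / v1\<^sup>2) = ln K - 2 * ln v1" using K v1 by (simp add: ln_div ln_realpow)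
      then have "D4 * \<bar>V$4 - Ul$4\<bar> \<le> D4 * (k * (ln K - 2 * ln v1 - ln ((magB Ul)\<^sup>2)))"
        using V(4) by (intro mult_left_mono) (auto simp: D4_def)
      also have "\<dots> = D4 * (k * (ln K - ln ((magB Ul)\<^sup>2))) + (- 2 * D4 * k) * ln v1" by (simp add: algebra_simps)
      finally have 4: "D4 * \<bar>V$4 - Ul$4\<bar> \<le> D4 * (k * (ln K - ln ((magB Ul)\<^sup>2))) + (- 2 * D4 * k) * ln v1" .
      have 2: "D2 * \<bar>V$2\<bar> \<le> D2 * sqrt K"
        using V(3) by (intro mult_left_mono real_le_rsqrt) (auto simp: D2_def)
      have "d * (riemann_u \<gamma> v1 - riemann_u \<gamma> (Ul$1)) \<le> d * (Ul$3 - V$3)" using V(2) d by (intro mult_left_mono) auto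
      then have 3: "d * riemann_u \<gamma> v1 - d * riemann_u \<gamma> (Ul$1) \<le> d * (Ul$3 - V$3)" by (simp add: right_diff_distrib)
      have "d * (Ul$3 - V$3) - D4 * \<bar>V$4 - Ul$4\<bar> - D2 * \<bar>V$2\<bar> - C \<le> rel_ent \<gamma> V Ul - rel_ent \<gamma> V Ur"
        unfolding d_def D4_def D2_def by (rule C) (use V v1 in auto)
      then show "0 \<le> rel_ent \<gamma> V Ul - a * rel_ent \<gamma> V Ur" using 2 3 4 v1(3) \<open>a = 1\<close> by simp
    qed
  next
    case 3
    \<comment> \<open>Exchanging the two states and replacing the weight by \<open>1 / a\<close>
      brings this case back to a weight below 1. Multiplying the resulting difference by
      \<open>a\<close> gives \<open>- G\<close>.\<close>
    have a': "0 < 1 / a" "1 / a < 1" using 3 by auto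
    obtain C where C: "\<And>V. 0 < V$1 \<and> V$1 \<le> Ur$1 \<Longrightarrow> (1 - 1 / a) / 4 * (V$3 - Ur$3)\<^sup>2 - C \<le> rel_ent \<gamma> V Ur - 1 / a * rel_ent \<gamma> V Ul"
      using rel_ent_gap[OF \<gamma> a' pos(2,1)] by blast
    define X where "X = max 1 (4 * C / (1 - 1 / a))"
    obtain v1 where v1: "0 < v1" "v1 < Ur$1" "(X + riemann_u \<gamma> (Ur$1)) + 0 * ln v1 < 1 * riemann_u \<gamma> v1"
      using riemann_u_dominates_log[OF \<gamma> zero_less_one pos(2)] by blast
    obtain \<Phi> \<Phi>' :: "real \<Rightarrow> real^4" and \<mu> \<mu>' :: "real \<Rightarrow> real" where c:
      "simple_wave \<beta> \<gamma> \<Phi> \<Phi>' \<mu> \<mu>'" "\<And>p. p \<in> {0..1} \<Longrightarrow> 0 \<le> 1 * \<mu>' p"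
      "\<Phi> 0 = Ur" "\<mu> 0 = 1 * sqrt (alpha 1 \<beta> \<gamma> Ur)"
      "\<Phi> 1 $ 1 = v1" "riemann_u \<gamma> v1 - riemann_u \<gamma> (Ur$1) \<le> 1 * (\<Phi> 1 $ 3 - Ur$3)"
      by (rule fast_curve[OF \<gamma> pos(2) B0(2) _ v1(1,2), of 1 \<beta>], simp, rule that, assumption+)
    have "X \<le> (\<Phi> 1 $ 3 - Ur$3)\<^sup>2"
      by (rule le_square_of_le[of _ 1]) (use c(6) v1 in \<open>auto simp: X_def\<close>)
    then have "4 * C / (1 - 1 / a) \<le> (\<Phi> 1 $ 3 - Ur$3)\<^sup>2" by (simp add: X_def)
    then have "4 * C \<le> (\<Phi> 1 $ 3 - Ur$3)\<^sup>2 * (1 - 1 / a)" using a' by (simp add: pos_divide_le_eq)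
    then have "C \<le> (1 - 1 / a) / 4 * (\<Phi> 1 $ 3 - Ur$3)\<^sup>2" by (simp add: mult.commute)
    moreover have "(1 - 1 / a) / 4 * (\<Phi> 1 $ 3 - Ur$3)\<^sup>2 - C \<le> rel_ent \<gamma> (\<Phi> 1) Ur - 1 / a * rel_ent \<gamma> (\<Phi> 1) Ul"
      by (rule C) (use c(5) v1 in auto)
    ultimately have "0 \<le> rel_ent \<gamma> (\<Phi> 1) Ur - 1 / a * rel_ent \<gamma> (\<Phi> 1) Ul" by linarith
    then have "0 \<le> a * (rel_ent \<gamma> (\<Phi> 1) Ur - 1 / a * rel_ent \<gamma> (\<Phi> 1) Ul)" using a by simp
    then have G1: "0 \<le> - 1 * (rel_ent \<gamma> (\<Phi> 1) Ul - a * rel_ent \<gamma> (\<Phi> 1) Ur)" using a by (simp add: right_diff_distrib)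
    have "\<sigma> - \<mu> 0 < 0" using speeds(2) by (simp add: c(4) char_speed_def)
    moreover have G0: "0 < rel_ent \<gamma> (\<Phi> 0) Ul - a * rel_ent \<gamma> (\<Phi> 0) Ur"
      using rel a pos by (simp add: c(3) rel_ent_self[OF \<gamma>])
    ultimately have "(\<sigma> - \<mu> 0) * (rel_ent \<gamma> (\<Phi> 0) Ul - a * rel_ent \<gamma> (\<Phi> 0) Ur) < 0"
      by (rule mult_neg_pos)
    then show ?thesis
      by (intro curve_not_a_contraction[OF \<gamma> Q a pos rh _ dissip _ c(3) c(1), of "-1"])
         (use c(2) G0 G1 in auto)
  qed
qed

theorem theorem5p2:
  fixes \<beta> \<gamma> :: real and Q :: "real^4 \<Rightarrow> real"
  assumes "\<beta> \<noteq> 0" and "1 < \<gamma>" and "is_entropy_flux \<beta> \<gamma> Q"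
  shows "(\<forall>Ul Ur \<sigma>2. k_shock \<beta> \<gamma> Q 2 Ul Ur \<sigma>2 \<and>
            ((magB Ul > magB Ur \<and> magB Ur > 0) \<or> (magB Ul < magB Ur \<and> magB Ur < 0))
            \<longrightarrow> \<not> (\<exists>a>0. a_contraction \<beta> \<gamma> Q a Ul Ur \<sigma>2))
       \<and> (\<forall>Ul Ur \<sigma>3. k_shock \<beta> \<gamma> Q 3 Ul Ur \<sigma>3 \<and>
            ((magB Ur > magB Ul \<and> magB Ul > 0) \<or> (magB Ur < magB Ul \<and> magB Ul < 0))
            \<longrightarrow> \<not> (\<exists>a>0. a_contraction \<beta> \<gamma> Q a Ul Ur \<sigma>3))"
proof -
  have basic: "0 < Ul$1 \<and> 0 < Ur$1 \<and> magB Ul \<noteq> 0 \<and> magB Ur \<noteq> 0 \<and>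
      flux \<beta> \<gamma> Ur - flux \<beta> \<gamma> Ul = \<sigma> *\<^sub>R (Ur - Ul) \<and> Q Ur - Q Ul \<le> \<sigma> * (ent \<gamma> Ur - ent \<gamma> Ul)"
    if "k_shock \<beta> \<gamma> Q k Ul Ur \<sigma>" for k Ul Ur \<sigma>
    using that by (auto simp: k_shock_def phys_dom_def)
  show ?thesis
  proof (intro conjI allI impI notI; elim exE conjE)
    fix Ul Ur \<sigma> a
    assume *: "k_shock \<beta> \<gamma> Q 2 Ul Ur \<sigma>" "0 < a" "a_contraction \<beta> \<gamma> Q a Ul Ur \<sigma>"
      and B: "(magB Ul > magB Ur \<and> magB Ur > 0) \<or> (magB Ul < magB Ur \<and> magB Ur < 0)"
    show False
      using shock_not_a_contraction[of \<gamma> \<beta> Q a Ul Ur \<sigma>] two_shock_speeds_and_velocity[OF assms(2,1) *(1) B] basic[OF *(1)] * assms by blast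
  next
    fix Ul Ur \<sigma> a
    assume *: "k_shock \<beta> \<gamma> Q 3 Ul Ur \<sigma>" "0 < a" "a_contraction \<beta> \<gamma> Q a Ul Ur \<sigma>"
      and B: "(magB Ur > magB Ul \<and> magB Ul > 0) \<or> (magB Ur < magB Ul \<and> magB Ul < 0)"
    show False
      using shock_not_a_contraction[of \<gamma> \<beta> Q a Ul Ur \<sigma>] three_shock_speeds_and_velocity[OF assms(2,1) *(1) B] basic[OF *(1)] * assms by blast
  qed
qed

end
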